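(* (1) On the space of probability distributions in $L^2(e^{x^2/2}\,dx)$ with mean $0$ and variance $1$, the standard Gaussian distribution $\chi$, as a fixed point of the classical central limit operator $T(\mu)=(\mu\ast\mu)\circ S_{1/\sqrt2}$, is strictly spectrally stable; that is, the differential of the operator $T$ at this point has its spectrum inside the (open) unit disc. (2) On the space of probability distributions in $L^2(\mathbf{1}_{[-2,2]}(t)\sqrt{4-t^2}\,dt)$ with mean $0$ and variance $1$, the standard semicircular distribution $\chi$, as a fixed point of the free central limit operator $T(\mu)=(\mu\boxplus\mu)\circ S_{1/\sqrt2}$, is strictly spectrally stable; that is, the differential of the operator $T$ at this point has its spectrum inside the (open) unit disc.
   Context: For $r>0$, $\mu\circ S_r$ is the dilation $d(\mu\circ S_r)(x)=d\mu(r^{-1}x)$; $\ast$ is the classical convolution; $\boxplus$ is the additive free convolution (the distribution of the sum of two freely independent random variables with the given distributions). The standard Gaussian has density $\frac{1}{\sqrt{2\pi}}e^{-x^2/2}$; the standard semicircular distribution has density $\frac{1}{2\pi}\sqrt{4-t^2}$ on $[-2,2]$. A measure $\mu$ is said to be in $L^2(\varphi)$ (for a weight $\varphi$) if $\mu\ll\varphi\,dx$ and $\frac{d\mu}{dx}\in L^2(\varphi)$, i.e. $\int\left|\frac{d\mu}{dx}\right|^2\varphi\,dx<\infty$. All measures in $L^2(e^{x^2/2}\,dx)$ or $L^2(\mathbf{1}_{[-2,2]}(t)\sqrt{4-t^2}\,dt)$ have finite moments of all orders. Differential of $T$. Measures with finite moments are identified with their moment sequences, elements of the space $\mathcal{M}$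 of real sequences $\{m_i\}_{i\ge1}$ with entrywise convergence. Let $\mathcal{R}:\mathcal{M}\to\mathcal{M}$, $\{m_i\}\mapsto\{c_i\}$, be the bijection to cumulants defined implicitly by $m_k=\sum_{\pi=\{B_1,\ldots,B_n\}\in\mathcal{P}(k)}\prod_j(|B_j|-1)!\,c_{|B_j|}$ over all partitions of $\{1,\ldots,k\}$ (classical case), respectively $m_k=\sum_{\pi=\{B_1,\ldots,B_n\}\in\mathcal{P}_{nc}(k)}\prod_j c_{|B_j|}$ over noncrossing partitions (free case). On $\mathcal{M}$ the operator $T$ is represented by $\mathcal{T}=\mathcal{R}^{-1}\circ\mathcal{T}^{\mathcal{R}}\circ\mathcal{R}$ with $(\mathcal{T}^{\mathcal{R}}(\mathbf{c}))_k=2^{1-k/2}c_k$. The differential of $T$ at $\chi$ is the G\^ateaux derivative $y\mapsto\lim_{\epsilon\to0}\frac{\mathcal{T}(\mathbf{m}^\chi+\epsilon y)-\mathcal{T}(\mathbf{m}^\chi)}{\epsilon}$ at the moment sequence $\mathbf{m}^\chi$ of $\chi$. It is regarded as an operator on perturbations $f$ in the corresponding Hilbert space $L^2(e^{x^2/2}\,dx)$, respectively $L^2(\mathbf{1}_{[-2,2]}(t)\sqrt{4-t^2}\,dt)$, with a density $f$ identified with its moments. On the space of probability distributions with mean $0$ and variance $1$, the admissible perturbations $f$ in the linear approximation are those whose moments of orders $0$, $1$ and $2$ vanish, so the differential is taken on this closed subspace. *)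

theory Defs
  imports
    "HOL-Probability.Probability"
    "HOL-Computational_Algebra.Polynomial"
begin

section \<open>Measures and perturbations in weighted L2 spaces\<close>

definition gauss_weight :: "real \<Rightarrow> real" where
  "gauss_weight x = exp (x\<^sup>2 / 2)"

definition semicircle_weight :: "real \<Rightarrow> real" where
  "semicircle_weight t = indicator {-2..2} t * sqrt (4 - t\<^sup>2)"

text \<open>Densities of signed measures that are absolutely continuous with respect to
  \<open>\<phi> dx\<close> (second condition) and whose density with respect to \<open>dx\<close> is square
  integrable against \<open>\<phi>\<close>. Elements are functions; equality in the Hilbert space is
  equality almost everywhere.\<close>

definition L2_weighted :: "(real \<Rightarrow> real) \<Rightarrow> (real \<Rightarrow> real) set" where
  "L2_weighted \<phi> = {f \<in> borel_measurable borel.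
     (AE x in lborel. \<phi> x = 0 \<longrightarrow> f x = 0) \<and>
     integrable lborel (\<lambda>x. (f x)\<^sup>2 * \<phi> x)}"

definition std_distributions :: "(real \<Rightarrow> real) \<Rightarrow> real measure set" where
  "std_distributions \<phi> = {\<mu>. prob_space \<mu> \<and>
     (\<exists>f \<in> L2_weighted \<phi>. (\<forall>x. 0 \<le> f x) \<and> \<mu> = density lborel (\<lambda>x. ennreal (f x))) \<and>
     (\<integral>x. x \<partial>\<mu>) = 0 \<and> (\<integral>x. x\<^sup>2 \<partial>\<mu>) = 1}"

definition admissible :: "(real \<Rightarrow> real) \<Rightarrow> (real \<Rightarrow> real) set" where
  "admissible \<phi> = {f \<in> L2_weighted \<phi>. \<forall>k\<le>2. (\<integral>x. x ^ k * f x \<partial>lborel) = 0}"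

definition std_gaussian :: "real measure" where
  "std_gaussian = density lborel (\<lambda>x. ennreal (1 / sqrt (2 * pi) * exp (- x\<^sup>2 / 2)))"

definition std_semicircle :: "real measure" where
  "std_semicircle =
     density lborel (\<lambda>t. ennreal (indicator {-2..2} t * (1 / (2 * pi) * sqrt (4 - t\<^sup>2))))"


section \<open>The central limit operators on measures\<close>

definition dilation :: "real \<Rightarrow> real measure \<Rightarrow> real measure" where
  "dilation r \<mu> = distr \<mu> borel (\<lambda>x. r * x)"

definition classical_clt :: "real measure \<Rightarrow> real measure" where
  "classical_clt \<mu> = dilation (1 / sqrt 2) (\<mu> \<star> \<mu>)"

text \<open>The joint distribution of two noncommutative random variables \<open>a\<close> (letter
  \<open>False\<close>) and \<open>b\<close> (letter \<open>True\<close>) is a linear functional on the free unital algebra on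
  two generators, that is, a function \<open>\<tau>\<close> on words. The term \<open>joint_moment \<tau> w ps\<close> is the
  value of its linear extension at \<open>w\<close> times the product over the entries \<open>(i, p)\<close> of
  \<open>ps\<close>, in this order, of the polynomial \<open>p\<close> in the generator \<open>i\<close>.\<close>

primrec joint_moment ::
  "(bool list \<Rightarrow> real) \<Rightarrow> bool list \<Rightarrow> (bool \<times> real poly) list \<Rightarrow> real" where
  "joint_moment \<tau> w [] = \<tau> w"
| "joint_moment \<tau> w (q # ps) =
     (\<Sum>k\<le>degree (snd q). coeff (snd q) k * joint_moment \<tau> (w @ replicate k (fst q)) ps)"

text \<open>Freeness: \<open>\<tau>\<close> vanishes on alternating products of centred polynomials.\<close>

definition freely_independent :: "(bool list \<Rightarrow> real) \<Rightarrow> bool" where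
  "freely_independent \<tau> \<longleftrightarrow> \<tau> [] = 1 \<and>
     (\<forall>ps. ps \<noteq> [] \<and> successively (\<lambda>q r. fst q \<noteq> fst r) ps \<and>
           (\<forall>q \<in> set ps. joint_moment \<tau> [] [q] = 0) \<longrightarrow>
           joint_moment \<tau> [] ps = 0)"

text \<open>For compactly supported probability measures \<open>\<mu>\<close>, \<open>\<nu>\<close> only: in this case
  the result is compactly supported and hence determined by its moments, which are
  those of the sum \<open>a + b\<close>.\<close>

definition free_convolution :: "real measure \<Rightarrow> real measure \<Rightarrow> real measure"
    (infixl \<open>\<boxplus>\<close> 65) where
  "\<mu> \<boxplus> \<nu> = (THE \<rho>. prob_space \<rho> \<and> sets \<rho> = sets borel \<and>
     (\<exists>R. AE x in \<rho>. \<bar>x\<bar> \<le> R) \<and>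
     (\<exists>\<tau>. freely_independent \<tau> \<and>
        (\<forall>k. \<tau> (replicate k False) = (\<integral>x. x ^ k \<partial>\<mu>)) \<and>
        (\<forall>k. \<tau> (replicate k True) = (\<integral>x. x ^ k \<partial>\<nu>)) \<and>
        (\<forall>k. (\<integral>x. x ^ k \<partial>\<rho>) = (\<Sum>w | length w = k. \<tau> w))))"

definition free_clt :: "real measure \<Rightarrow> real measure" where
  "free_clt \<mu> = dilation (1 / sqrt 2) (\<mu> \<boxplus> \<mu>)"


section \<open>The central limit operators on moment sequences\<close>

text \<open>Real sequences indexed by \<open>i \<ge> 1\<close>. Entry 0 is unused and fixed at 0, so that
  they form a linear subspace of the type \<open>nat \<Rightarrow> real\<close>, whose topology is that of
  entrywise convergence.\<close>

definition sequences :: "(nat \<Rightarrow> real) set" where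
  "sequences = {m. m 0 = 0}"

definition noncrossing :: "nat set set \<Rightarrow> bool" where
  "noncrossing P \<longleftrightarrow> \<not> (\<exists>A\<in>P. \<exists>B\<in>P. A \<noteq> B \<and>
     (\<exists>a\<in>A. \<exists>b\<in>B. \<exists>c\<in>A. \<exists>d\<in>B. a < b \<and> b < c \<and> c < d))"

definition classical_moments :: "(nat \<Rightarrow> real) \<Rightarrow> nat \<Rightarrow> real" where
  "classical_moments c k = (if k = 0 then 0 else
     \<Sum>P | partition_on {1..k} P. \<Prod>B\<in>P. fact (card B - 1) * c (card B))"

definition free_moments :: "(nat \<Rightarrow> real) \<Rightarrow> nat \<Rightarrow> real" where
  "free_moments c k = (if k = 0 then 0 else
     \<Sum>P | partition_on {1..k} P \<and> noncrossing P. \<Prod>B\<in>P. c (card B))"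

definition scale_cumulants :: "(nat \<Rightarrow> real) \<Rightarrow> nat \<Rightarrow> real" where
  "scale_cumulants c k = 2 powr (1 - real k / 2) * c k"

text \<open>The moment-to-cumulant bijection is the inverse of the given
  cumulant-to-moment map \<open>F\<close>.\<close>

definition clt_sequence ::
  "((nat \<Rightarrow> real) \<Rightarrow> nat \<Rightarrow> real) \<Rightarrow> (nat \<Rightarrow> real) \<Rightarrow> nat \<Rightarrow> real" where
  "clt_sequence F = F \<circ> scale_cumulants \<circ> the_inv_into sequences F"

definition measure_moments :: "real measure \<Rightarrow> nat \<Rightarrow> real" where
  "measure_moments \<mu> k = (if k = 0 then 0 else \<integral>x. x ^ k \<partial>\<mu>)"

definition density_moments :: "(real \<Rightarrow> real) \<Rightarrow> nat \<Rightarrow> real" where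
  "density_moments f k = (if k = 0 then 0 else \<integral>x. x ^ k * f x \<partial>lborel)"


section \<open>The differential and spectral stability\<close>

definition has_gateaux_derivative ::
  "((nat \<Rightarrow> real) \<Rightarrow> nat \<Rightarrow> real) \<Rightarrow> (nat \<Rightarrow> real) \<Rightarrow> (nat \<Rightarrow> real) \<Rightarrow> (nat \<Rightarrow> real) \<Rightarrow> bool"
where
  "has_gateaux_derivative \<T> m y d \<longleftrightarrow>
     ((\<lambda>\<epsilon>::real. (\<lambda>k. (\<T> (\<lambda>i. m i + \<epsilon> * y i) k - \<T> m k) / \<epsilon>)) \<longlongrightarrow> d) (at 0)"

text \<open>\<open>D\<close> is the differential at \<open>\<mu>\<close> of the operator represented by \<open>\<T>\<close>, as an operator
  on admissible densities. Densities are identified with their moments, which determine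
  them almost everywhere for the two weights above; so \<open>D f\<close> is unique up to null sets.\<close>

definition is_differential ::
  "((nat \<Rightarrow> real) \<Rightarrow> nat \<Rightarrow> real) \<Rightarrow> (real \<Rightarrow> real) \<Rightarrow> real measure \<Rightarrow>
   ((real \<Rightarrow> real) \<Rightarrow> real \<Rightarrow> real) \<Rightarrow> bool" where
  "is_differential \<T> \<phi> \<mu> D \<longleftrightarrow> (\<forall>f \<in> admissible \<phi>. D f \<in> admissible \<phi> \<and>
     has_gateaux_derivative \<T> (measure_moments \<mu>) (density_moments f) (density_moments (D f)))"

text \<open>The spectrum of an operator on a real Hilbert space is that of its
  complexification.\<close>

definition complex_space :: "(real \<Rightarrow> real) set \<Rightarrow> (real \<Rightarrow> complex) set" where
  "complex_space H = {f. (\<lambda>x. Re (f x)) \<in> H \<and> (\<lambda>x. Im (f x)) \<in> H}"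

definition complexification ::
  "((real \<Rightarrow> real) \<Rightarrow> real \<Rightarrow> real) \<Rightarrow> (real \<Rightarrow> complex) \<Rightarrow> real \<Rightarrow> complex" where
  "complexification D f = (\<lambda>x. Complex (D (\<lambda>t. Re (f t)) x) (D (\<lambda>t. Im (f t)) x))"

definition L2_norm :: "(real \<Rightarrow> real) \<Rightarrow> (real \<Rightarrow> complex) \<Rightarrow> real" where
  "L2_norm \<phi> f = sqrt (\<integral>x. (cmod (f x))\<^sup>2 * \<phi> x \<partial>lborel)"

text \<open>Bounded linear operators on the Hilbert space of classes modulo null sets of the
  elements of \<open>H\<close>. That \<open>A\<close> respects these classes follows from the conditions.\<close>

definition bounded_operator ::
  "(real \<Rightarrow> real) \<Rightarrow> (real \<Rightarrow> complex) set \<Rightarrow>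
   ((real \<Rightarrow> complex) \<Rightarrow> real \<Rightarrow> complex) \<Rightarrow> bool" where
  "bounded_operator \<phi> H A \<longleftrightarrow>
     (\<forall>f\<in>H. A f \<in> H) \<and>
     (\<forall>f\<in>H. \<forall>g\<in>H. \<forall>a b. AE x in lborel. A (\<lambda>t. a * f t + b * g t) x = a * A f x + b * A g x) \<and>
     (\<exists>C. \<forall>f\<in>H. L2_norm \<phi> (A f) \<le> C * L2_norm \<phi> f)"

definition resolvent_set ::
  "(real \<Rightarrow> real) \<Rightarrow> (real \<Rightarrow> complex) set \<Rightarrow>
   ((real \<Rightarrow> complex) \<Rightarrow> real \<Rightarrow> complex) \<Rightarrow> complex set" where
  "resolvent_set \<phi> H A = {z. \<exists>S. bounded_operator \<phi> H S \<and>
     (\<forall>f\<in>H. (AE x in lborel. S (\<lambda>t. z * f t - A f t) x = f x) \<and>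
             (AE x in lborel. z * S f x - A (S f) x = f x))}"

definition op_spectrum ::
  "(real \<Rightarrow> real) \<Rightarrow> (real \<Rightarrow> complex) set \<Rightarrow>
   ((real \<Rightarrow> complex) \<Rightarrow> real \<Rightarrow> complex) \<Rightarrow> complex set" where
  "op_spectrum \<phi> H A = - resolvent_set \<phi> H A"

text \<open>The first conjunct states that the differential exists. The second one
  concerns every version of it, so that it does not depend on a choice of
  representatives modulo null sets.\<close>

definition strictly_spectrally_stable ::
  "((nat \<Rightarrow> real) \<Rightarrow> nat \<Rightarrow> real) \<Rightarrow> (real \<Rightarrow> real) \<Rightarrow> real measure \<Rightarrow> bool" where
  "strictly_spectrally_stable \<T> \<phi> \<mu> \<longleftrightarrow>
     (\<exists>D. is_differential \<T> \<phi> \<mu> D) \<and>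
     (\<forall>D. is_differential \<T> \<phi> \<mu> D \<longrightarrow>
        bounded_operator \<phi> (complex_space (admissible \<phi>)) (complexification D) \<and>
        op_spectrum \<phi> (complex_space (admissible \<phi>)) (complexification D) \<subseteq> ball 0 1)"

end

theory Submission
  imports Defs "HOL-Computational_Algebra.Formal_Power_Series"
begin

text \<open>In both cases the differential is diagonal in a basis of polynomials times a fixed density. Put
  \<open>w = 1/\<phi>\<close>; then \<open>f \<mapsto> f/w\<close> identifies \<open>L\<^sup>2(\<phi>)\<close> with \<open>L\<^sup>2(w)\<close>, and the monic orthogonal polynomials
  \<open>p\<^sub>n\<close> of \<open>w\<close> (Hermite, respectively Chebyshev of the first kind) satisfy
  \<open>x\<^sup>k = (\<Sum>n\<le>k. J k n * p\<^sub>n)\<close>, where \<open>J k n\<close> counts weighted lattice paths. The cumulants of the fixed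
  point are those with \<open>c\<^sub>2 = 1\<close> and all others \<open>0\<close>, and the derivative there of the cumulant-to-moment
  map in the \<open>n\<close>-th coordinate is, up to a constant factor, the \<open>n\<close>-th column of \<open>J\<close>. Hence
  \<open>\<integral> p\<^sub>n f\<close> is a multiple of the \<open>n\<close>-th cumulant perturbation, and the differential multiplies it by
  \<open>2\<^bsup>1 - n/2\<^esup>\<close>; on admissible \<open>f\<close> only \<open>n \<ge> 3\<close> occurs. Densities in \<open>L\<^sup>2(\<phi>)\<close> are determined by
  their moments, because their Fourier transforms are given by the moment series, so this determines
  the differential. The eigenvalues decay geometrically, which makes the eigenfunction expansions of
  the differential and of \<open>z\<close> times its resolvent minus the identity absolutely convergent; no
  Riesz-Fischer theorem is needed.

  For free convolution, left multiplication on the full Fock space gives an explicit joint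
  distribution of two free semicircular variables, and freeness determines the joint distribution
  uniquely.\<close>

section \<open>Measures determined by their moments\<close>

text \<open>The differential is given only through moment sequences and up to null sets. Therefore
  \<open>D f\<close> is never handled directly: being a differential is shown equivalent to the
  identities \<open>rcoef n (D f) = eigenvalue n * rcoef n f\<close>, and operator identities are
  checked on coefficients. The scaling of cumulants is linear and fixes the cumulants of the fixed
  point, since its factor at order 2 is 1. Hence the differential is the scaling conjugated by the
  derivative of the cumulant-to-moment map. For the inverse map it suffices to know
  differentiability; the value of its derivative follows from the unit triangularity of
  \<open>J\<close>. The factors at orders 0, 1, 2 are 2, sqrt 2, 1; without them the largest one is
  1 / sqrt 2, which is the spectral gap. The polynomials are those of 1 / \<phi>, an unnormalized
  Gaussian, respectively arcsine, density. The semicircle density itself belongs to Chebyshev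
  polynomials of the second kind, so its moments have to be related to the first kind. Since
  \<open>inverse 0 = 0\<close>, the function 1 / \<phi> is 0 wherever \<phi> is.\<close>

lemma integral_fourier_moments:
  fixes g :: "real \<Rightarrow> complex"
  assumes [measurable]: "g \<in> borel_measurable M" "(\<lambda>x. x) \<in> borel_measurable M"
    and exp: "\<And>s. integrable M (\<lambda>x. exp (s * \<bar>x\<bar>) * cmod (g x))"
  shows "(\<lambda>k. (\<i> * of_real t) ^ k / fact k * (\<integral>x. of_real (x ^ k) * g x \<partial>M)) sums
           (\<integral>x. exp (\<i> * of_real (t * x)) * g x \<partial>M)"
proof -
  define F where "F k x = (\<i> * of_real t) ^ k / fact k * (of_real (x ^ k) * g x)" for k x
  have nF: "norm (F k x) = inverse (fact k) * (\<bar>t\<bar> * \<bar>x\<bar>) ^ k * cmod (g x)" for k x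
    by (simp add: F_def norm_mult norm_divide norm_power power_mult_distrib power_abs divide_inverse norm_inverse)
  have term_le: "inverse (fact k) * (\<bar>t\<bar> * \<bar>x\<bar>) ^ k \<le> exp (\<bar>t\<bar> * \<bar>x\<bar>)" for k x
    using sum_le_suminf[OF summable_exp_generic[of "\<bar>t\<bar> * \<bar>x\<bar>"], of "{k}"] by (simp add: exp_def)
  have [measurable]: "F k \<in> borel_measurable M" for k
    unfolding F_def by measurable
  have F_int: "integrable M (F k)" for k
    by (rule Bochner_Integration.integrable_bound[OF exp[of "\<bar>t\<bar>"]])
       (auto simp: nF intro!: mult_right_mono term_le)
  have sm: "(\<lambda>k. norm (F k x)) sums (exp (\<bar>t\<bar> * \<bar>x\<bar>) * cmod (g x))" for x
    unfolding nF using exp_converges[of "\<bar>t\<bar> * \<bar>x\<bar>"] by (intro sums_mult2) simp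
  \<comment> \<open>The partial sums of the norms stay below
    \<open>exp (\<bar>t\<bar> * \<bar>x\<bar>) * cmod (g x)\<close>, which is integrable by the
    hypothesis; this justifies termwise integration of the exponential series.\<close>
  have "summable (\<lambda>k. \<integral>x. norm (F k x) \<partial>M)"
  proof (rule bounded_imp_summable)
    fix n
    have "(\<Sum>k\<le>n. \<integral>x. norm (F k x) \<partial>M) = (\<integral>x. (\<Sum>k\<le>n. norm (F k x)) \<partial>M)"
      using F_int by (subst Bochner_Integration.integral_sum) auto
    also have "\<dots> \<le> (\<integral>x. exp (\<bar>t\<bar> * \<bar>x\<bar>) * cmod (g x) \<partial>M)"
      using sm by (intro integral_mono exp Bochner_Integration.integrable_sum integrable_norm F_int)
        (metis finite_atMost norm_ge_zero sum_le_suminf sums_iff)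
    finally show "(\<Sum>k\<le>n. \<integral>x. norm (F k x) \<partial>M) \<le> (\<integral>x. exp (\<bar>t\<bar> * \<bar>x\<bar>) * cmod (g x) \<partial>M)" .
  qed simp
  moreover have "AE x in M. summable (\<lambda>k. norm (F k x))"
    using sm sums_summable by blast
  ultimately have "(\<lambda>k. \<integral>x. F k x \<partial>M) sums (\<integral>x. (\<Sum>k. F k x) \<partial>M)"
    using F_int by (intro sums_integral)
  moreover have "(\<Sum>k. F k x) = exp (\<i> * of_real (t * x)) * g x" for x
  proof -
    have "(\<lambda>k. (\<i> * of_real (t * x)) ^ k /\<^sub>R fact k * g x) sums (exp (\<i> * of_real (t * x)) * g x)"
      by (intro sums_mult2 exp_converges)
    moreover have "(\<i> * of_real (t * x)) ^ k /\<^sub>R fact k * g x = F k x" for k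
      by (simp add: F_def scaleR_conv_of_real power_mult_distrib field_simps)
    ultimately show ?thesis by (simp add: sums_iff)
  qed
  moreover have "(\<integral>x. F k x \<partial>M) = (\<i> * of_real t) ^ k / fact k * (\<integral>x. of_real (x ^ k) * g x \<partial>M)" for k
    unfolding F_def by (rule integral_mult_right_zero)
  ultimately show ?thesis by simp
qed

text \<open>Exponential moments of every order make the characteristic function equal to its moment
  series on the whole line, so equal moments give equal characteristic functions.\<close>

lemma prob_measure_eqI_moments:
  fixes M N :: "real measure"
  assumes "prob_space M" "sets M = sets borel" "\<And>s. integrable M (\<lambda>x. exp (s * \<bar>x\<bar>))"
    and "prob_space N" "sets N = sets borel" "\<And>s. integrable N (\<lambda>x. exp (s * \<bar>x\<bar>))"
    and eq: "\<And>k. (\<integral>x. x ^ k \<partial>M) = (\<integral>x. x ^ k \<partial>N)"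
  shows "M = N"
proof (rule Levy_uniqueness)
  show "real_distribution M" "real_distribution N"
    using assms by (auto simp: real_distribution_def real_distribution_axioms_def)
  have [measurable_cong]: "sets M = sets borel" "sets N = sets borel" by fact+
  show "char M = char N"
  proof
    fix t
    have "(\<lambda>k. (\<i> * of_real t) ^ k / fact k * (\<integral>x. of_real (x ^ k) * 1 \<partial>L)) sums
           (\<integral>x. exp (\<i> * of_real (t * x)) * 1 \<partial>L)" if "L = M \<or> L = N" for L
      using that assms by (intro integral_fourier_moments) auto
    from this[of M] this[of N] show "char M t = char N t"
      using eq by (simp add: char_def sums_iff integral_complex_of_real del: of_real_power of_real_mult)
  qed
qed

text \<open>The uniqueness theorem concerns probability measures, whereas \<open>f\<close> is
  signed. The positive and negative parts have the same mass \<open>c\<close> by the moment of order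
  0, and divided by \<open>c\<close> they have the same moments. So they agree almost everywhere,
  and as they are never both positive, both vanish.\<close>

lemma AE_eq_0_if_moments_0:
  fixes f :: "real \<Rightarrow> real"
  assumes [measurable]: "f \<in> borel_measurable borel"
    and exp: "\<And>s. integrable lborel (\<lambda>x. exp (s * \<bar>x\<bar>) * \<bar>f x\<bar>)"
    and mom: "\<And>k. (\<integral>x. x ^ k * f x \<partial>lborel) = 0"
  shows "AE x in lborel. f x = 0"
proof -
  define fp where "fp x = max 0 (f x)" for x
  define fm where "fm x = max 0 (- f x)" for x
  have [measurable]: "fp \<in> borel_measurable borel" "fm \<in> borel_measurable borel"
    unfolding fp_def fm_def by measurable
  have nn: "fp x \<ge> 0" "fm x \<ge> 0" "f x = fp x - fm x" "\<bar>fp x\<bar> \<le> \<bar>f x\<bar>" "\<bar>fm x\<bar> \<le> \<bar>f x\<bar>" for x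
    by (auto simp: fp_def fm_def max_def)
  have ie: "integrable lborel (\<lambda>x. exp (s * \<bar>x\<bar>) * fp x)" "integrable lborel (\<lambda>x. exp (s * \<bar>x\<bar>) * fm x)" for s
    by (rule Bochner_Integration.integrable_bound[OF exp[of s]]; auto simp: abs_mult nn(4,5) intro!: mult_left_mono)+
  have i0: "integrable lborel fp" "integrable lborel fm" using ie[of 0] by auto
  have pow_le: "\<bar>x\<bar> ^ k \<le> fact k * exp (1 * \<bar>x\<bar>)" for x :: real and k
    using sum_le_suminf[OF summable_exp_generic[of "\<bar>x\<bar>"], of "{k}"] by (simp add: exp_def field_simps)
  have ik: "integrable lborel (\<lambda>x. x ^ k * fp x)" "integrable lborel (\<lambda>x. x ^ k * fm x)" for k
  proof -
    have *: "integrable lborel (\<lambda>x. x ^ k * h x)" if [measurable]: "h \<in> borel_measurable borel"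
      and "integrable lborel (\<lambda>x. exp (1 * \<bar>x\<bar>) * h x)" "\<And>x. h x \<ge> 0" for h :: "real \<Rightarrow> real"
    proof (rule Bochner_Integration.integrable_bound[OF integrable_mult_right[OF that(2), of "fact k"]])
      show "AE x in lborel. norm (x ^ k * h x) \<le> norm (fact k * (exp (1 * \<bar>x\<bar>) * h x))"
        using that(3) pow_le by (auto simp: abs_mult power_abs mult.assoc[symmetric] intro!: mult_right_mono)
    qed measurable
    show "integrable lborel (\<lambda>x. x ^ k * fp x)" "integrable lborel (\<lambda>x. x ^ k * fm x)"
      using *[OF _ ie(1)[of 1]] *[OF _ ie(2)[of 1]] nn by auto
  qed
  have meq: "(\<integral>x. x ^ k * fp x \<partial>lborel) = (\<integral>x. x ^ k * fm x \<partial>lborel)" for k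
    using mom[of k] ik[of k] by (simp add: nn(3) algebra_simps)
  define c where "c = (\<integral>x. fp x \<partial>lborel)"
  have c: "c = (\<integral>x. fm x \<partial>lborel)" using meq[of 0] by (simp add: c_def)
  have fp0: "AE x in lborel. fp x = 0" 
  proof (cases "c = 0")
    case True
    then show ?thesis using i0 nn by (simp add: c_def integral_nonneg_eq_0_iff_AE)
  next
    case False
    then have c0: "c > 0" using nn by (simp add: c_def integral_nonneg order_less_le)
    define P where "P h = density lborel (\<lambda>x. ennreal (h x / c))" for h :: "real \<Rightarrow> real"
    have prob: "prob_space (P h)" and sets: "sets (P h) = sets borel"
      and iexp: "integrable (P h) (\<lambda>x. exp (s * \<bar>x\<bar>))"
      and moms: "(\<integral>x. x ^ k \<partial>P h) = (\<integral>x. x ^ k * h x \<partial>lborel) / c"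
      if [measurable]: "h \<in> borel_measurable borel" and "\<And>x. h x \<ge> 0" "integrable lborel h"
        "(\<integral>x. h x \<partial>lborel) = c" "\<And>s. integrable lborel (\<lambda>x. exp (s * \<bar>x\<bar>) * h x)" for h s k
    proof -
      show "prob_space (P h)" unfolding P_def
        using that c0 by (intro prob_spaceI) (simp add: emeasure_density nn_integral_eq_integral)
      show "sets (P h) = sets borel" by (simp add: P_def)
      show "integrable (P h) (\<lambda>x. exp (s * \<bar>x\<bar>))"
        using that c0 unfolding P_def by (subst integrable_density) (auto simp: mult.commute)
      show "(\<integral>x. x ^ k \<partial>P h) = (\<integral>x. x ^ k * h x \<partial>lborel) / c"
        using that c0 unfolding P_def by (subst integral_density) (auto simp: mult.commute)
    qed
    have "P fp = P fm"
      using i0 c nn ie meq by (intro prob_measure_eqI_moments prob sets iexp) (auto simp: moms c_def)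
    then have "AE x in lborel. ennreal (fp x / c) = ennreal (fm x / c)"
      unfolding P_def by (intro sigma_finite_measure.density_unique[OF sigma_finite_lborel]) auto
    then show ?thesis
    proof eventually_elim
      case (elim x)
      then have "fp x = fm x" using c0 nn[of x] by simp
      then show ?case by (auto simp: fp_def fm_def max_def split: if_splits)
    qed
  qed
  moreover have "AE x in lborel. fm x = 0"
  proof -
    have "c = 0" unfolding c_def using fp0 by (rule integral_eq_zero_AE)
    then show ?thesis using c i0(2) nn(2) by (simp add: integral_nonneg_eq_0_iff_AE)
  qed
  ultimately show ?thesis by eventually_elim (simp add: nn)
qed

section \<open>Orthogonal polynomials\<close>

text \<open>Three-term recurrence of the monic orthogonal polynomials of an even weight, which is
  why no diagonal coefficient occurs. \<open>\<beta> n\<close> is the quotient of the squared norms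
  at n and n - 1.\<close>

fun orth_poly :: "(nat \<Rightarrow> real) \<Rightarrow> nat \<Rightarrow> real \<Rightarrow> real" where
  "orth_poly \<beta> 0 x = 1"
| "orth_poly \<beta> (Suc 0) x = x"
| "orth_poly \<beta> (Suc (Suc n)) x = x * orth_poly \<beta> (Suc n) x - \<beta> (Suc n) * orth_poly \<beta> n x"

text \<open>Total weight of the nonnegative paths of \<open>k\<close> up or down steps from height 0
  to height \<open>n\<close>, where up steps weigh 1 and a step down from height j weighs
  \<open>\<beta> j\<close>. The recursion removes the last step.\<close>

primrec path_weight :: "(nat \<Rightarrow> real) \<Rightarrow> nat \<Rightarrow> nat \<Rightarrow> real" where
  "path_weight \<beta> 0 = (\<lambda>n. if n = 0 then 1 else 0)"
| "path_weight \<beta> (Suc k) = (\<lambda>n. (case n of 0 \<Rightarrow> 0 | Suc j \<Rightarrow> path_weight \<beta> k j)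
     + \<beta> (Suc n) * path_weight \<beta> k (Suc n))"

lemma path_weight_eq_0: "k < n \<Longrightarrow> path_weight \<beta> k n = 0"
  by (induction k arbitrary: n) (auto split: nat.split)

lemma path_weight_diag [simp]: "path_weight \<beta> n n = 1"
  by (induction n) (auto simp: path_weight_eq_0)

lemma mult_orth_poly:
  "x * orth_poly \<beta> n x = orth_poly \<beta> (Suc n) x + (case n of 0 \<Rightarrow> 0 | Suc j \<Rightarrow> \<beta> n * orth_poly \<beta> j x)"
  by (cases n) auto

text \<open>Multiplication by x acts on the polynomials through the Jacobi matrix, and the recursion
  of \<open>path_weight\<close> is the induced action on coefficients.\<close>

lemma power_eq_sum_orth_poly: "x ^ k = (\<Sum>n\<le>k. path_weight \<beta> k n * orth_poly \<beta> n x)"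
proof (induction k)
  case (Suc k)
  let ?J = "path_weight \<beta>" and ?p = "\<lambda>n. orth_poly \<beta> n x"
  have "x ^ Suc k = (\<Sum>n\<le>k. ?J k n * (x * ?p n))"
    by (simp add: Suc sum_distrib_left mult_ac)
  also have "\<dots> = (\<Sum>n\<le>k. ?J k n * ?p (Suc n))
      + (\<Sum>n\<le>k. ?J k n * (case n of 0 \<Rightarrow> 0 | Suc j \<Rightarrow> \<beta> n * ?p j))"
    by (simp only: mult_orth_poly sum.distrib distrib_left)
  \<comment> \<open>The added terms vanish; with them, the shift of the index by one ends exactly at
    \<open>Suc k\<close>.\<close>
  also have "(\<Sum>n\<le>k. ?J k n * (case n of 0 \<Rightarrow> 0 | Suc j \<Rightarrow> \<beta> n * ?p j))
      = (\<Sum>n\<le>Suc (Suc k). ?J k n * (case n of 0 \<Rightarrow> 0 | Suc j \<Rightarrow> \<beta> n * ?p j))"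
    by (simp add: path_weight_eq_0)
  also have "\<dots> = (\<Sum>n\<le>Suc k. \<beta> (Suc n) * ?J k (Suc n) * ?p n)"
    by (subst sum.atMost_Suc_shift) (simp add: mult_ac)
  also have "(\<Sum>n\<le>k. ?J k n * ?p (Suc n)) = (\<Sum>n\<le>Suc k. (case n of 0 \<Rightarrow> 0 | Suc j \<Rightarrow> ?J k j) * ?p n)"
    by (subst sum.atMost_Suc_shift) simp
  finally show ?case by (simp only: path_weight.simps sum.distrib[symmetric] distrib_right)
qed simp

section \<open>Functions of at most exponential growth\<close>

definition exp_bounded :: "(real \<Rightarrow> real) \<Rightarrow> bool" where
  "exp_bounded q \<longleftrightarrow> q \<in> borel_measurable borel \<and> (\<exists>C s. \<forall>x. \<bar>q x\<bar> \<le> C * exp (s * \<bar>x\<bar>))"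

lemma exp_boundedE:
  assumes "exp_bounded q"
  obtains C s where "C \<ge> 0" "s \<ge> 0" "\<And>x. \<bar>q x\<bar> \<le> C * exp (s * \<bar>x\<bar>)"
proof -
  obtain C s where q: "\<And>x. \<bar>q x\<bar> \<le> C * exp (s * \<bar>x\<bar>)" using assms by (auto simp: exp_bounded_def)
  have "\<bar>q x\<bar> \<le> \<bar>C\<bar> * exp (\<bar>s\<bar> * \<bar>x\<bar>)" for x
    by (rule order_trans[OF q]) (intro mult_mono, auto intro: mult_right_mono)
  then show thesis by (intro that[of "\<bar>C\<bar>" "\<bar>s\<bar>"]) auto
qed

lemma exp_bounded_measurable [measurable_dest]: "exp_bounded q \<Longrightarrow> q \<in> borel_measurable borel"
  by (simp add: exp_bounded_def)

lemma exp_bounded_exp: "exp_bounded (\<lambda>x. exp (s * \<bar>x\<bar>))"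
  unfolding exp_bounded_def by (intro conjI exI[of _ 1] exI[of _ s]) auto

lemma exp_bounded_const: "exp_bounded (\<lambda>x. c)"
  unfolding exp_bounded_def by (intro conjI exI[of _ "\<bar>c\<bar>"] exI[of _ 0]) auto

lemma exp_bounded_ident: "exp_bounded (\<lambda>x. x)"
  unfolding exp_bounded_def
  by (intro conjI exI[of _ 1] exI[of _ 1]) (auto intro: order_trans[OF _ exp_ge_add_one_self])

lemma exp_bounded_mult:
  assumes "exp_bounded q" "exp_bounded r"
  shows "exp_bounded (\<lambda>x. q x * r x)"
proof -
  note [measurable] = assms
  obtain C s D t where *: "C \<ge> 0" "\<And>x. \<bar>q x\<bar> \<le> C * exp (s * \<bar>x\<bar>)" "D \<ge> 0" "\<And>x. \<bar>r x\<bar> \<le> D * exp (t * \<bar>x\<bar>)"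
    using assms by (metis exp_boundedE)
  have "\<bar>q x * r x\<bar> \<le> (C * D) * exp ((s + t) * \<bar>x\<bar>)" for x
    using mult_mono[OF *(2,4), of x x] *(1) unfolding distrib_right[of s t] exp_add by (simp add: abs_mult mult_ac)
  then show ?thesis unfolding exp_bounded_def by auto
qed

lemma exp_bounded_add:
  assumes "exp_bounded q" "exp_bounded r"
  shows "exp_bounded (\<lambda>x. q x + r x)"
proof -
  note [measurable] = assms
  obtain C s D t where *: "C \<ge> 0" "s \<ge> 0" "\<And>x. \<bar>q x\<bar> \<le> C * exp (s * \<bar>x\<bar>)"
      "D \<ge> 0" "t \<ge> 0" "\<And>x. \<bar>r x\<bar> \<le> D * exp (t * \<bar>x\<bar>)"
    using assms by (metis exp_boundedE)
  have "\<bar>q x + r x\<bar> \<le> (C + D) * exp ((s + t) * \<bar>x\<bar>)" for x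
  proof -
    have "C * exp (s * \<bar>x\<bar>) \<le> C * exp ((s + t) * \<bar>x\<bar>)" "D * exp (t * \<bar>x\<bar>) \<le> D * exp ((s + t) * \<bar>x\<bar>)"
      using * by (intro mult_left_mono; simp add: mult_right_mono)+
    then show ?thesis using *(3,6)[of x] abs_triangle_ineq[of "q x" "r x"]
      by (simp only: distrib_right[of C D])
  qed
  then show ?thesis unfolding exp_bounded_def by auto
qed

lemma exp_bounded_power: "exp_bounded q \<Longrightarrow> exp_bounded (\<lambda>x. q x ^ k)"
  by (induction k) (auto intro: exp_bounded_const exp_bounded_mult)

lemma exp_bounded_abs: "exp_bounded q \<Longrightarrow> exp_bounded (\<lambda>x. \<bar>q x\<bar>)"
  by (auto simp: exp_bounded_def)

lemma exp_bounded_orth_poly: "exp_bounded (orth_poly \<beta> n)"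
proof -
  have "exp_bounded (\<lambda>x. orth_poly \<beta> n x)"
  proof (induction n rule: induct_nat_012)
    case (ge2 n)
    have "exp_bounded (\<lambda>x. x * orth_poly \<beta> (Suc n) x + (- \<beta> (Suc n)) * orth_poly \<beta> n x)"
      by (intro exp_bounded_add exp_bounded_mult exp_bounded_const exp_bounded_ident ge2)
    then show ?case by simp
  qed (auto intro: exp_bounded_const exp_bounded_ident)
  then show ?thesis by simp
qed

text \<open>Polynomials and exponentials lie in one class closed under sums and products, so
  integrability against the weight can later be derived from the shape of the integrand
  alone.\<close>

lemmas exp_bounded_intros = exp_bounded_exp exp_bounded_const exp_bounded_ident exp_bounded_mult
  exp_bounded_add exp_bounded_power exp_bounded_abs exp_bounded_orth_poly

lemma borel_measurable_orth_poly [measurable]: "orth_poly \<beta> n \<in> borel_measurable borel"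
  using exp_bounded_orth_poly exp_bounded_measurable by blast

text \<open>\<open>weight_moments\<close> expresses through moments that \<open>\<beta>\<close>
  holds the recurrence coefficients of 1 / \<phi>; orthogonality is derived from it.
  \<open>W\<close> is the total mass. \<open>integrable_exp\<close> is what makes elements of the
  Hilbert space determined by their moments.\<close>

locale orthogonal_weight =
  fixes \<phi> :: "real \<Rightarrow> real" and \<beta> :: "nat \<Rightarrow> real" and W :: real
  assumes weight_measurable [measurable]: "\<phi> \<in> borel_measurable borel"
    and weight_nonneg: "\<phi> x \<ge> 0"
    and integrable_exp: "integrable lborel (\<lambda>x. exp (s * \<bar>x\<bar>) * inverse (\<phi> x))"
    and \<beta>_pos: "\<beta> (Suc n) > 0"
    and W_pos: "W > 0"
    and weight_moments: "(\<integral>x. x ^ k * inverse (\<phi> x) \<partial>lborel) = W * path_weight \<beta> k 0"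
begin

abbreviation "w x \<equiv> inverse (\<phi> x)"
abbreviation "p \<equiv> orth_poly \<beta>"
abbreviation "J \<equiv> path_weight \<beta>"
abbreviation "H2 \<equiv> complex_space (L2_weighted \<phi>)"

text \<open>The squared norm of \<open>p n\<close> in the space with weight \<open>w\<close>, by
  \<open>orthogonality\<close>.\<close>

definition h :: "nat \<Rightarrow> real" where "h n = W * (\<Prod>i<n. \<beta> (Suc i))"

text \<open>The inner product of \<open>p n\<close> and f / w in the space with weight
  \<open>w\<close>; there the two factors \<open>w\<close> cancel.\<close>

definition coef :: "nat \<Rightarrow> (real \<Rightarrow> complex) \<Rightarrow> complex" where
  "coef n f = (\<integral>x. of_real (p n x) * f x \<partial>lborel)"

definition rcoef :: "nat \<Rightarrow> (real \<Rightarrow> real) \<Rightarrow> real" where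
  "rcoef n f = (\<integral>x. p n x * f x \<partial>lborel)"

lemma h_pos: "h n > 0"
  using W_pos \<beta>_pos by (simp add: h_def prod_pos)

lemma w_nonneg: "w x \<ge> 0" using weight_nonneg by simp

lemma integrable_exp_bounded: 
  assumes "exp_bounded q" shows "integrable lborel (\<lambda>x. q x * w x)"
proof -
  note [measurable] = assms
  obtain C s where q: "\<And>x. \<bar>q x\<bar> \<le> C * exp (s * \<bar>x\<bar>)" "C \<ge> 0"
    using assms by (metis exp_boundedE)
  show ?thesis
  proof (rule Bochner_Integration.integrable_bound[OF integrable_mult_right[OF integrable_exp[of s], of C]])
    show "AE x in lborel. norm (q x * w x) \<le> norm (C * (exp (s * \<bar>x\<bar>) * w x))"
      using q w_nonneg weight_nonneg by (auto simp: abs_mult mult.assoc[symmetric] intro!: mult_right_mono)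
  qed measurable
qed

text \<open>Induction along the three-term recurrence, for all \<open>k\<close> at once because a
  factor x moves into the power. The step is the recursion of \<open>path_weight\<close> solved for
  the entry at height \<open>Suc (Suc n)\<close>, with
  \<open>h (Suc n) = \<beta> (Suc n) * h n\<close>.\<close>

lemma integral_power_orth_poly: "(\<integral>x. x ^ k * p n x * w x \<partial>lborel) = h n * J k n"
proof (induction n arbitrary: k rule: induct_nat_012)
  case 0 show ?case by (simp add: weight_moments h_def)
next
  case 1
  show ?case using weight_moments[of "Suc k"] by (simp add: h_def mult_ac)
next
  case (ge2 n)
  have "(\<integral>x. x ^ k * p (Suc (Suc n)) x * w x \<partial>lborel)
      = (\<integral>x. x ^ Suc k * p (Suc n) x * w x - \<beta> (Suc n) * (x ^ k * p n x * w x) \<partial>lborel)"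
    by (intro Bochner_Integration.integral_cong) (auto simp: algebra_simps)
  also have "\<dots> = (\<integral>x. x ^ Suc k * p (Suc n) x * w x \<partial>lborel) - \<beta> (Suc n) * (\<integral>x. x ^ k * p n x * w x \<partial>lborel)"
    by (subst Bochner_Integration.integral_diff) (auto intro!: integrable_exp_bounded integrable_mult_right exp_bounded_intros simp del: power_Suc)
  also have "\<dots> = h (Suc n) * J (Suc k) (Suc n) - \<beta> (Suc n) * (h n * J k n)"
    unfolding ge2 ..
  also have "\<dots> = h (Suc (Suc n)) * J k (Suc (Suc n))"
    by (simp add: h_def algebra_simps)
  finally show ?case .
qed

text \<open>By unit triangularity of \<open>J\<close>, \<open>p m\<close> is the m-th power minus a
  combination of the \<open>p j\<close> with j < m, whose integrals are known by induction.\<close>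

lemma orthogonality: "(\<integral>x. p m x * p n x * w x \<partial>lborel) = (if m = n then h n else 0)"
proof (induction m rule: less_induct)
  case (less m)
  have int: "integrable lborel (\<lambda>x. c * (p j x * p n x * w x))" for c j
    by (intro integrable_mult_right integrable_exp_bounded exp_bounded_intros)
  have "h n * J m n = (\<integral>x. (\<Sum>j\<le>m. J m j * (p j x * p n x * w x)) \<partial>lborel)"
    by (subst integral_power_orth_poly[symmetric], subst power_eq_sum_orth_poly[where \<beta>=\<beta>])
       (simp add: sum_distrib_right sum_distrib_left mult_ac)
  also have "\<dots> = (\<Sum>j\<le>m. J m j * (\<integral>x. p j x * p n x * w x \<partial>lborel))"
    using int by (subst Bochner_Integration.integral_sum) auto
  also have "\<dots> = (\<integral>x. p m x * p n x * w x \<partial>lborel) + (\<Sum>j<m. J m j * (if j = n then h n else 0))"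
    using less by (simp add: lessThan_Suc_atMost[symmetric])
  also have "(\<Sum>j<m. J m j * (if j = n then h n else 0)) = (if n < m then J m n * h n else 0)"
    by (simp add: if_distrib[of "(*) _"] cong: if_cong)
  finally show ?case
    by (cases m n rule: linorder_cases) (auto simp: path_weight_eq_0)
qed

lemma H2_iff:
  "f \<in> H2 \<longleftrightarrow> f \<in> borel_measurable borel \<and> (AE x in lborel. \<phi> x = 0 \<longrightarrow> f x = 0)
     \<and> integrable lborel (\<lambda>x. (cmod (f x))\<^sup>2 * \<phi> x)" (is "_ \<longleftrightarrow> ?R")
proof
  assume "f \<in> H2"
  then have *: "(\<lambda>x. Re (f x)) \<in> L2_weighted \<phi>" "(\<lambda>x. Im (f x)) \<in> L2_weighted \<phi>"
    by (auto simp: complex_space_def)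
  then have m: "f \<in> borel_measurable borel"
    by (simp add: borel_measurable_complex_iff L2_weighted_def)
  moreover from * have "AE x in lborel. \<phi> x = 0 \<longrightarrow> Re (f x) = 0" "AE x in lborel. \<phi> x = 0 \<longrightarrow> Im (f x) = 0"
    by (auto simp: L2_weighted_def)
  then have "AE x in lborel. \<phi> x = 0 \<longrightarrow> f x = 0"
    by eventually_elim (auto simp: complex_eq_iff)
  moreover have "integrable lborel (\<lambda>x. (Re (f x))\<^sup>2 * \<phi> x + (Im (f x))\<^sup>2 * \<phi> x)"
    using * by (intro Bochner_Integration.integrable_add) (auto simp: L2_weighted_def)
  ultimately show ?R by (simp add: cmod_power2 distrib_right)
next
  assume R: ?R
  then have [measurable]: "f \<in> borel_measurable borel" by simp
  from R have i: "integrable lborel (\<lambda>x. (cmod (f x))\<^sup>2 * \<phi> x)" by simp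
  have "integrable lborel (\<lambda>x. (Re (f x))\<^sup>2 * \<phi> x)"
    by (rule Bochner_Integration.integrable_bound[OF i])
      (auto simp: abs_mult cmod_power2 weight_nonneg intro!: mult_right_mono AE_I2)
  moreover have "integrable lborel (\<lambda>x. (Im (f x))\<^sup>2 * \<phi> x)"
    by (rule Bochner_Integration.integrable_bound[OF i])
      (auto simp: abs_mult cmod_power2 weight_nonneg intro!: mult_right_mono AE_I2)
  ultimately show "f \<in> H2"
    using R by (auto simp: complex_space_def L2_weighted_def elim!: eventually_mono)
qed

lemma H2_measurable: "f \<in> H2 \<Longrightarrow> f \<in> borel_measurable borel"
  and H2_AE: "f \<in> H2 \<Longrightarrow> AE x in lborel. \<phi> x = 0 \<longrightarrow> f x = 0"
  and H2_integrable: "f \<in> H2 \<Longrightarrow> integrable lborel (\<lambda>x. (cmod (f x))\<^sup>2 * \<phi> x)"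
  by (simp_all add: H2_iff)

lemma L2_norm_nonneg: "L2_norm \<phi> f \<ge> 0" by (simp add: L2_norm_def weight_nonneg)

lemma L2_norm_power2: "(L2_norm \<phi> f)\<^sup>2 = (\<integral>x. (cmod (f x))\<^sup>2 * \<phi> x \<partial>lborel)"
  by (simp add: L2_norm_def weight_nonneg)

lemma cmod_sum_power2_le: "(cmod (u + v))\<^sup>2 \<le> 2 * (cmod u)\<^sup>2 + 2 * (cmod v)\<^sup>2"
proof -
  have "(cmod (u + v))\<^sup>2 \<le> (cmod u + cmod v)\<^sup>2" by (intro power_mono norm_triangle_ineq) auto
  also have "\<dots> \<le> 2 * (cmod u)\<^sup>2 + 2 * (cmod v)\<^sup>2"
    using zero_le_power2[of "cmod u - cmod v"] by (simp add: power2_eq_square algebra_simps)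
  finally show ?thesis .
qed

lemma H2_add: 
  assumes "f \<in> H2" "g \<in> H2" 
  shows "(\<lambda>x. f x + g x) \<in> H2" "(L2_norm \<phi> (\<lambda>x. f x + g x))\<^sup>2 \<le> 2 * (L2_norm \<phi> f)\<^sup>2 + 2 * (L2_norm \<phi> g)\<^sup>2"
proof -
  note [measurable] = assms[THEN H2_measurable]
  have i: "integrable lborel (\<lambda>x. 2 * ((cmod (f x))\<^sup>2 * \<phi> x) + 2 * ((cmod (g x))\<^sup>2 * \<phi> x))"
    using assms by (intro Bochner_Integration.integrable_add integrable_mult_right H2_integrable)
  have le: "(cmod (f x + g x))\<^sup>2 * \<phi> x \<le> 2 * ((cmod (f x))\<^sup>2 * \<phi> x) + 2 * ((cmod (g x))\<^sup>2 * \<phi> x)" for x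
    using mult_right_mono[OF cmod_sum_power2_le[of "f x" "g x"] weight_nonneg[of x]] by (simp add: algebra_simps)
  have j: "integrable lborel (\<lambda>x. (cmod (f x + g x))\<^sup>2 * \<phi> x)"
    by (rule Bochner_Integration.integrable_bound[OF i])
       (use le in \<open>auto simp: abs_mult weight_nonneg\<close>)
  moreover have "AE x in lborel. \<phi> x = 0 \<longrightarrow> f x + g x = 0"
    using H2_AE[OF assms(1)] H2_AE[OF assms(2)] by eventually_elim auto
  ultimately show "(\<lambda>x. f x + g x) \<in> H2" by (simp add: H2_iff)
  have "(L2_norm \<phi> (\<lambda>x. f x + g x))\<^sup>2 \<le> (\<integral>x. 2 * ((cmod (f x))\<^sup>2 * \<phi> x) + 2 * ((cmod (g x))\<^sup>2 * \<phi> x) \<partial>lborel)"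
    unfolding L2_norm_power2 using le i j by (intro integral_mono) auto
  then show "(L2_norm \<phi> (\<lambda>x. f x + g x))\<^sup>2 \<le> 2 * (L2_norm \<phi> f)\<^sup>2 + 2 * (L2_norm \<phi> g)\<^sup>2"
    using assms by (simp add: L2_norm_power2 H2_integrable)
qed

lemma H2_mult: 
  assumes "f \<in> H2" 
  shows "(\<lambda>x. c * f x) \<in> H2" "L2_norm \<phi> (\<lambda>x. c * f x) = cmod c * L2_norm \<phi> f"
proof -
  have "(\<lambda>x. (cmod (c * f x))\<^sup>2 * \<phi> x) = (\<lambda>x. (cmod c)\<^sup>2 * ((cmod (f x))\<^sup>2 * \<phi> x))"
    by (simp add: norm_mult power_mult_distrib mult_ac)
  moreover note assms
  ultimately show "(\<lambda>x. c * f x) \<in> H2" "L2_norm \<phi> (\<lambda>x. c * f x) = cmod c * L2_norm \<phi> f"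
    by (auto simp: H2_iff L2_norm_def real_sqrt_mult elim!: eventually_mono)
qed

text \<open>Cauchy-Schwarz in the form of a family of additive inequalities: expanding the square of
  \<open>t * \<bar>q x\<bar> - cmod (f x) * \<phi> x\<close> and dividing by
  \<open>t * \<phi> x\<close> gives the pointwise bound. Where \<phi> vanishes, f does so almost
  everywhere. Integrability of the product comes out of the same bound.\<close>

lemma H2_pair:
  assumes f: "f \<in> H2" and q: "exp_bounded q"
  shows "integrable lborel (\<lambda>x. of_real (q x) * f x)"
    and "t > 0 \<Longrightarrow> 2 * cmod (\<integral>x. of_real (q x) * f x \<partial>lborel)
           \<le> t * (\<integral>x. (q x)\<^sup>2 * w x \<partial>lborel) + (L2_norm \<phi> f)\<^sup>2 / t"
proof -
  note [measurable] = H2_measurable[OF f] q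
  have i: "integrable lborel (\<lambda>x. (q x)\<^sup>2 * w x)"
    by (intro integrable_exp_bounded exp_bounded_intros q)
  have i': "integrable lborel (\<lambda>x. t * ((q x)\<^sup>2 * w x) + (cmod (f x))\<^sup>2 * \<phi> x / t)" for t
    using i H2_integrable[OF f] by simp
  have le: "AE x in lborel. 2 * cmod (of_real (q x) * f x) \<le> t * ((q x)\<^sup>2 * w x) + (cmod (f x))\<^sup>2 * \<phi> x / t"
    if "t > 0" for t
    using H2_AE[OF f]
  proof eventually_elim
    case (elim x)
    show ?case
    proof (cases "\<phi> x = 0")
      case False
      then have pos: "\<phi> x > 0" using weight_nonneg[of x] by simp
      have "0 \<le> (t * \<bar>q x\<bar> - cmod (f x) * \<phi> x)\<^sup>2 / (t * \<phi> x)" using pos that by simp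
      also have "\<dots> = t * ((q x)\<^sup>2 * w x) + (cmod (f x))\<^sup>2 * \<phi> x / t - 2 * cmod (of_real (q x) * f x)"
        using pos that by (simp add: power2_diff norm_mult field_simps power2_eq_square abs_mult_self_eq)
      finally show ?thesis by simp
    qed (use elim in auto)
  qed
  show int: "integrable lborel (\<lambda>x. of_real (q x) * f x)"
  proof (rule Bochner_Integration.integrable_bound[OF i'[of 1]])
    show "AE x in lborel. norm (of_real (q x) * f x) \<le> norm (1 * ((q x)\<^sup>2 * w x) + (cmod (f x))\<^sup>2 * \<phi> x / 1)"
      using le[OF zero_less_one] 
    proof eventually_elim
      case (elim x)
      then show ?case using norm_ge_zero[of "of_real (q x) * f x"] by simp
    qed
  qed measurable
  assume t: "t > 0"
  have "2 * cmod (\<integral>x. of_real (q x) * f x \<partial>lborel) \<le> 2 * (\<integral>x. cmod (of_real (q x) * f x) \<partial>lborel)"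
    by (simp add: integral_norm_bound)
  also have "\<dots> = (\<integral>x. 2 * cmod (of_real (q x) * f x) \<partial>lborel)" by simp
  also have "\<dots> \<le> (\<integral>x. t * ((q x)\<^sup>2 * w x) + (cmod (f x))\<^sup>2 * \<phi> x / t \<partial>lborel)"
    using int by (intro integral_mono_AE i' le t integrable_mult_right integrable_norm)
  also have "\<dots> = t * (\<integral>x. (q x)\<^sup>2 * w x \<partial>lborel) + (L2_norm \<phi> f)\<^sup>2 / t"
    using i H2_integrable[OF f] by (simp add: L2_norm_power2)
  finally show "2 * cmod (\<integral>x. of_real (q x) * f x \<partial>lborel)
           \<le> t * (\<integral>x. (q x)\<^sup>2 * w x \<partial>lborel) + (L2_norm \<phi> f)\<^sup>2 / t" .
qed

text \<open>The choice \<open>t = B / sqrt (h n)\<close> balances the two terms of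
  \<open>H2_pair\<close>. If B = 0 this is not positive, and \<open>t = e / h n\<close> with
  arbitrary e > 0 is used instead.\<close>

lemma coef_le:
  assumes f: "f \<in> H2"
  shows "cmod (coef n f) \<le> sqrt (h n) * L2_norm \<phi> f"
proof -
  define I where "I = cmod (coef n f)"
  define B where "B = L2_norm \<phi> f"
  have le: "2 * I \<le> t * h n + B\<^sup>2 / t" if "t > 0" for t
    using H2_pair(2)[OF f exp_bounded_orth_poly that, of \<beta> n] orthogonality[of n n]
    by (simp add: I_def B_def coef_def power2_eq_square)
  have B: "B \<ge> 0" by (simp add: B_def L2_norm_nonneg)
  have hp: "h n > 0" "sqrt (h n) > 0" using h_pos by auto
  show ?thesis
  proof (cases "B = 0")
    case True
    have "2 * I \<le> e" if "e > 0" for e using le[of "e / h n"] True hp that by simp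
    then have "2 * I \<le> 0" using field_le_epsilon[of "2 * I" 0] by auto
    then show ?thesis using B hp by (simp add: I_def B_def[symmetric] True)
  next
    case False
    then have "B > 0" using B by simp
    have "h n = sqrt (h n) * sqrt (h n)" using hp by simp
    then have "B / sqrt (h n) * h n = B * sqrt (h n)" "B\<^sup>2 / (B / sqrt (h n)) = B * sqrt (h n)"
      using hp \<open>B > 0\<close> by (auto simp: field_simps power2_eq_square)
    then show ?thesis using le[of "B / sqrt (h n)"] hp \<open>B > 0\<close> by (simp add: I_def B_def mult_ac)
  qed
qed

lemma coef_add: "f \<in> H2 \<Longrightarrow> g \<in> H2 \<Longrightarrow> coef n (\<lambda>x. f x + g x) = coef n f + coef n g"
  by (simp add: coef_def distrib_left H2_pair(1) exp_bounded_orth_poly)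

lemma coef_mult: "coef n (\<lambda>x. c * f x) = c * coef n f"
  by (simp add: coef_def mult.left_commute)

lemma coef_Complex:
  assumes "f \<in> H2"
  shows "coef n f = Complex (rcoef n (\<lambda>x. Re (f x))) (rcoef n (\<lambda>x. Im (f x)))"
  using H2_pair(1)[OF assms exp_bounded_orth_poly[of \<beta> n]]
  by (simp add: complex_eq_iff coef_def rcoef_def integral_Re[symmetric] integral_Im[symmetric])

lemma L2_weighted_H2: "f \<in> L2_weighted \<phi> \<Longrightarrow> (\<lambda>x. complex_of_real (f x)) \<in> H2"
  by (auto simp: complex_space_def L2_weighted_def)

lemma L2_weighted_pair:
  assumes f: "f \<in> L2_weighted \<phi>" and q: "exp_bounded q"
  shows "integrable lborel (\<lambda>x. q x * f x)"
  using integrable_Re[OF H2_pair(1)[OF L2_weighted_H2[OF f] q]] by simp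

lemma moment_eq:
  assumes f: "f \<in> L2_weighted \<phi>"
  shows "(\<integral>x. x ^ k * f x \<partial>lborel) = (\<Sum>n\<le>k. J k n * rcoef n f)"
proof -
  have "(\<integral>x. x ^ k * f x \<partial>lborel) = (\<integral>x. (\<Sum>n\<le>k. J k n * (p n x * f x)) \<partial>lborel)"
    by (subst power_eq_sum_orth_poly[where \<beta>=\<beta>]) (simp add: sum_distrib_right sum_distrib_left mult_ac)
  also have "\<dots> = (\<Sum>n\<le>k. J k n * rcoef n f)"
    using L2_weighted_pair[OF f exp_bounded_orth_poly]
    by (subst Bochner_Integration.integral_sum) (auto simp: rcoef_def)
  finally show ?thesis .
qed

text \<open>Completeness of the polynomials: vanishing coefficients mean vanishing moments by
  \<open>moment_eq\<close>. Real and imaginary parts are treated separately, as the moment theorem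
  is about real functions.\<close>

lemma AE_eq_0_if_coef_0:
  assumes f: "f \<in> H2" and 0: "\<And>n. coef n f = 0"
  shows "AE x in lborel. f x = 0"
proof -
  have "AE x in lborel. g x = 0" if g: "g \<in> L2_weighted \<phi>" "\<And>n. rcoef n g = 0" for g
  proof (rule AE_eq_0_if_moments_0)
    show m: "g \<in> borel_measurable borel" using g by (auto simp: L2_weighted_def)
    show "integrable lborel (\<lambda>x. exp (s * \<bar>x\<bar>) * \<bar>g x\<bar>)" for s
      using integrable_abs[OF L2_weighted_pair[OF g(1) exp_bounded_exp[of s]]] by (simp add: abs_mult)
    show "(\<integral>x. x ^ k * g x \<partial>lborel) = 0" for k using g by (simp add: moment_eq)
  qed
  from this[of "\<lambda>x. Re (f x)"] this[of "\<lambda>x. Im (f x)"]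
  have "AE x in lborel. Re (f x) = 0" "AE x in lborel. Im (f x) = 0"
    using f 0 coef_Complex[OF f] by (auto simp: complex_space_def complex_eq_iff)
  then show ?thesis by eventually_elim (simp add: complex_eq_iff)
qed

text \<open>This reduces linearity and both resolvent equations to comparisons of
  coefficients.\<close>

lemma AE_eq_if_coef_eq:
  assumes f: "f \<in> H2" "g \<in> H2" and eq: "\<And>n. coef n f = coef n g"
  shows "AE x in lborel. f x = g x"
proof -
  have m: "(\<lambda>x. (-1) * g x) \<in> H2" by (intro H2_mult f)
  have "AE x in lborel. f x + (-1) * g x = 0"
    by (intro AE_eq_0_if_coef_0 H2_add f m) (simp only: coef_add[OF f(1) m] coef_mult, simp add: eq)
  then show ?thesis by eventually_elim simp
qed

lemma L2_norm_cong_AE: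
  "f \<in> H2 \<Longrightarrow> g \<in> H2 \<Longrightarrow> AE x in lborel. f x = g x \<Longrightarrow> L2_norm \<phi> f = L2_norm \<phi> g"
  unfolding L2_norm_def using H2_measurable[of f] H2_measurable[of g]
  by (intro arg_cong[of _ _ sqrt] integral_cong_AE) (auto elim!: eventually_mono)

end

section \<open>Expansions with geometrically decaying coefficients\<close>

context orthogonal_weight
begin

definition series :: "(nat \<Rightarrow> complex) \<Rightarrow> real \<Rightarrow> complex" where
  "series a x = (\<Sum>n. a n * of_real (p n x)) * of_real (w x)"

lemma borel_measurable_series [measurable]: "series a \<in> borel_measurable borel"
  unfolding series_def by measurable

text \<open>Each \<open>(p n x)\<^sup>2 / h n * w x\<close> integrates to 1, so exchanging sum and
  integral leaves the geometric series. For Hermite polynomials, \<open>G\<close> is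
  \<open>w\<close> times the diagonal of Mehler's kernel.\<close>

lemma geometric_dominant:
  assumes r: "0 \<le> r" "r < 1"
  defines "G \<equiv> \<lambda>x. \<Sum>n. r ^ n * ((p n x)\<^sup>2 / h n * w x)"
  shows "AE x in lborel. summable (\<lambda>n. r ^ n * ((p n x)\<^sup>2 / h n * w x))"
    and "integrable lborel G" "(\<integral>x. G x \<partial>lborel) = 1 / (1 - r)"
proof -
  define F where "F n x = r ^ n * ((p n x)\<^sup>2 / h n * w x)" for n x
  have nn: "F n x \<ge> 0" for n x using r h_pos[of n] weight_nonneg by (simp add: F_def)
  have [measurable]: "F n \<in> borel_measurable borel" for n unfolding F_def by measurable
  have int: "integrable lborel (F n)" for n
    using integrable_mult_right[OF integrable_exp_bounded[OF exp_bounded_power[OF exp_bounded_orth_poly[of \<beta> n], of 2]], of "r ^ n / h n"]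
    by (simp add: F_def[abs_def])
  have "(\<integral>x. F n x \<partial>lborel) = (\<integral>x. (r ^ n / h n) * (p n x * p n x * w x) \<partial>lborel)" for n
    by (simp add: F_def power2_eq_square)
  then have I: "(\<integral>x. F n x \<partial>lborel) = r ^ n" for n
    using h_pos[of n] by (simp only: integral_mult_right_zero orthogonality) simp
  have "(\<integral>\<^sup>+x. (\<Sum>n. ennreal (F n x)) \<partial>lborel) = (\<Sum>n. \<integral>\<^sup>+x. ennreal (F n x) \<partial>lborel)"
    by (intro nn_integral_suminf) auto
  also have "\<dots> = (\<Sum>n. ennreal (r ^ n))"
    using int nn by (subst nn_integral_eq_integral) (auto simp: I)
  also have "\<dots> = ennreal (1 / (1 - r))"
    using r by (subst suminf_ennreal_eq[OF _ geometric_sums]) auto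
  finally have "(\<integral>\<^sup>+x. (\<Sum>n. ennreal (F n x)) \<partial>lborel) \<noteq> \<infinity>" by simp
  then have "AE x in lborel. (\<Sum>n. ennreal (F n x)) \<noteq> \<infinity>"
    by (intro nn_integral_PInf_AE) auto
  then have ae: "AE x in lborel. summable (\<lambda>n. F n x)"
    by eventually_elim (auto intro!: summable_suminf_not_top nn)
  then show "AE x in lborel. summable (\<lambda>n. r ^ n * ((p n x)\<^sup>2 / h n * w x))" by (simp only: F_def)
  have ae': "AE x in lborel. summable (\<lambda>n. norm (F n x))" using ae nn by simp
  have sm: "summable (\<lambda>n. \<integral>x. norm (F n x) \<partial>lborel)" using r nn by (simp add: I)
  have G: "G = (\<lambda>x. \<Sum>n. F n x)" by (simp add: G_def F_def)
  show "integrable lborel G" unfolding G using int ae' sm by (rule integrable_suminf)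
  show "(\<integral>x. G x \<partial>lborel) = 1 / (1 - r)"
    unfolding G using sums_integral[OF int ae' sm] geometric_sums[of r] r
    by (auto simp: I intro: sums_unique2)
qed

text \<open>The decay is split as \<open>r ^ n = \<rho> ^ n * sqrt (r ^ n)\<close> with
  \<open>\<rho> = sqrt r\<close>. The first factor makes the sum over n converge; the second one
  bounds the normalized n-th polynomial times \<open>sqrt (w x)\<close> by
  \<open>sqrt (G x)\<close>. The series is thus dominated pointwise by a multiple of the square root
  of an integrable function, which gives membership and the norm bound.\<close>

lemma series:
  assumes r: "0 \<le> r" "r < 1" and a: "\<And>n. cmod (a n) * sqrt (h n) \<le> K * r ^ n"
  shows "series a \<in> H2"
    and "L2_norm \<phi> (series a) \<le> K / (1 - sqrt r) * sqrt (1 / (1 - r))"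
    and "coef n (series a) = a n * h n"
proof -
  define G where "G = (\<lambda>x. \<Sum>n. r ^ n * ((p n x)\<^sup>2 / h n * w x))"
  note G = geometric_dominant[OF r, folded G_def]
  define \<rho> where "\<rho> = sqrt r"
  have \<rho>: "0 \<le> \<rho>" "\<rho> < 1" "r = \<rho>\<^sup>2" "r ^ n = \<rho> ^ n * sqrt (r ^ n)" for n
    using r by (auto simp: \<rho>_def real_sqrt_power power_mult_distrib[symmetric])
  have K: "K \<ge> 0" using a[of 0] h_pos[of 0] by (auto intro: order_trans[rotated])
  have term_nonneg: "0 \<le> r ^ i * ((p i x)\<^sup>2 / h i * w x)" for i x
    using r h_pos[of i] weight_nonneg by simp
  have term_bound: "cmod (a n * of_real (p n x)) * sqrt (w x) \<le> K * \<rho> ^ n * sqrt (G x)"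
    if sm: "summable (\<lambda>n. r ^ n * ((p n x)\<^sup>2 / h n * w x))" for n x
  proof -
    have hn: "h n > 0" "sqrt (h n) > 0" using h_pos by auto
    have "cmod (a n * of_real (p n x)) * sqrt (w x)
        = cmod (a n) * sqrt (h n) * (\<bar>p n x\<bar> / sqrt (h n) * sqrt (w x))"
      using hn by (simp add: norm_mult)
    also have "\<dots> \<le> K * r ^ n * (\<bar>p n x\<bar> / sqrt (h n) * sqrt (w x))"
      using hn w_nonneg weight_nonneg by (intro mult_right_mono a) simp
    also have "\<dots> = K * \<rho> ^ n * (sqrt (r ^ n) * (\<bar>p n x\<bar> / sqrt (h n) * sqrt (w x)))"
      by (subst \<rho>(4)) simp
    also have "sqrt (r ^ n) * (\<bar>p n x\<bar> / sqrt (h n) * sqrt (w x)) = sqrt (r ^ n * ((p n x)\<^sup>2 / h n * w x))"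
      by (simp add: real_sqrt_mult real_sqrt_divide)
    also have "\<dots> \<le> sqrt (G x)"
      using sum_le_suminf[OF sm, of "{n}"] term_nonneg by (simp add: G_def)
    finally show ?thesis using K \<rho> by (simp add: mult_left_mono)
  qed
  have geo: "summable (\<lambda>n. K * \<rho> ^ n * c)" "(\<Sum>n. K * \<rho> ^ n * c) = K / (1 - \<rho>) * c" for c
  proof -
    have "(\<lambda>n. K * \<rho> ^ n * c) sums (K * (1 / (1 - \<rho>)) * c)"
      using \<rho> by (intro sums_mult sums_mult2 geometric_sums) simp
    then show "summable (\<lambda>n. K * \<rho> ^ n * c)" "(\<Sum>n. K * \<rho> ^ n * c) = K / (1 - \<rho>) * c"
      by (auto simp: sums_iff)
  qed
  have sm_abs: "summable (\<lambda>n. cmod (a n * of_real (p n x)) * sqrt (w x))"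
    if sm: "summable (\<lambda>n. r ^ n * ((p n x)\<^sup>2 / h n * w x))" for x
    by (rule summable_comparison_test'[OF geo(1)[of "sqrt (G x)"]])
       (use term_bound[OF sm] w_nonneg weight_nonneg in \<open>auto simp: norm_mult abs_mult\<close>)
  have le: "(cmod (series a x))\<^sup>2 * \<phi> x \<le> (K / (1 - \<rho>))\<^sup>2 * G x"
    if sm: "summable (\<lambda>n. r ^ n * ((p n x)\<^sup>2 / h n * w x))" for x
  proof (cases "\<phi> x = 0")
    case True
    have "G x = 0" by (simp add: G_def True)
    then show ?thesis by (simp add: True)
  next
    case False
    then have pos: "\<phi> x > 0" "w x > 0" using weight_nonneg[of x] by auto
    then have sn: "summable (\<lambda>n. cmod (a n * of_real (p n x)))"
      using summable_mult2[OF sm_abs[OF sm], of "inverse (sqrt (w x))"] by (simp add: field_simps)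
    have "cmod (\<Sum>n. a n * of_real (p n x)) * sqrt (w x) \<le> (\<Sum>n. cmod (a n * of_real (p n x))) * sqrt (w x)"
      using pos by (intro mult_right_mono summable_norm sn) auto
    also have "\<dots> = (\<Sum>n. cmod (a n * of_real (p n x)) * sqrt (w x))"
      by (rule suminf_mult2[OF sn])
    also have "\<dots> \<le> (\<Sum>n. K * \<rho> ^ n * sqrt (G x))"
      by (intro suminf_le term_bound sm_abs sm geo)
    also have "\<dots> = K / (1 - \<rho>) * sqrt (G x)" by (rule geo)
    finally have "(cmod (\<Sum>n. a n * of_real (p n x)) * sqrt (w x))\<^sup>2 \<le> (K / (1 - \<rho>) * sqrt (G x))\<^sup>2"
      using pos by (intro power_mono) auto
    moreover have "G x \<ge> 0"
      unfolding G_def by (intro suminf_nonneg sm term_nonneg)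
    ultimately have "(cmod (\<Sum>n. a n * of_real (p n x)))\<^sup>2 * w x \<le> (K / (1 - \<rho>))\<^sup>2 * G x"
      using pos by (simp add: power_mult_distrib power_divide)
    moreover have "(cmod (series a x))\<^sup>2 * \<phi> x = (cmod (\<Sum>n. a n * of_real (p n x)))\<^sup>2 * w x"
    proof -
      have "(cmod (series a x))\<^sup>2 * \<phi> x = (cmod (\<Sum>n. a n * of_real (p n x)))\<^sup>2 * (w x * (w x * \<phi> x))"
        using pos by (simp add: series_def norm_mult norm_inverse power_mult_distrib power2_eq_square mult_ac)
      also have "w x * \<phi> x = 1" using pos by simp
      finally show ?thesis by simp
    qed
    ultimately show ?thesis by simp
  qed
  have leAE: "AE x in lborel. (cmod (series a x))\<^sup>2 * \<phi> x \<le> (K / (1 - \<rho>))\<^sup>2 * G x"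
    using G(1) by eventually_elim (rule le)
  have int: "integrable lborel (\<lambda>x. (cmod (series a x))\<^sup>2 * \<phi> x)"
  proof (rule Bochner_Integration.integrable_bound[OF integrable_mult_right[OF G(2), of "(K / (1 - \<rho>))\<^sup>2"]])
    show "AE x in lborel. norm ((cmod (series a x))\<^sup>2 * \<phi> x) \<le> norm ((K / (1 - \<rho>))\<^sup>2 * G x)"
      using leAE by eventually_elim (auto simp: weight_nonneg)
  qed measurable
  then show S: "series a \<in> H2" by (simp add: H2_iff series_def)
  have "(L2_norm \<phi> (series a))\<^sup>2 \<le> (\<integral>x. (K / (1 - \<rho>))\<^sup>2 * G x \<partial>lborel)"
    unfolding L2_norm_power2 by (intro integral_mono_AE int integrable_mult_right G leAE)
  also have "\<dots> = (K / (1 - \<rho>))\<^sup>2 * (1 / (1 - r))"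
    using G(3) by simp
  also have "\<dots> = (K / (1 - \<rho>) * sqrt (1 / (1 - r)))\<^sup>2"
    using r by (simp only: power_mult_distrib) simp
  finally show "L2_norm \<phi> (series a) \<le> K / (1 - sqrt r) * sqrt (1 / (1 - r))"
    unfolding \<rho>_def using K r by (rule_tac power2_le_imp_le) auto
  define F where "F m x = of_real (p n x) * (a m * of_real (p m x)) * of_real (w x)" for m x
  have intpp: "integrable lborel (\<lambda>x. p i x * p j x * w x)" for i j
    by (intro integrable_exp_bounded exp_bounded_intros)
  have [measurable]: "F m \<in> borel_measurable borel" for m
    unfolding F_def by measurable
  have Feq: "F m = (\<lambda>x. a m * of_real (p n x * p m x * w x))" for m
    by (auto simp: F_def mult_ac)
  have intF: "integrable lborel (F m)" for m
    unfolding Feq using intpp by (intro integrable_mult_right integrable_of_real)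
  \<comment> \<open>Cauchy-Schwarz for \<open>p n\<close> and \<open>p m\<close> in the space with
    weight \<open>w\<close>, obtained from 2 A B \<le> A A + B B for the polynomials divided by
    their norms.\<close>
  have normF: "(\<integral>x. norm (F m x) \<partial>lborel) \<le> sqrt (h n) * (K * r ^ m)" for m
  proof -
    have hp: "h n > 0" "h m > 0" "sqrt (h n) > 0" "sqrt (h m) > 0" using h_pos by auto
    have pp: "\<bar>p n x * p m x\<bar> * w x \<le> sqrt (h n) * sqrt (h m) / 2 * (p n x * p n x * w x / h n + p m x * p m x * w x / h m)" for x
    proof -
      define A where "A = \<bar>p n x\<bar> / sqrt (h n)"
      define B where "B = \<bar>p m x\<bar> / sqrt (h m)"
      have AB: "\<bar>p n x\<bar> = A * sqrt (h n)" "\<bar>p m x\<bar> = B * sqrt (h m)"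
        "p n x * p n x / h n = A * A" "p m x * p m x / h m = B * B"
        using hp by (auto simp: A_def B_def)
      have "2 * (A * B) \<le> A * A + B * B"
        using zero_le_power2[of "A - B"] by (simp add: power2_eq_square algebra_simps)
      then have "sqrt (h n) * sqrt (h m) / 2 * w x * (2 * (A * B)) \<le> sqrt (h n) * sqrt (h m) / 2 * w x * (A * A + B * B)"
        using hp w_nonneg weight_nonneg by (intro mult_left_mono) auto
      then show ?thesis unfolding AB(3,4)[symmetric] by (simp add: abs_mult AB(1,2) algebra_simps)
    qed
    have 1: "(\<integral>x. norm (F m x) \<partial>lborel) = cmod (a m) * (\<integral>x. \<bar>p n x * p m x\<bar> * w x \<partial>lborel)"
      unfolding integral_mult_right_zero[symmetric]
      using weight_nonneg by (intro Bochner_Integration.integral_cong) (auto simp: Feq norm_mult abs_mult norm_inverse)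
    have "(\<integral>x. \<bar>p n x * p m x\<bar> * w x \<partial>lborel)
        \<le> (\<integral>x. sqrt (h n) * sqrt (h m) / 2 * (p n x * p n x * w x / h n + p m x * p m x * w x / h m) \<partial>lborel)"
      using pp by (intro integral_mono integrable_exp_bounded exp_bounded_intros integrable_mult_right
         Bochner_Integration.integrable_add integrable_divide intpp) auto
    also have "\<dots> = sqrt (h n) * sqrt (h m)"
      using intpp hp by (simp add: orthogonality Bochner_Integration.integral_add)
    finally have "(\<integral>x. norm (F m x) \<partial>lborel) \<le> cmod (a m) * (sqrt (h n) * sqrt (h m))"
      unfolding 1 by (rule mult_left_mono) simp
    also have "\<dots> \<le> sqrt (h n) * (K * r ^ m)"
      using mult_left_mono[OF a[of m], of "sqrt (h n)"] hp by (simp add: mult_ac)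
    finally show ?thesis .
  qed
  have smF: "summable (\<lambda>m. \<integral>x. norm (F m x) \<partial>lborel)"
  proof (rule summable_comparison_test')
    show "summable (\<lambda>m. sqrt (h n) * (K * r ^ m))" using r by (intro summable_mult summable_geometric) auto
  qed (use normF in \<open>auto simp: abs_of_nonneg\<close>)
  have aeF: "AE x in lborel. summable (\<lambda>m. norm (F m x))"
    using G(1)
  proof eventually_elim
    case (elim x)
    have "summable (\<lambda>m. cmod (a m * of_real (p m x)) * sqrt (w x) * (\<bar>p n x\<bar> * sqrt (w x)))"
      by (intro summable_mult2 sm_abs elim)
    moreover have "norm (F m x) = cmod (a m * of_real (p m x)) * sqrt (w x) * (\<bar>p n x\<bar> * sqrt (w x))" for m
    proof -
      have "norm (F m x) = cmod (a m * of_real (p m x)) * \<bar>p n x\<bar> * w x"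
        using weight_nonneg[of x] by (simp add: F_def norm_mult norm_inverse mult_ac)
      moreover have "sqrt (w x) * sqrt (w x) = w x" using weight_nonneg by simp
      ultimately show ?thesis by (metis mult.assoc mult.commute)
    qed
    ultimately show ?case by simp
  qed
  have "(\<lambda>m. \<integral>x. F m x \<partial>lborel) sums (\<integral>x. (\<Sum>m. F m x) \<partial>lborel)"
    by (rule sums_integral[OF intF aeF smF])
  moreover have "(\<integral>x. F m x \<partial>lborel) = (if m = n then a n * h n else 0)" for m
  proof -
    have "(\<integral>x. F m x \<partial>lborel) = a m * of_real (\<integral>x. p n x * p m x * w x \<partial>lborel)"
      unfolding Feq integral_mult_right_zero integral_complex_of_real ..
    then show ?thesis by (simp add: orthogonality)
  qed
  moreover have "(\<lambda>m. if m = n then a n * h n else 0) sums (a n * h n)"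
    by (rule sums_single)
  ultimately have "(\<integral>x. (\<Sum>m. F m x) \<partial>lborel) = a n * h n"
    by (simp add: sums_iff)
  moreover have "(\<integral>x. (\<Sum>m. F m x) \<partial>lborel) = coef n (series a)"
    unfolding coef_def
  proof (intro integral_cong_AE)
    show "AE x in lborel. (\<Sum>m. F m x) = of_real (p n x) * series a x"
      using G(1)
    proof eventually_elim
      case (elim x)
      show ?case
      proof (cases "\<phi> x = 0")
        case False
        then have pos: "w x > 0" using weight_nonneg[of x] by auto
        then have sn: "summable (\<lambda>n. cmod (a n * of_real (p n x)))"
          using summable_mult2[OF sm_abs[OF elim], of "inverse (sqrt (w x))"] by (simp add: field_simps)
        then have "(\<Sum>m. F m x) = of_real (p n x) * (\<Sum>m. a m * of_real (p m x)) * of_real (w x)"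
          unfolding F_def
          by (rule sums_unique[OF sums_mult2[OF sums_mult[OF summable_sums[OF summable_norm_cancel]]], symmetric])
        then show ?thesis by (simp add: series_def mult_ac)
      qed (simp add: F_def series_def)
    qed
  qed measurable
  ultimately show "coef n (series a) = a n * h n" by simp
qed

end

section \<open>Operators diagonal in the orthogonal polynomials\<close>

definition eigenvalue :: "nat \<Rightarrow> real" where
  "eigenvalue n = 2 powr (1 - real n / 2)"

lemma two_powr_neg_half: "2 powr (- 1 / 2) = 1 / sqrt (2 :: real)"
  using powr_minus_divide[of 2 "1 / 2 :: real"] by (simp add: powr_half_sqrt)

text \<open>Geometric form of the eigenvalues, which supplies M = 2 and r = 1 / sqrt 2 for the
  multiplier bounds.\<close>

lemma eigenvalue_eq: "eigenvalue n = 2 * (1 / sqrt 2) ^ n"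
proof -
  have *: "1 - real n / 2 = 1 + (- 1 / 2) * real n" by simp
  have "eigenvalue n = 2 powr 1 * (2 powr (- 1 / 2)) powr real n"
    unfolding eigenvalue_def * powr_add powr_powr ..
  also have "2 powr (- 1 / 2) = 1 / sqrt 2" by (rule two_powr_neg_half)
  finally show ?thesis by (simp add: powr_realpow)
qed

lemma eigenvalue_pos: "eigenvalue n > 0" by (simp add: eigenvalue_def)

lemma eigenvalue_le: "3 \<le> n \<Longrightarrow> eigenvalue n \<le> 1 / sqrt 2"
proof -
  assume "3 \<le> n"
  then have "eigenvalue n \<le> 2 powr (- 1 / 2)"
    unfolding eigenvalue_def by (intro powr_mono) auto
  then show ?thesis by (simp only: two_powr_neg_half)
qed

context orthogonal_weight
begin

definition multiplier :: "(nat \<Rightarrow> complex) \<Rightarrow> (real \<Rightarrow> complex) \<Rightarrow> real \<Rightarrow> complex" where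
  "multiplier \<mu> f = series (\<lambda>n. \<mu> n * coef n f / h n)"

text \<open>By \<open>coef_le\<close> the coefficients divided by \<open>sqrt (h n)\<close> are at
  most the norm of f, so decay of the multiplier alone yields the decay that \<open>series\<close>
  asks for, with a constant proportional to that norm.\<close>

lemma multiplier:
  assumes f: "f \<in> H2" and r: "0 \<le> r" "r < 1" and \<mu>: "\<And>n. cmod (\<mu> n) \<le> M * r ^ n"
  shows "multiplier \<mu> f \<in> H2"
    and "L2_norm \<phi> (multiplier \<mu> f) \<le> M / (1 - sqrt r) * sqrt (1 / (1 - r)) * L2_norm \<phi> f"
    and "coef n (multiplier \<mu> f) = \<mu> n * coef n f"
proof -
  have *: "cmod (\<mu> n * coef n f / h n) * sqrt (h n) \<le> (M * L2_norm \<phi> f) * r ^ n" for n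
  proof -
    have hp: "h n > 0" "sqrt (h n) > 0" using h_pos by auto
    have "cmod (coef n f) / sqrt (h n) \<le> L2_norm \<phi> f"
      using coef_le[OF f, of n] hp by (simp add: field_simps)
    then have "cmod (\<mu> n) * (cmod (coef n f) / sqrt (h n)) \<le> (M * r ^ n) * L2_norm \<phi> f"
      using hp order_trans[OF norm_ge_zero \<mu>] by (intro mult_mono \<mu>) auto
    moreover have "cmod (\<mu> n * coef n f / h n) * sqrt (h n) = cmod (\<mu> n) * (cmod (coef n f) / sqrt (h n))"
      using hp real_sqrt_mult_self[of "h n"] by (simp add: norm_mult norm_divide field_simps)
    ultimately show ?thesis by (simp add: mult_ac)
  qed
  note S = series[OF r, of "\<lambda>n. \<mu> n * coef n f / h n", OF *]
  show "multiplier \<mu> f \<in> H2" "coef n (multiplier \<mu> f) = \<mu> n * coef n f"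
    using S(1) S(3)[of n] h_pos[of n] by (auto simp: multiplier_def)
  show "L2_norm \<phi> (multiplier \<mu> f) \<le> M / (1 - sqrt r) * sqrt (1 / (1 - r)) * L2_norm \<phi> f"
    using S(2) by (simp add: multiplier_def mult_ac)
qed

lemma rcoef_of_real:
  assumes "f \<in> L2_weighted \<phi>" shows "coef n (\<lambda>x. complex_of_real (f x)) = of_real (rcoef n f)"
  using coef_Complex[OF L2_weighted_H2[OF assms], of n] by (simp add: rcoef_def complex_eq_iff)

text \<open>\<open>J\<close> is unit lower triangular, so moments and coefficients up to a given
  order vanish together. Admissibility thereby becomes a condition on the coefficients of orders 0,
  1, 2.\<close>

lemma moment_0_iff:
  assumes f: "f \<in> L2_weighted \<phi>"
  shows "(\<forall>k\<le>K. (\<integral>x. x ^ k * f x \<partial>lborel) = 0) \<longleftrightarrow> (\<forall>n\<le>K. rcoef n f = 0)"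
proof
  assume m: "\<forall>k\<le>K. (\<integral>x. x ^ k * f x \<partial>lborel) = 0"
  have "n \<le> K \<Longrightarrow> rcoef n f = 0" for n
  proof (induction n rule: less_induct)
    case (less n)
    then have "(\<Sum>j\<le>n. J n j * rcoef j f) = rcoef n f"
      by (simp add: lessThan_Suc_atMost[symmetric])
    then show ?case using moment_eq[OF f, of n] m less.prems by simp
  qed
  then show "\<forall>n\<le>K. rcoef n f = 0" by simp
qed (simp add: moment_eq[OF f])

lemma admissible_iff:
  "f \<in> admissible \<phi> \<longleftrightarrow> f \<in> L2_weighted \<phi> \<and> (\<forall>n\<le>2. rcoef n f = 0)"
  using moment_0_iff[of f 2] by (auto simp: admissible_def)

lemma complex_admissible_iff:
  "f \<in> complex_space (admissible \<phi>) \<longleftrightarrow> f \<in> H2 \<and> (\<forall>n\<le>2. coef n f = 0)"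
proof -
  have "f \<in> complex_space (admissible \<phi>) \<longleftrightarrow> f \<in> H2 \<and> (\<forall>n\<le>2. rcoef n (\<lambda>x. Re (f x)) = 0 \<and> rcoef n (\<lambda>x. Im (f x)) = 0)"
    by (auto simp: complex_space_def admissible_iff)
  then show ?thesis by (auto simp: coef_Complex complex_eq_iff)
qed

lemma eigenvalue_norm_le: "cmod (of_real (eigenvalue n)) \<le> 2 * (1 / sqrt 2) ^ n"
  using eigenvalue_pos[of n] by (simp add: eigenvalue_eq[symmetric] less_imp_le)

lemma inv_sqrt2: "0 \<le> 1 / sqrt 2" "1 / sqrt 2 < (1 :: real)" by auto

text \<open>The eigenvalues are real, so the complex multiplier has real coefficients at a real
  function, and its real part has the same coefficients.\<close>

lemma diagonal_operator_exists:
  "\<exists>D. \<forall>f\<in>admissible \<phi>. D f \<in> admissible \<phi> \<and> (\<forall>n. rcoef n (D f) = eigenvalue n * rcoef n f)"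
proof (intro exI ballI conjI allI)
  define D where "D f x = Re (multiplier (\<lambda>n. of_real (eigenvalue n)) (\<lambda>x. complex_of_real (f x)) x)" for f x
  fix f assume f: "f \<in> admissible \<phi>"
  then have L: "f \<in> L2_weighted \<phi>" by (simp add: admissible_iff)
  note m = multiplier[OF L2_weighted_H2[OF L] inv_sqrt2 eigenvalue_norm_le]
  have DL: "D f \<in> L2_weighted \<phi>" using m(1) by (simp add: complex_space_def D_def[abs_def])
  show *: "rcoef n (D f) = eigenvalue n * rcoef n f" for n
  proof -
    have "rcoef n (D f) = Re (coef n (multiplier (\<lambda>n. of_real (eigenvalue n)) (\<lambda>x. complex_of_real (f x))))"
      by (subst coef_Complex[OF m(1)]) (simp add: D_def[abs_def])
    then show ?thesis by (simp add: m(3) rcoef_of_real[OF L])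
  qed
  show "D f \<in> admissible \<phi>" using DL f by (simp add: admissible_iff *)
qed

text \<open>The resolvent comes from 1 / (z - \<lambda>) = (1 / z) * (1 + \<lambda> / (z -
  \<lambda>)). The identity has no decaying eigenvalues, so it is split off, and only the remainder,
  which decays like the eigenvalues, is realized as a multiplier. The assumptions on
  \<open>D\<close> concern coefficients only and so fit every version of the differential.\<close>

theorem diagonal_operator_spectrum:
  assumes D: "\<And>f. f \<in> admissible \<phi> \<Longrightarrow> D f \<in> admissible \<phi>"
    "\<And>f n. f \<in> admissible \<phi> \<Longrightarrow> rcoef n (D f) = eigenvalue n * rcoef n f"
  shows "bounded_operator \<phi> (complex_space (admissible \<phi>)) (complexification D)"
    and "op_spectrum \<phi> (complex_space (admissible \<phi>)) (complexification D) \<subseteq> ball 0 1"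
proof -
  let ?H = "complex_space (admissible \<phi>)" and ?C = "complexification D"
  have CH: "?C f \<in> ?H" and coefC: "coef n (?C f) = eigenvalue n * coef n f" if f: "f \<in> ?H" for f n
  proof -
    have a: "(\<lambda>x. Re (f x)) \<in> admissible \<phi>" "(\<lambda>x. Im (f x)) \<in> admissible \<phi>"
      using f by (auto simp: complex_space_def)
    then show C: "?C f \<in> ?H" by (simp add: complex_space_def complexification_def D)
    have "f \<in> H2" "?C f \<in> H2" using f C by (auto simp: complex_admissible_iff)
    then show "coef n (?C f) = eigenvalue n * coef n f"
      using a by (simp add: coef_Complex complexification_def D complex_eq_iff)
  qed
  have H: "f \<in> H2" if "f \<in> ?H" for f using that by (simp add: complex_admissible_iff)
  have lin: "(\<lambda>x. a * f x + b * g x) \<in> ?H" 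
    and coef_lin: "coef n (\<lambda>x. a * f x + b * g x) = a * coef n f + b * coef n g"
    if "f \<in> ?H" "g \<in> ?H" for f g a b n
    using that by (auto simp: complex_admissible_iff H2_add H2_mult coef_add coef_mult)
  have diff: "(\<lambda>x. a * f x - g x) = (\<lambda>x. a * f x + (-1) * g x)" for a and f g :: "real \<Rightarrow> complex" by simp
  show "bounded_operator \<phi> ?H ?C"
    unfolding bounded_operator_def
  proof (intro conjI ballI allI)
    fix f g a b assume "f \<in> ?H" "g \<in> ?H"
    then show "AE x in lborel. ?C (\<lambda>t. a * f t + b * g t) x = a * ?C f x + b * ?C g x"
      by (intro AE_eq_if_coef_eq H CH lin) (simp_all only: coef_lin coefC lin CH, simp add: algebra_simps)
  next
    have "L2_norm \<phi> (?C f) \<le> 2 / (1 - sqrt (1 / sqrt 2)) * sqrt (1 / (1 - 1 / sqrt 2)) * L2_norm \<phi> f" if "f \<in> ?H" for f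
    proof -
      note m = multiplier[OF H[OF that] inv_sqrt2 eigenvalue_norm_le]
      have "L2_norm \<phi> (?C f) = L2_norm \<phi> (multiplier (\<lambda>n. of_real (eigenvalue n)) f)"
        using that by (intro L2_norm_cong_AE AE_eq_if_coef_eq H CH m) (auto simp: m(3) coefC)
      then show ?thesis using m(2) by simp
    qed
    then show "\<exists>C. \<forall>f\<in>?H. L2_norm \<phi> (?C f) \<le> C * L2_norm \<phi> f" by blast
  qed (rule CH)
  have "z \<in> resolvent_set \<phi> ?H ?C" if z: "cmod z \<ge> 1" for z
  proof -
    \<comment> \<open>For n \<le> 2 the eigenvalues 2, sqrt 2, 1 may coincide with z, so the
      quotient is replaced by 0; admissible functions have coefficient 0 there.\<close>
    define \<mu> where "\<mu> n = (if n \<le> 2 then 0 else of_real (eigenvalue n) / (z - of_real (eigenvalue n)))" for n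
    define S where "S f = (\<lambda>x. inverse z * f x + inverse z * multiplier \<mu> f x)" for f
    have z0: "z \<noteq> 0" using z by auto
    \<comment> \<open>Reverse triangle inequality: z has modulus at least 1, the eigenvalue at most
      1 / sqrt 2.\<close>
    have gap: "1 - 1 / sqrt 2 \<le> cmod (z - of_real (eigenvalue n))" if "n \<ge> 3" for n
      using norm_triangle_ineq2[of z "of_real (eigenvalue n)"] eigenvalue_le[OF that] eigenvalue_pos[of n] z
      by simp
    have \<mu>_le: "cmod (\<mu> n) \<le> (2 / (1 - 1 / sqrt 2)) * (1 / sqrt 2) ^ n" for n
    proof (cases "n \<le> 2")
      case False
      then have "cmod (\<mu> n) \<le> eigenvalue n / (1 - 1 / sqrt 2)"
        using gap[of n] eigenvalue_pos[of n] inv_sqrt2 by (simp add: \<mu>_def norm_divide frac_le less_imp_le)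
      then show ?thesis by (simp add: eigenvalue_eq)
    qed (use inv_sqrt2 in \<open>simp add: \<mu>_def\<close>)
    have S: "S f \<in> ?H" "coef n (S f) = (if n \<le> 2 then 0 else coef n f / (z - eigenvalue n))"
      "(L2_norm \<phi> (S f))\<^sup>2 \<le> (2 * (cmod (inverse z))\<^sup>2 
        + 2 * (cmod (inverse z) * (2 / (1 - 1 / sqrt 2) / (1 - sqrt (1 / sqrt 2)) * sqrt (1 / (1 - 1 / sqrt 2))))\<^sup>2) * (L2_norm \<phi> f)\<^sup>2"
      if f: "f \<in> ?H" for f n
    proof -
      note m = multiplier[OF H[OF f] inv_sqrt2 \<mu>_le]
      have SH: "S f \<in> H2" unfolding S_def by (intro H2_add H2_mult m H f)
      have c: "coef n (S f) = inverse z * coef n f + inverse z * (\<mu> n * coef n f)" for n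
        unfolding S_def using m f by (simp add: coef_add H2_mult H coef_mult)
      have c0: "coef n f = 0" if "n \<le> 2" for n using f that by (simp add: complex_admissible_iff)
      show c': "coef n (S f) = (if n \<le> 2 then 0 else coef n f / (z - eigenvalue n))" for n
      proof (cases "n \<le> 2")
        case False
        then have "z - eigenvalue n \<noteq> 0" using gap[of n] inv_sqrt2 by auto
        then show ?thesis using False z0 by (simp add: c \<mu>_def field_simps)
      qed (simp add: c c0)
      show "S f \<in> ?H" using SH c' by (simp add: complex_admissible_iff)
      have "(L2_norm \<phi> (S f))\<^sup>2 \<le> 2 * (cmod (inverse z) * L2_norm \<phi> f)\<^sup>2 + 2 * (cmod (inverse z) * L2_norm \<phi> (multiplier \<mu> f))\<^sup>2"
        unfolding S_def using H2_add(2)[OF H2_mult(1)[OF H[OF f]] H2_mult(1)[OF m(1)], of "inverse z" "inverse z"]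
        by (simp only: H2_mult(2) H f m)
      also have "\<dots> \<le> 2 * (cmod (inverse z) * L2_norm \<phi> f)\<^sup>2 + 2 * (cmod (inverse z) * 
          (2 / (1 - 1 / sqrt 2) / (1 - sqrt (1 / sqrt 2)) * sqrt (1 / (1 - 1 / sqrt 2)) * L2_norm \<phi> f))\<^sup>2"
        by (intro add_left_mono mult_left_mono power_mono m) (auto simp: L2_norm_nonneg)
      finally show "(L2_norm \<phi> (S f))\<^sup>2 \<le> (2 * (cmod (inverse z))\<^sup>2 
        + 2 * (cmod (inverse z) * (2 / (1 - 1 / sqrt 2) / (1 - sqrt (1 / sqrt 2)) * sqrt (1 / (1 - 1 / sqrt 2))))\<^sup>2) * (L2_norm \<phi> f)\<^sup>2"
        unfolding power_mult_distrib by (simp add: algebra_simps)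
    qed
    have "bounded_operator \<phi> ?H S"
      unfolding bounded_operator_def
    proof (intro conjI ballI allI)
      fix f g a b assume "f \<in> ?H" "g \<in> ?H"
      then show "AE x in lborel. S (\<lambda>t. a * f t + b * g t) x = a * S f x + b * S g x"
        by (intro AE_eq_if_coef_eq H S lin) (simp_all only: coef_lin S lin, simp add: add_divide_distrib)
    next
      define c where "c = 2 * (cmod (inverse z))\<^sup>2 
        + 2 * (cmod (inverse z) * (2 / (1 - 1 / sqrt 2) / (1 - sqrt (1 / sqrt 2)) * sqrt (1 / (1 - 1 / sqrt 2))))\<^sup>2"
      have "L2_norm \<phi> (S f) \<le> sqrt c * L2_norm \<phi> f" if "f \<in> ?H" for f
      proof (rule power2_le_imp_le)
        have "c \<ge> 0" by (simp add: c_def)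
        then show "(L2_norm \<phi> (S f))\<^sup>2 \<le> (sqrt c * L2_norm \<phi> f)\<^sup>2"
          using S(3)[OF that] unfolding c_def[symmetric] by (simp add: power_mult_distrib)
        show "0 \<le> sqrt c * L2_norm \<phi> f" using \<open>c \<ge> 0\<close> by (simp add: L2_norm_nonneg)
      qed
      then show "\<exists>C. \<forall>f\<in>?H. L2_norm \<phi> (S f) \<le> C * L2_norm \<phi> f" by blast
    qed (rule S)
    moreover have "(AE x in lborel. S (\<lambda>t. z * f t - ?C f t) x = f x) \<and>
             (AE x in lborel. z * S f x - ?C (S f) x = f x)" if f: "f \<in> ?H" for f
    proof -
      have c: "(if n \<le> 2 then 0 else (z - eigenvalue n) * coef n f / (z - eigenvalue n)) = coef n f" for n
      proof (cases "n \<le> 2")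
        case False
        then have "z - eigenvalue n \<noteq> 0" using gap[of n] inv_sqrt2 by auto
        then show ?thesis using False by simp
      qed (use f in \<open>simp add: complex_admissible_iff\<close>)
      show ?thesis
      proof
        show "AE x in lborel. S (\<lambda>t. z * f t - ?C f t) x = f x"
        proof (intro AE_eq_if_coef_eq)
          show "coef n (S (\<lambda>t. z * f t - ?C f t)) = coef n f" for n
            unfolding diff S(2)[OF lin[OF f CH[OF f]]] coef_lin[OF f CH[OF f]] coefC[OF f]
            by (subst (2) c[symmetric]) (simp add: algebra_simps)
        qed (simp_all only: diff H S lin CH f)
        have "AE x in lborel. z * S f x + (-1) * ?C (S f) x = f x"
        proof (intro AE_eq_if_coef_eq)
          show "coef n (\<lambda>x. z * S f x + (-1) * ?C (S f) x) = coef n f" for n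
            unfolding coef_lin[OF S(1)[OF f] CH[OF S(1)[OF f]]] coefC[OF S(1)[OF f]] S(2)[OF f]
            by (subst (3) c[symmetric]) (simp add: algebra_simps diff_divide_distrib)
        qed (intro H S lin CH f)+
        then show "AE x in lborel. z * S f x - ?C (S f) x = f x" by simp
      qed
    qed
    ultimately show ?thesis by (auto simp: resolvent_set_def)
  qed
  then show "op_spectrum \<phi> ?H ?C \<subseteq> ball 0 1"
    by (force simp: op_spectrum_def not_le[symmetric])
qed

end

section \<open>The differential on moment sequences\<close>

text \<open>Functions carry the product topology, so the Gateaux limit can be taken entry by
  entry.\<close>

lemma tendsto_fun_iff:
  fixes f :: "'c \<Rightarrow> 'a \<Rightarrow> 'b :: topological_space"
  shows "(f \<longlongrightarrow> l) F \<longleftrightarrow> (\<forall>k. ((\<lambda>x. f x k) \<longlongrightarrow> l k) F)"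
  unfolding limitin_canonical_iff[symmetric] euclidean_product_topology[symmetric] limitin_componentwise
  by simp

text \<open>The cumulants of both fixed points: classical ones of the Gaussian, free ones of the
  semicircular distribution.\<close>

definition unit_cumulants :: "nat \<Rightarrow> real" where
  "unit_cumulants n = (if n = 2 then 1 else 0)"

lemma scale_cumulants_eq: "scale_cumulants c k = eigenvalue k * c k"
  by (simp add: scale_cumulants_def eigenvalue_def)

lemma scale_unit_cumulants: "scale_cumulants unit_cumulants = unit_cumulants"
  by (auto simp: scale_cumulants_def unit_cumulants_def)

text \<open>Common frame for all partitions with \<open>\<kappa> n = fact (n - 1)\<close> and for
  noncrossing partitions with \<open>\<kappa> n = 1\<close>. The one-block partition with its
  nonzero weight makes the transform invertible.\<close>

locale cumulant_transform =
  fixes Q :: "nat \<Rightarrow> nat set set set" and \<kappa> :: "nat \<Rightarrow> real"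
  assumes Q_partition: "P \<in> Q k \<Longrightarrow> partition_on {1..k} P"
    and Q_single: "k > 0 \<Longrightarrow> {{1..k}} \<in> Q k"
    and \<kappa>_nonzero: "\<kappa> k \<noteq> 0"
begin

definition moments :: "(nat \<Rightarrow> real) \<Rightarrow> nat \<Rightarrow> real" where
  "moments c k = (if k = 0 then 0 else \<Sum>P\<in>Q k. \<Prod>B\<in>P. \<kappa> (card B) * c (card B))"

text \<open>Without the one-block partition only cumulants of order below \<open>k\<close> enter, so
  \<open>moments_eq\<close> is a triangular system.\<close>

definition lower_moments :: "(nat \<Rightarrow> real) \<Rightarrow> nat \<Rightarrow> real" where
  "lower_moments c k = (\<Sum>P\<in>Q k - {{{1..k}}}. \<Prod>B\<in>P. \<kappa> (card B) * c (card B))"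

lemma moments_0 [simp]: "moments c 0 = 0" by (simp add: moments_def)

lemma finite_Q: "finite (Q k)"
  by (rule finite_subset[OF _ finitely_many_partition_on[of "{1..k}"]]) (auto dest: Q_partition)

lemma moments_eq: "k > 0 \<Longrightarrow> moments c k = \<kappa> k * c k + lower_moments c k"
  unfolding moments_def lower_moments_def by (subst sum.remove[OF finite_Q Q_single]) auto

lemma card_block_less:
  assumes "P \<in> Q k - {{{1..k}}}" "B \<in> P"
  shows "card B < k"
proof -
  have part: "partition_on {1..k} P" using assms Q_partition by auto
  then have "B \<subseteq> {1..k}" using assms(2) by (auto simp: partition_on_def)
  moreover have "B \<noteq> {1..k}"
  proof
    assume B: "B = {1..k}"
    have "C = {1..k}" if "C \<in> P" for C
    proof (rule ccontr)
      assume "C \<noteq> {1..k}"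
      then have "disjnt C {1..k}"
        using part that assms(2) B by (auto simp: partition_on_def pairwise_def)
      moreover have "C \<subseteq> {1..k}" "C \<noteq> {}" using part that by (auto simp: partition_on_def)
      ultimately show False by (auto simp: disjnt_def)
    qed
    then have "P = {{1..k}}" using assms(2) by blast
    then show False using assms(1) by simp
  qed
  ultimately have "card B < card {1..k}" by (intro psubset_card_mono) auto
  then show ?thesis by simp
qed

lemma lower_moments_cong: "(\<And>j. j < k \<Longrightarrow> c j = c' j) \<Longrightarrow> lower_moments c k = lower_moments c' k"
  unfolding lower_moments_def 
  by (intro sum.cong prod.cong refl) (simp add: card_block_less)

text \<open>The triangular system solved recursively. The cut-off \<open>if j < k\<close> makes the
  decrease visible to the termination proof; \<open>cumulants_eq\<close> removes it again.\<close>

function cumulants :: "(nat \<Rightarrow> real) \<Rightarrow> nat \<Rightarrow> real" where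
  "cumulants m k = (if k = 0 then 0
     else (m k - lower_moments (\<lambda>j. if j < k then cumulants m j else 0) k) / \<kappa> k)"
  by auto
termination by (relation "Wellfounded.measure snd") auto

declare cumulants.simps [simp del]

lemma cumulants_0 [simp]: "cumulants m 0 = 0" by (simp add: cumulants.simps)

lemma cumulants_eq: "k > 0 \<Longrightarrow> cumulants m k = (m k - lower_moments (cumulants m) k) / \<kappa> k"
  by (subst cumulants.simps) (auto intro!: lower_moments_cong)

lemma moments_cumulants:
  assumes "m \<in> sequences" shows "moments (cumulants m) = m"
proof
  fix k show "moments (cumulants m) k = m k"
    using assms \<kappa>_nonzero[of k] by (cases "k = 0") (auto simp: moments_eq cumulants_eq sequences_def)
qed

lemma cumulants_moments:
  assumes "c \<in> sequences" shows "cumulants (moments c) = c"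
proof
  fix k show "cumulants (moments c) k = c k"
  proof (induction k rule: less_induct)
    case (less k)
    show ?case
      using assms \<kappa>_nonzero[of k] lower_moments_cong[of k "cumulants (moments c)" c] less
      by (cases "k = 0") (auto simp: moments_eq cumulants_eq sequences_def)
  qed
qed

lemma the_inv_into_moments: "m \<in> sequences \<Longrightarrow> the_inv_into sequences moments m = cumulants m"
  by (rule the_inv_into_f_eq) (auto intro!: inj_on_inverseI cumulants_moments moments_cumulants simp: sequences_def)

text \<open>Each cumulant is a polynomial in the moment of its order and the lower cumulants.
  Existence suffices here, because the value is later forced by the derivative of
  \<open>moments\<close>.\<close>

lemma cumulants_differentiable:
  assumes "\<And>k. \<exists>D. ((\<lambda>\<epsilon>. m \<epsilon> k) has_real_derivative D) (at 0)"
  shows "\<exists>D. ((\<lambda>\<epsilon>. cumulants (m \<epsilon>) k) has_real_derivative D) (at 0)"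
proof (induction k rule: less_induct)
  case (less k)
  show ?case
  proof (cases "k = 0")
    case False
    have "\<exists>D. \<forall>j<k. ((\<lambda>\<epsilon>. cumulants (m \<epsilon>) j) has_real_derivative D j) (at 0)"
      using less by metis
    then obtain D where D: "\<And>j. j < k \<Longrightarrow> ((\<lambda>\<epsilon>. cumulants (m \<epsilon>) j) has_real_derivative D j) (at 0)"
      by blast
    obtain D' where D': "((\<lambda>\<epsilon>. m \<epsilon> k) has_real_derivative D') (at 0)" using assms by blast
    have "\<exists>E. ((\<lambda>\<epsilon>. lower_moments (cumulants (m \<epsilon>)) k) has_real_derivative E) (at 0)"
      unfolding lower_moments_def
      by (rule exI, rule DERIV_sum, rule has_field_derivative_prod, rule DERIV_cmult, rule D) (rule card_block_less)
    then obtain E where E: "((\<lambda>\<epsilon>. lower_moments (cumulants (m \<epsilon>)) k) has_real_derivative E) (at 0)" ..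
    have "((\<lambda>\<epsilon>. (m \<epsilon> k - lower_moments (cumulants (m \<epsilon>)) k) / \<kappa> k) has_real_derivative (D' - E) / \<kappa> k) (at 0)"
      by (intro DERIV_cdivide DERIV_diff D' E)
    then show ?thesis using False by (auto simp: cumulants_eq)
  qed (auto intro!: exI[of _ 0])
qed

text \<open>\<open>lin\<close> is used twice. On the cumulant curve \<open>c\<close>, whose moments
  are the given affine curve, it identifies the cumulant perturbations \<open>d\<close> with the
  coefficients \<open>b\<close>. On the scaled curve, which also starts at
  \<open>unit_cumulants\<close>, it yields the derivative of the operator.\<close>

theorem gateaux_derivative_clt_sequence:
  assumes lin: "\<And>c d k. (\<And>j. ((\<lambda>\<epsilon>. c \<epsilon> j) has_real_derivative d j) (at 0)) \<Longrightarrow> c 0 = unit_cumulants \<Longrightarrow>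
      ((\<lambda>\<epsilon>. moments (c \<epsilon>) k) has_real_derivative (\<Sum>n=1..k. \<kappa> n * path_weight \<beta> k n * d n)) (at 0)"
    and y: "y 0 = 0" "\<And>k. k > 0 \<Longrightarrow> y k = (\<Sum>n=1..k. path_weight \<beta> k n * b n)"
  shows "has_gateaux_derivative (clt_sequence moments) (moments unit_cumulants) y z
    \<longleftrightarrow> z = (\<lambda>k. \<Sum>n=1..k. path_weight \<beta> k n * (eigenvalue n * b n))"
proof -
  define m where "m = moments unit_cumulants"
  define c where "c \<epsilon> = cumulants (\<lambda>i. m i + \<epsilon> * y i)" for \<epsilon> :: real
  have m0: "m 0 = 0" by (simp add: m_def moments_def)
  have seq: "(\<lambda>i. m i + \<epsilon> * y i) \<in> sequences" for \<epsilon> using m0 y by (simp add: sequences_def)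
  have c0: "c 0 = unit_cumulants" 
    unfolding c_def m_def by (simp add: cumulants_moments sequences_def unit_cumulants_def)
  have clt: "clt_sequence moments (\<lambda>i. m i + \<epsilon> * y i) = moments (scale_cumulants (c \<epsilon>))" for \<epsilon>
    by (simp add: clt_sequence_def c_def the_inv_into_moments[OF seq])
  have "\<exists>d. \<forall>j. ((\<lambda>\<epsilon>. c \<epsilon> j) has_real_derivative d j) (at 0)"
    unfolding c_def by (intro choice allI cumulants_differentiable) 
      (rule exI, rule DERIV_add[OF DERIV_const DERIV_cmult_right[OF DERIV_ident]])
  then obtain d where d: "\<And>j. ((\<lambda>\<epsilon>. c \<epsilon> j) has_real_derivative d j) (at 0)" by blast
  have y_eq: "y k = (\<Sum>n=1..k. \<kappa> n * path_weight \<beta> k n * d n)" for k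
  proof (rule DERIV_unique)
    have "((\<lambda>\<epsilon>. m k + \<epsilon> * y k) has_real_derivative y k) (at 0)" by (auto intro!: derivative_eq_intros)
    then show "((\<lambda>\<epsilon>. moments (c \<epsilon>) k) has_real_derivative y k) (at 0)"
      by (simp add: c_def moments_cumulants[OF seq])
  qed (rule lin[OF d c0])
  \<comment> \<open>The diagonal entries of \<open>path_weight\<close> are 1, so comparing the two
    expansions of \<open>y n\<close> determines \<open>d n\<close> from the earlier ones.\<close>
  have db: "n > 0 \<Longrightarrow> \<kappa> n * d n = b n" for n
  proof (induction n rule: less_induct)
    case (less n)
    have split: "{1..n} = insert n {1..<n}" using less.prems by auto
    have "(\<Sum>j=1..<n. \<kappa> j * path_weight \<beta> n j * d j) = (\<Sum>j=1..<n. path_weight \<beta> n j * b j)"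
      using less.IH by (intro sum.cong) (auto simp: mult_ac)
    then show ?case
      using y_eq[of n] y(2)[OF less.prems] unfolding split by simp
  qed
  have "((\<lambda>\<epsilon>. moments (scale_cumulants (c \<epsilon>)) k) has_real_derivative
      (\<Sum>n=1..k. \<kappa> n * path_weight \<beta> k n * (eigenvalue n * d n))) (at 0)" for k
    by (intro lin) (auto simp: scale_cumulants_eq[abs_def] intro!: DERIV_cmult d,
        use c0 scale_unit_cumulants in \<open>simp add: scale_cumulants_eq[abs_def]\<close>)
  also have "(\<Sum>n=1..k. \<kappa> n * path_weight \<beta> k n * (eigenvalue n * d n)) 
      = (\<Sum>n=1..k. path_weight \<beta> k n * (eigenvalue n * b n))" for k
  proof (intro sum.cong refl)
    fix n assume "n \<in> {1..k}"
    then have "\<kappa> n * d n = b n" by (intro db) simp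
    then show "\<kappa> n * path_weight \<beta> k n * (eigenvalue n * d n) = path_weight \<beta> k n * (eigenvalue n * b n)"
      by (simp add: mult_ac)
  qed
  finally have der: "((\<lambda>\<epsilon>. clt_sequence moments (\<lambda>i. m i + \<epsilon> * y i) k) has_real_derivative
      (\<Sum>n=1..k. path_weight \<beta> k n * (eigenvalue n * b n))) (at 0)" for k
    unfolding clt .
  then have lim: "((\<lambda>\<epsilon>. (clt_sequence moments (\<lambda>i. m i + \<epsilon> * y i) k - clt_sequence moments m k) / \<epsilon>)
      \<longlongrightarrow> (\<Sum>n=1..k. path_weight \<beta> k n * (eigenvalue n * b n))) (at 0)" for k
    unfolding DERIV_def by simp
  have "((\<lambda>\<epsilon>. (clt_sequence moments (\<lambda>i. m i + \<epsilon> * y i) k - clt_sequence moments m k) / \<epsilon>)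
      \<longlongrightarrow> z k) (at 0) \<longleftrightarrow> z k = (\<Sum>n=1..k. path_weight \<beta> k n * (eigenvalue n * b n))" (is "?L \<longleftrightarrow> ?R") for k
  proof
    assume ?L then show ?R by (rule LIM_unique[OF _ lim])
  next
    assume R: ?R show ?L unfolding R by (rule lim)
  qed
  then show ?thesis
    unfolding has_gateaux_derivative_def m_def[symmetric] tendsto_fun_iff by auto
qed

end

section \<open>Classical cumulants\<close>

lemma sum_Pow_card:
  fixes g :: "nat \<Rightarrow> real"
  assumes "finite S"
  shows "(\<Sum>T\<in>Pow S. g (card T)) = (\<Sum>j\<le>card S. real (card S choose j) * g j)"
proof -
  have "(\<Sum>T\<in>Pow S. g (card T)) = (\<Sum>j\<le>card S. \<Sum>T\<in>{T \<in> Pow S. card T = j}. g (card T))"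
    using assms by (intro sum.group[symmetric]) (auto intro: card_mono)
  also have "\<dots> = (\<Sum>j\<le>card S. real (card S choose j) * g j)"
    using assms by (intro sum.cong) (auto simp: n_subsets)
  finally show ?thesis .
qed

text \<open>For a partition the union has one member; this form needs no choice operator.\<close>

definition block :: "'a set set \<Rightarrow> 'a \<Rightarrow> 'a set" where
  "block P a = \<Union>{B\<in>P. a \<in> B}"

lemma partition_on_block_unique:
  assumes "partition_on S P" "B \<in> P" "C \<in> P" "x \<in> B" "x \<in> C"
  shows "B = C"
  using partition_onD2[OF assms(1)] assms(2-) unfolding pairwise_def disjnt_def by blast

lemma block_eq:
  assumes "partition_on S P" "B \<in> P" "a \<in> B"
  shows "block P a = B"
proof -
  have "{B\<in>P. a \<in> B} = {B}" using partition_on_block_unique[OF assms(1)] assms by blast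
  then show ?thesis by (simp add: block_def)
qed

lemma block_in:
  assumes "partition_on S P" "a \<in> S"
  shows "block P a \<in> P" "a \<in> block P a"
proof -
  obtain B where "B \<in> P" "a \<in> B" using assms by (auto simp: partition_on_def)
  then show "block P a \<in> P" "a \<in> block P a" using block_eq[OF assms(1)] by auto
qed

definition partition_sum :: "(nat \<Rightarrow> real) \<Rightarrow> nat set \<Rightarrow> real" where
  "partition_sum f S = (\<Sum>P | partition_on S P. \<Prod>B\<in>P. f (card B))"

text \<open>Partitions are sorted by the block of \<open>a\<close>, which is \<open>a\<close>
  together with a subset \<open>T\<close> of \<open>S\<close>; the other blocks partition
  \<open>S - T\<close>.\<close>

lemma partition_sum_insert:
  assumes S: "finite S" "a \<notin> S"
  shows "partition_sum f (insert a S) = (\<Sum>T\<in>Pow S. f (Suc (card T)) * partition_sum f (S - T))"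
proof -
  let ?B = "\<lambda>P. block P a"
  have block: "?B P \<in> P" "a \<in> ?B P" if "partition_on (insert a S) P" for P
    using block_in[OF that] by auto
  have "partition_sum f (insert a S)
      = (\<Sum>(T, P)\<in>(SIGMA T:Pow S. {P. partition_on (S - T) P}). f (Suc (card T)) * (\<Prod>B\<in>P. f (card B)))"
    unfolding partition_sum_def
  proof (rule sum.reindex_bij_witness[where i = "\<lambda>(T, P). insert (insert a T) P"
        and j = "\<lambda>P. (?B P - {a}, P - {?B P})"], goal_cases)
    case (1 P)
    then show ?case using block[of P] by (auto simp: insert_absorb)
  next
    case (2 P)
    then have P: "partition_on (insert a S) P" by simp
    obtain B where B: "?B P = B" "B \<in> P" "a \<in> B" using block[OF P] by simp
    then have "disjnt B (\<Union>(P - {B}))"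
      using pairwiseD[OF partition_onD2[OF P], of B] by (auto simp: disjnt_iff)
    moreover have "insert B (P - {B}) = P" using B by auto
    ultimately have *: "partition_on (insert a S - B) (P - {B})" "B \<subseteq> insert a S"
      using partition_on_insert[of B "P - {B}" "insert a S"] P by auto
    moreover have "insert a S - B = S - (B - {a})" using B S by auto
    ultimately show ?case unfolding B(1) by auto
  next
    case (3 x)
    then obtain T P where x: "x = (T, P)" "T \<subseteq> S" "partition_on (S - T) P" by auto
    then have "a \<notin> \<Union>P" using S by (auto simp: partition_on_def)
    then have "{B \<in> insert (insert a T) P. a \<in> B} = {insert a T}" "insert a T \<notin> P" by auto
    then show ?case using x S by (auto simp: block_def)
  next
    case (4 x)
    then obtain T P where x: "x = (T, P)" "T \<subseteq> S" "partition_on (S - T) P" by auto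
    have "\<Union>P = S - T" using x by (auto simp: partition_on_def)
    then have "disjnt (insert a T) (\<Union>P)" using S x by (auto simp: disjnt_def)
    moreover have "insert a S - insert a T = S - T" using S by auto
    ultimately show ?case using partition_on_insert[of "insert a T" P "insert a S"] x by auto
  next
    case (5 P)
    then have P: "partition_on (insert a S) P" by simp
    have fin: "finite P" using P S by (auto intro: finite_elements)
    obtain B where B: "?B P = B" "B \<in> P" "a \<in> B" using block[OF P] by simp
    have "B \<subseteq> insert a S" using B(2) P by (auto simp: partition_on_def)
    then have "finite B" using S by (metis finite_insert finite_subset)
    then have "Suc (card (B - {a})) = card B" using B(3) by (intro card_Suc_Diff1)
    then show ?case unfolding B(1) using prod.remove[OF fin B(2), of "\<lambda>B. f (card B)"] by simp
  qed
  also have "\<dots> = (\<Sum>T\<in>Pow S. f (Suc (card T)) * partition_sum f (S - T))"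
    unfolding partition_sum_def sum_distrib_left using S
    by (subst sum.Sigma) (auto intro: finitely_many_partition_on)
  finally show ?thesis .
qed

text \<open>The complete Bell polynomials in f 1, f 2, ...; the recursion is
  \<open>partition_sum_insert\<close> with the sets \<open>T\<close> grouped by size.\<close>

fun exp_moments :: "(nat \<Rightarrow> real) \<Rightarrow> nat \<Rightarrow> real" where
  "exp_moments f 0 = 1"
| "exp_moments f (Suc k) = (\<Sum>j\<le>k. real (k choose j) * (f (Suc j) * exp_moments f (k - j)))"

declare exp_moments.simps(2) [simp del]

lemma partition_sum_eq: "finite S \<Longrightarrow> partition_sum f S = exp_moments f (card S)"
proof (induction "card S" arbitrary: S rule: less_induct)
  case less
  show ?case
  proof (cases "S = {}")
    case True
    then show ?thesis by (simp add: partition_sum_def partition_on_empty)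
  next
    case False
    then obtain a R where S: "S = insert a R" "a \<notin> R" by (meson Set.set_insert ex_in_conv)
    then have fin: "finite R" using less.prems by simp
    have "partition_sum f S = (\<Sum>T\<in>Pow R. f (Suc (card T)) * exp_moments f (card R - card T))"
      unfolding S(1) partition_sum_insert[OF fin S(2)]
    proof (intro sum.cong refl)
      fix T assume T: "T \<in> Pow R"
      then have "finite T" using fin by (metis PowD finite_subset)
      then have "card (R - T) = card R - card T" using T by (intro card_Diff_subset) auto
      then show "f (Suc (card T)) * partition_sum f (R - T) = f (Suc (card T)) * exp_moments f (card R - card T)"
        using less.hyps[of "R - T"] S fin by simp
    qed
    also have "\<dots> = exp_moments f (card S)"
      using sum_Pow_card[OF fin, of "\<lambda>j. f (Suc j) * exp_moments f (card R - j)"] S fin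
      by (simp add: exp_moments.simps(2))
    finally show ?thesis .
  qed
qed

section \<open>Gaussian moments and the linearized classical transform\<close>

fun gauss_moment :: "nat \<Rightarrow> real" where
  "gauss_moment 0 = 1"
| "gauss_moment (Suc 0) = 0"
| "gauss_moment (Suc (Suc k)) = real (Suc k) * gauss_moment k"

lemma choose_real: "real (k choose n) * real (k - n) = real k * real (k - 1 choose n)"
  using arg_cong[OF binomial_absorb_comp[of k n], of real] by (simp only: of_nat_mult mult.commute)

text \<open>Both sides count the ways to pair off some of \<open>k\<close> points and leave
  \<open>n\<close> open: the open points are chosen and the rest is matched. In the path recursion
  the last point is open, or is joined to one of \<open>Suc n\<close> open points.\<close>

lemma path_weight_hermite:
  "path_weight real k n = (if n \<le> k then real (k choose n) * gauss_moment (k - n) else 0)"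
proof (induction k arbitrary: n)
  case (Suc k)
  have "real (Suc n) * path_weight real k (Suc n)
      = (if n \<le> k then real (k choose n) * gauss_moment (Suc k - n) else 0)" for n
  proof (cases "Suc n \<le> k")
    case True
    have "real (Suc n) * real (k choose Suc n) = real (k choose n) * real (k - n)"
      using binomial_absorption[of n k] choose_real[of k n] by (metis of_nat_mult)
    moreover have "Suc k - n = Suc (Suc (k - Suc n))" "k - n = Suc (k - Suc n)" using True by auto
    ultimately show ?thesis using True by (simp add: Suc)
  next
    case False
    then show ?thesis by (cases "n = k") (auto simp: Suc)
  qed
  then show ?case
    by (cases n) (auto simp: Suc algebra_simps not_le less_Suc_eq)
qed auto

interpretation classical: cumulant_transform "\<lambda>k. {P. partition_on {1..k} P}" "\<lambda>n. fact (n - 1)"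
  by unfold_locales (auto intro: partition_on_space)

lemma classical_moments_eq: "classical.moments = classical_moments"
  by (intro ext) (simp only: classical.moments_def classical_moments_def)

lemma classical_moments_exp:
  "classical_moments c k = (if k = 0 then 0 else exp_moments (\<lambda>n. fact (n - 1) * c n) k)"
  using partition_sum_eq[of "{1..k}" "\<lambda>n. fact (n - 1) * c n"]
  by (simp add: classical_moments_def partition_sum_def)

lemma exp_moments_unit: "exp_moments (\<lambda>n. fact (n - 1) * unit_cumulants n) k = gauss_moment k"
proof (induction k rule: gauss_moment.induct)
  case (3 k)
  have "(\<Sum>j\<le>Suc k. real (Suc k choose j) * ((fact (Suc j - 1) * unit_cumulants (Suc j)) * exp_moments (\<lambda>n. fact (n - 1) * unit_cumulants n) (Suc k - j)))
      = (\<Sum>j\<in>{1}. real (Suc k choose j) * ((fact (Suc j - 1) * unit_cumulants (Suc j)) * exp_moments (\<lambda>n. fact (n - 1) * unit_cumulants n) (Suc k - j)))"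
    by (rule sum.mono_neutral_right) (auto simp: unit_cumulants_def)
  then show ?case using 3 by (simp add: exp_moments.simps(2)) (simp add: unit_cumulants_def)
qed (simp_all add: exp_moments.simps unit_cumulants_def)

text \<open>The product rule in the Bell recursion gives two terms: the varied cumulant belongs to
  the block of the distinguished point, or that point lies in a pair, the only block size with
  nonzero cumulant at the base point. The Hermite path weights split in the same way.\<close>

lemma exp_moments_derivative:
  fixes c :: "real \<Rightarrow> nat \<Rightarrow> real"
  assumes c: "\<And>j. ((\<lambda>\<epsilon>. c \<epsilon> j) has_real_derivative d j) (at 0)" and c0: "c 0 = unit_cumulants"
  shows "((\<lambda>\<epsilon>. exp_moments (\<lambda>n. fact (n - 1) * c \<epsilon> n) k) has_real_derivative
      (\<Sum>n=1..k. fact (n - 1) * path_weight real k n * d n)) (at 0)"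
proof (induction k rule: less_induct)
  case (less k)
  define D where "D k = (\<Sum>n=1..k. fact (n - 1) * path_weight real k n * d n)" for k
  show ?case
  proof (cases k)
    case 0 then show ?thesis by simp
  next
    case (Suc l)
    let ?d' = "\<Sum>j\<le>l. real (l choose j) * ((fact j * d (Suc j)) * gauss_moment (l - j) + D (l - j) * (fact j * unit_cumulants (Suc j)))"
    have "((\<lambda>\<epsilon>. exp_moments (\<lambda>n. fact (n - 1) * c \<epsilon> n) (Suc l)) has_real_derivative ?d') (at 0)"
      unfolding exp_moments.simps(2)
    proof (intro DERIV_sum DERIV_cmult)
      fix j assume "j \<in> {..l}"
      then have IH: "((\<lambda>\<epsilon>. exp_moments (\<lambda>n. fact (n - 1) * c \<epsilon> n) (l - j)) has_real_derivative D (l - j)) (at 0)"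
        unfolding D_def using Suc by (intro less.IH) auto
      show "((\<lambda>\<epsilon>. (fact (Suc j - 1) * c \<epsilon> (Suc j)) * exp_moments (\<lambda>n. fact (n - 1) * c \<epsilon> n) (l - j))
          has_real_derivative (fact j * d (Suc j)) * gauss_moment (l - j) + D (l - j) * (fact j * unit_cumulants (Suc j))) (at 0)"
        using DERIV_mult[OF DERIV_cmult[OF c[of "Suc j"], of "fact j"] IH] c0 exp_moments_unit[of "l - j"] by simp
    qed
    moreover have "?d' = D (Suc l)"
    proof -
      \<comment> \<open>Only j = 1 survives. For l = 0 it is out of range, and then the factor
        \<open>real l\<close> makes the right-hand side 0.\<close>
      have 1: "(\<Sum>j\<le>l. real (l choose j) * (D (l - j) * (fact j * unit_cumulants (Suc j)))) = real l * D (l - 1)"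
      proof -
        have "(\<Sum>j\<le>l. real (l choose j) * (D (l - j) * (fact j * unit_cumulants (Suc j))))
            = (\<Sum>j\<in>{1} \<inter> {..l}. real (l choose j) * (D (l - j) * (fact j * unit_cumulants (Suc j))))"
          by (rule sum.mono_neutral_right) (auto simp: unit_cumulants_def)
        then show ?thesis by (cases l) (auto simp: unit_cumulants_def)
      qed
      have 2: "real l * D (l - 1) = (\<Sum>n=1..Suc l. fact (n - 1) * (real l * path_weight real (l - 1) n) * d n)"
      proof -
        have "D (l - 1) = (\<Sum>n=1..Suc l. fact (n - 1) * path_weight real (l - 1) n * d n)"
          unfolding D_def by (rule sum.mono_neutral_left) (auto simp: path_weight_eq_0)
        then show ?thesis by (simp only: sum_distrib_left mult_ac)
      qed
      have 3: "(\<Sum>j\<le>l. real (l choose j) * ((fact j * d (Suc j)) * gauss_moment (l - j)))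
          = (\<Sum>n=1..Suc l. fact (n - 1) * (real (l choose (n - 1)) * gauss_moment (Suc l - n)) * d n)"
        by (rule sum.reindex_bij_witness[of _ "\<lambda>n. n - 1" Suc]) auto
      \<comment> \<open>Among \<open>Suc l\<close> points with \<open>n\<close> left open, the
        distinguished point is open or is paired with one of the \<open>l\<close> others.\<close>
      have 4: "path_weight real (Suc l) n
          = real (l choose (n - 1)) * gauss_moment (Suc l - n) + real l * path_weight real (l - 1) n"
        if n: "1 \<le> n" "n \<le> Suc l" for n
      proof -
        obtain j where j: "n = Suc j" using n by (cases n) auto
        have "real (l choose n) * gauss_moment (Suc l - n) = real l * path_weight real (l - 1) n"
        proof (cases "Suc n \<le> l")
          case True
          then have eq: "Suc l - n = Suc (Suc (l - 1 - n))" "Suc (l - 1 - n) = l - n" by auto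
          have "real (l choose n) * gauss_moment (Suc l - n) = (real (l choose n) * real (l - n)) * gauss_moment (l - 1 - n)"
            unfolding eq(1) eq(2)[symmetric] by (simp only: gauss_moment.simps mult.assoc)
          also have "\<dots> = real l * (real (l - 1 choose n) * gauss_moment (l - 1 - n))"
            unfolding choose_real by simp
          finally show ?thesis using True by (simp add: path_weight_hermite)
        next
          case False
          then show ?thesis using n by (cases "n = l") (auto simp: path_weight_eq_0)
        qed
        moreover have "path_weight real (Suc l) n = real (Suc l choose n) * gauss_moment (Suc l - n)"
          using n by (simp only: path_weight_hermite if_True)
        ultimately show ?thesis by (simp add: j algebra_simps)
      qed
      have "?d' = (\<Sum>j\<le>l. real (l choose j) * ((fact j * d (Suc j)) * gauss_moment (l - j)))
           + (\<Sum>j\<le>l. real (l choose j) * (D (l - j) * (fact j * unit_cumulants (Suc j))))"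
        by (simp only: distrib_left sum.distrib)
      also have "\<dots> = (\<Sum>n=1..Suc l. fact (n - 1) * (real (l choose (n - 1)) * gauss_moment (Suc l - n)) * d n
          + fact (n - 1) * (real l * path_weight real (l - 1) n) * d n)"
        unfolding 1 2 3 sum.distrib ..
      also have "\<dots> = D (Suc l)"
        unfolding D_def by (intro sum.cong refl) (simp only: 4 atLeastAtMost_iff distrib_left distrib_right)
      finally show ?thesis .
    qed
    ultimately show ?thesis unfolding D_def Suc by simp
  qed
qed

lemma classical_moments_derivative:
  fixes c :: "real \<Rightarrow> nat \<Rightarrow> real"
  assumes "\<And>j. ((\<lambda>\<epsilon>. c \<epsilon> j) has_real_derivative d j) (at 0)" "c 0 = unit_cumulants"
  shows "((\<lambda>\<epsilon>. classical_moments (c \<epsilon>) k) has_real_derivative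
      (\<Sum>n=1..k. fact (n - 1) * path_weight real k n * d n)) (at 0)"
  using exp_moments_derivative[OF assms, of k] by (cases "k = 0") (simp_all add: classical_moments_exp)

section \<open>Noncrossing partitions\<close>

lemma noncrossingD:
  assumes "noncrossing P" "A \<in> P" "B \<in> P" "p \<in> A" "q \<in> B" "r \<in> A" "s \<in> B" "p < q" "q < r" "r < s"
  shows "A = B"
  using assms unfolding noncrossing_def by blast

lemma noncrossingI:
  assumes "\<And>A B p q r s. A \<in> P \<Longrightarrow> B \<in> P \<Longrightarrow> p \<in> A \<Longrightarrow> q \<in> B \<Longrightarrow> r \<in> A \<Longrightarrow> s \<in> B
     \<Longrightarrow> p < q \<Longrightarrow> q < r \<Longrightarrow> r < s \<Longrightarrow> A = B"
  shows "noncrossing P"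
  using assms unfolding noncrossing_def by blast

lemma noncrossing_subset:
  assumes "noncrossing P" "Q \<subseteq> P"
  shows "noncrossing Q"
proof (rule noncrossingI)
  fix A B :: "nat set" and p q r s
  assume *: "A \<in> Q" "B \<in> Q" "p \<in> A" "q \<in> B" "r \<in> A" "s \<in> B" "p < q" "q < r" "r < s"
  show "A = B" using assms(2) * by (intro noncrossingD[OF assms(1) _ _ *(3-)]) auto
qed

lemma partition_on_sub: "partition_on S P \<Longrightarrow> B \<in> P \<Longrightarrow> B \<subseteq> S"
  by (auto simp: partition_on_def)

text \<open>\<open>j\<close> is the second smallest element of the block \<open>B\<close> of
  \<open>a\<close>. Any other block lies strictly between \<open>a\<close> and \<open>j\<close> or
  entirely to the right of \<open>j\<close>, since otherwise it would cross
  \<open>B\<close>.\<close>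

lemma noncrossing_split:
  assumes part: "partition_on {a..<b} P" and nc: "noncrossing P"
    and B: "B \<in> P" "a \<in> B" and j: "j \<in> B" "a < j" "\<And>x. x \<in> B \<Longrightarrow> a < x \<Longrightarrow> j \<le> x"
  defines "P1 \<equiv> {C\<in>P. C \<subseteq> {Suc a..<j}}" and "P2 \<equiv> insert (B - {a}) {C\<in>P. C \<subseteq> {j..<b}}"
  shows "partition_on {Suc a..<j} P1" "noncrossing P1" "partition_on {j..<b} P2" "noncrossing P2"
    and "P1 \<union> insert B (P2 - {B - {a}}) = P"
proof -
  note uniq = partition_on_block_unique[OF part]
  have sub: "C \<subseteq> {a..<b}" if "C \<in> P" for C using partition_on_sub[OF part that] .
  have bj: "j < b" using sub[OF B(1)] j by auto
  have dich: "C \<subseteq> {Suc a..<j} \<or> C \<subseteq> {j..<b}" if C: "C \<in> P" "C \<noteq> B" for C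
  proof (rule ccontr)
    assume "\<not> ?thesis"
    then obtain x y where xy: "x \<in> C" "x \<notin> {Suc a..<j}" "y \<in> C" "y \<notin> {j..<b}" by blast
    have "x \<in> {a..<b}" "y \<in> {a..<b}" using xy sub[OF C(1)] by auto
    moreover have "x \<noteq> a" "y \<noteq> a" "x \<noteq> j" using uniq[OF C(1) B(1)] xy B(2) j(1) C(2) by auto
    ultimately have "a < y" "y < j" "j < x" using xy by auto
    \<comment> \<open>The crossing is a < y < j < x, with a, j in \<open>B\<close> and y, x in
      \<open>C\<close>.\<close>
    then have "B = C" using noncrossingD[OF nc B(1) C(1) B(2) xy(3) j(1) xy(1)] by simp
    then show False using C by simp
  qed
  have Bge: "B - {a} \<subseteq> {j..<b}"
  proof
    fix x assume x: "x \<in> B - {a}"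
    then have "x \<in> {a..<b}" using sub[OF B(1)] by auto
    then show "x \<in> {j..<b}" using x j(3)[of x] by auto
  qed
  show "partition_on {Suc a..<j} P1"
    unfolding partition_on_def
  proof (intro conjI)
    show "\<Union>P1 = {Suc a..<j}"
    proof (intro equalityI subsetI)
      fix x assume x: "x \<in> {Suc a..<j}"
      then have "x \<in> {a..<b}" using bj by auto
      then obtain C where C: "C \<in> P" "x \<in> C" using block_in[OF part] by blast
      moreover have "C \<noteq> B" using C x j(3)[of x] by auto
      then have "C \<subseteq> {Suc a..<j}" using dich[OF C(1)] C x by auto
      ultimately show "x \<in> \<Union>P1" by (auto simp: P1_def)
    qed (auto simp: P1_def)
    show "disjoint P1" using partition_onD2[OF part] by (auto simp: P1_def pairwise_def)
    show "{} \<notin> P1" using partition_onD3[OF part] by (auto simp: P1_def)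
  qed
  show "noncrossing P1"
    by (rule noncrossing_subset[OF nc]) (auto simp: P1_def)
  have sub2: "C \<in> P2 \<Longrightarrow> \<exists>C'\<in>P. C \<subseteq> C' \<and> (C' \<noteq> B \<longrightarrow> C = C') \<and> (C' = B \<longrightarrow> C = B - {a})" for C
  proof -
    assume "C \<in> P2"
    moreover have "\<not> B \<subseteq> {j..<b}" using B(2) j(2) by auto
    ultimately consider "C = B - {a}" | "C \<in> P" "C \<noteq> B" unfolding P2_def by blast
    then show ?thesis
    proof cases
      case 1 then show ?thesis using B(1) by (intro bexI[of _ B]) auto
    next
      case 2 then show ?thesis by (intro bexI[of _ C]) auto
    qed
  qed
  show "partition_on {j..<b} P2"
    unfolding partition_on_def
  proof (intro conjI)
    show "\<Union>P2 = {j..<b}"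
    proof (intro equalityI subsetI)
      fix x assume x: "x \<in> {j..<b}"
      then have "x \<in> {a..<b}" using j by auto
      then obtain C where C: "C \<in> P" "x \<in> C" using block_in[OF part] by blast
      show "x \<in> \<Union>P2"
      proof (cases "C = B")
        case True
        then show ?thesis using C x j(2) by (auto simp: P2_def)
      next
        case False
        then have "C \<subseteq> {j..<b}" using dich[OF C(1)] C x by auto
        then show ?thesis using C by (auto simp: P2_def)
      qed
    qed (use Bge in \<open>auto simp: P2_def\<close>)
    show "disjoint P2"
      unfolding pairwise_def
    proof (intro ballI impI)
      fix C D assume CD: "C \<in> P2" "D \<in> P2" "C \<noteq> D"
      then obtain C' D' where "C' \<in> P" "D' \<in> P" "C \<subseteq> C'" "D \<subseteq> D'" "C' \<noteq> D'"
        using sub2[OF CD(1)] sub2[OF CD(2)] by metis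
      then show "disjnt C D" using uniq unfolding disjnt_def by blast
    qed
    have "j \<in> B - {a}" using j by simp
    then show "{} \<notin> P2" using partition_onD3[OF part] by (auto simp: P2_def)
  qed
  show "noncrossing P2"
  proof (rule noncrossingI)
    fix C D p q r s assume *: "C \<in> P2" "D \<in> P2" "p \<in> C" "q \<in> D" "r \<in> C" "s \<in> D" "p < q" "q < r" "r < s"
    obtain C' D' where CD: "C' \<in> P" "C \<subseteq> C'" "C' \<noteq> B \<longrightarrow> C = C'" "C' = B \<longrightarrow> C = B - {a}"
        "D' \<in> P" "D \<subseteq> D'" "D' \<noteq> B \<longrightarrow> D = D'" "D' = B \<longrightarrow> D = B - {a}"
      using sub2[OF *(1)] sub2[OF *(2)] by metis
    then have "C' = D'" using noncrossingD[OF nc, of C' D' p q r s] * by blast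
    then show "C = D" using CD by metis
  qed
  have "B - {a} \<notin> P" 
  proof
    assume "B - {a} \<in> P"
    then have "B - {a} = B" using uniq[OF _ B(1), of "B - {a}" j] j by auto
    then show False using B(2) by auto
  qed
  moreover have "\<not> B \<subseteq> {Suc a..<j}" "\<not> B \<subseteq> {j..<b}" using B(2) j(2) by auto
  ultimately show "P1 \<union> insert B (P2 - {B - {a}}) = P"
    using dich B(1) unfolding P1_def P2_def by blast
qed

text \<open>The inverse of the splitting. The recovery of \<open>P1\<close> and \<open>P2\<close>
  makes the correspondence bijective, and the disjointness claims let products over blocks
  factor.\<close>

lemma noncrossing_join:
  assumes part1: "partition_on {Suc a..<j} P1" and nc1: "noncrossing P1"
    and part2: "partition_on {j..<b} P2" and nc2: "noncrossing P2"
    and B: "B \<in> P2" "j \<in> B" and aj: "a < j"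
  defines "P \<equiv> P1 \<union> insert (insert a B) (P2 - {B})"
  shows "partition_on {a..<b} P" "noncrossing P"
    and "{C\<in>P. C \<subseteq> {Suc a..<j}} = P1" "insert B {C\<in>P. C \<subseteq> {j..<b}} = P2"
    and "P1 \<inter> insert (insert a B) (P2 - {B}) = {}" "insert a B \<notin> P2 - {B}" 
proof -
  have sub1: "C \<subseteq> {Suc a..<j}" "C \<noteq> {}" if "C \<in> P1" for C
    using that part1 by (auto simp: partition_on_def)
  have sub2: "C \<subseteq> {j..<b}" "C \<noteq> {}" if "C \<in> P2" for C
    using that part2 by (auto simp: partition_on_def)
  note uniq1 = partition_on_block_unique[OF part1] and uniq2 = partition_on_block_unique[OF part2]
  have jb: "j < b" using sub2[OF B(1)] B(2) by auto
  have disj12: "x \<notin> D" if "C \<in> P1" "x \<in> C" "D \<in> P2" for C D x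
    using sub1(1)[OF that(1)] sub2(1)[OF that(3)] that(2) by force
  have a1: "a \<notin> C" if "C \<in> P1" for C using sub1(1)[OF that] by auto
  have a2: "a \<notin> C" if "C \<in> P2" for C using sub2(1)[OF that] aj by auto
  show "partition_on {a..<b} P"
    unfolding partition_on_def
  proof (intro conjI)
    have "\<Union>P = \<Union>P1 \<union> (insert a (\<Union>P2))" using B unfolding P_def by blast
    also have "\<dots> = {Suc a..<j} \<union> insert a {j..<b}" 
      using partition_onD1[OF part1] partition_onD1[OF part2] by simp
    also have "\<dots> = {a..<b}" using aj jb by auto
    finally show "\<Union>P = {a..<b}" .
    show "{} \<notin> P" using partition_onD3[OF part1] partition_onD3[OF part2] by (auto simp: P_def)
    show "disjoint P"
    proof -
      have "C = D" if CD: "C \<in> P" "D \<in> P" "x \<in> C" "x \<in> D" for C D x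
      proof -
        have cases: "E \<in> P1 \<or> E = insert a B \<or> E \<in> P2 \<and> E \<noteq> B" if "E \<in> P" for E
          using that by (auto simp: P_def)
        consider "x = a" | "x \<in> B" | E where "E \<in> P1" "x \<in> E" | "x \<noteq> a" "x \<notin> B" "\<forall>E\<in>P1. x \<notin> E"
          by blast
        then show ?thesis
        proof cases
          case 1
          then show ?thesis using cases[OF CD(1)] cases[OF CD(2)] CD(3,4) a1 a2 by metis
        next
          case 2
          have "E = insert a B" if "E \<in> P" "x \<in> E" for E
            using cases[OF that(1)] disj12[OF _ that(2) B(1)] uniq2[OF _ B(1) that(2) 2] 2 by metis
          then show ?thesis using CD by metis
        next
          case (3 E)
          then have "x \<noteq> a" "x \<notin> B" using a1 disj12[OF _ _ B(1)] by auto
          then have "C \<in> P1" "D \<in> P1" 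
            using cases[OF CD(1)] cases[OF CD(2)] CD(3,4) disj12[OF 3] by auto
          then show ?thesis using uniq1 CD by metis
        next
          case 4
          then have "C \<in> P2" "D \<in> P2" using cases[OF CD(1)] cases[OF CD(2)] CD(3,4) by auto
          then show ?thesis using uniq2 CD by metis
        qed
      qed
      then show ?thesis unfolding pairwise_def disjnt_def by blast
    qed
  qed
  have in_gap: "x \<notin> D" if "C \<in> P1" "p \<in> C" "r \<in> C" "D \<in> insert (insert a B) (P2 - {B})" "p < x" "x < r" for C D p r x
  proof -
    have "a < p" "r < j" using sub1(1)[OF that(1)] that(2,3) by auto
    moreover have "D \<subseteq> insert a {j..<b}" using that(4) sub2(1) B by auto
    ultimately show ?thesis using that(5,6) by auto
  qed
  show "noncrossing P"
  proof (rule noncrossingI)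
    fix C D p q r s assume *: "C \<in> P" "D \<in> P" "p \<in> C" "q \<in> D" "r \<in> C" "s \<in> D" "p < q" "q < r" "r < s"
    let ?R = "insert (insert a B) (P2 - {B})"
    consider "C \<in> P1" "D \<in> P1" | "C \<in> P1" "D \<in> ?R" | "C \<in> ?R" "D \<in> P1" | "C \<in> ?R" "D \<in> ?R"
      using *(1,2) unfolding P_def by blast
    then show "C = D"
    proof cases
      case 1
      then show ?thesis using noncrossingD[OF nc1] * by blast
    next
      case 2
      then show ?thesis using in_gap[of C p r D q] * by blast
    next
      case 3
      then show ?thesis using in_gap[of D q s C r] * by blast
    next
      case 4
      have ge: "D \<in> ?R \<Longrightarrow> x \<in> D \<Longrightarrow> x = a \<or> j \<le> x" for D x
      proof -
        assume "D \<in> ?R" "x \<in> D"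
        then have "x \<in> insert a {j..<b}" using sub2(1) B(1) by blast
        then show ?thesis by auto
      qed
      have q: "q \<noteq> a" "r \<noteq> a" "s \<noteq> a" 
        using ge[OF 4(1) *(3)] aj * by auto
      show ?thesis
      proof (cases "C = insert a B")
        case C: True
        show ?thesis
        proof (cases "D = insert a B")
          case False
          then have D: "D \<in> P2" "D \<noteq> B" using 4(2) by auto
          \<comment> \<open>A crossing that starts at \<open>a\<close> is turned into one inside
            \<open>P2\<close> by putting \<open>j\<close>, an element of the same block, in place of
            \<open>a\<close>.\<close>
          have "j \<noteq> q" using uniq2[OF B(1) D(1) B(2)] D *(4) by auto
          moreover have "j \<le> q" using ge[OF 4(2) *(4)] q by auto
          ultimately have "j < q" by simp
          moreover have "r \<in> B" using C *(5) q by simp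
          ultimately have "B = D" using noncrossingD[OF nc2 B(1) D(1) B(2)] * by blast
          then show ?thesis using D by simp
        qed (use C in simp)
      next
        case False
        then have C: "C \<in> P2" "C \<noteq> B" using 4(1) by auto
        show ?thesis
        proof (cases "D = insert a B")
          case True
          then have "q \<in> B" "s \<in> B" using * q by auto
          then have "C = B" using noncrossingD[OF nc2 C(1) B(1)] * by blast
          then show ?thesis using C by simp
        next
          case False
          then have "D \<in> P2" using 4(2) by auto
          then show ?thesis using noncrossingD[OF nc2 C(1)] * by blast
        qed
      qed
    qed
  qed
  have n1: "\<not> C \<subseteq> {Suc a..<j}" if C2: "C \<in> P2" for C
  proof
    assume C: "C \<subseteq> {Suc a..<j}"
    obtain x where "x \<in> C" using sub2(2)[OF C2] by auto
    then show False using C sub2(1)[OF C2] by force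
  qed
  have n2: "\<not> C \<subseteq> {j..<b}" if C1: "C \<in> P1" for C
  proof
    assume C: "C \<subseteq> {j..<b}"
    obtain x where "x \<in> C" using sub1(2)[OF C1] by auto
    then show False using C sub1(1)[OF C1] by force
  qed
  have n3: "\<not> insert a B \<subseteq> {Suc a..<j}" "\<not> insert a B \<subseteq> {j..<b}" using aj by auto
  show "{C\<in>P. C \<subseteq> {Suc a..<j}} = P1" unfolding P_def using n1 n3 sub1(1) by blast
  show "insert B {C\<in>P. C \<subseteq> {j..<b}} = P2" unfolding P_def using n2 n3 sub2(1) B(1) by blast
  show "P1 \<inter> insert (insert a B) (P2 - {B}) = {}"
    using n1 sub1(1) n3 by blast
  show "insert a B \<notin> P2 - {B}" using a2 by blast
qed

abbreviation nc_partitions :: "nat set \<Rightarrow> nat set set set" where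
  "nc_partitions S \<equiv> {P. partition_on S P \<and> noncrossing P}"

definition nc_sum :: "(nat \<Rightarrow> real) \<Rightarrow> nat set \<Rightarrow> real" where
  "nc_sum f S = (\<Sum>P\<in>nc_partitions S. \<Prod>B\<in>P. f (card B))"

text \<open>Removing \<open>a\<close> from its block and remembering the removal in the shift \<open>s\<close> of the weight of that
  block splits the remaining partition at the second smallest element of the block, which gives a
  recursion with only two factors.\<close>

definition nc_block_sum :: "(nat \<Rightarrow> real) \<Rightarrow> nat \<Rightarrow> nat \<Rightarrow> nat \<Rightarrow> real" where
  "nc_block_sum f s a b = (\<Sum>P\<in>nc_partitions {a..<b}.
     f (card (block P a) + s) * (\<Prod>B\<in>P - {block P a}. f (card B)))"

lemma finite_nc_partitions: "finite S \<Longrightarrow> finite (nc_partitions S)"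
  by (rule finite_subset[OF _ finitely_many_partition_on[of S]]) auto

lemma nc_sum_empty: "nc_sum f {} = 1"
proof -
  have "nc_partitions {} = {{}}" by (auto simp: partition_on_empty noncrossing_def)
  then show ?thesis by (simp add: nc_sum_def)
qed

lemma nc_sum_eq_block_sum:
  assumes "a < b" shows "nc_sum f {a..<b} = nc_block_sum f 0 a b"
  unfolding nc_sum_def nc_block_sum_def
proof (intro sum.cong refl)
  fix P assume "P \<in> nc_partitions {a..<b}"
  then have P: "partition_on {a..<b} P" by simp
  have "block P a \<in> P" using block_in[OF P, of a] assms by simp
  then show "(\<Prod>B\<in>P. f (card B)) = f (card (block P a) + 0) * (\<Prod>B\<in>P - {block P a}. f (card B))"
    using prod.remove[OF finite_elements[OF _ P], of "block P a" "\<lambda>B. f (card B)"] by simp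
qed

lemma nc_block_sum_singleton:
  assumes "a < b"
  shows "(\<Sum>P\<in>{P \<in> nc_partitions {a..<b}. block P a = {a}}.
       f (card (block P a) + s) * (\<Prod>B\<in>P - {block P a}. f (card B))) = f (Suc s) * nc_sum f {Suc a..<b}"
  unfolding nc_sum_def sum_distrib_left
proof (rule sum.reindex_bij_witness[where i = "insert {a}" and j = "\<lambda>P. P - {{a}}"], goal_cases)
  case (1 P)
  then have P: "partition_on {a..<b} P" and B: "block P a = {a}" by auto
  have "{a} \<in> P" using block_in[OF P, of a] assms unfolding B by simp
  then show ?case by auto
next
  case (2 P)
  then have P: "partition_on {a..<b} P" "noncrossing P" and B: "block P a = {a}" by auto
  have a: "{a} \<in> P" using block_in[OF P(1), of a] assms unfolding B by simp
  have "disjnt {a} (\<Union>(P - {{a}}))"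
    using pairwiseD[OF partition_onD2[OF P(1)] a] by (auto simp: disjnt_iff)
  moreover have "insert {a} (P - {{a}}) = P" using a by auto
  moreover have "{a..<b} - {a} = {Suc a..<b}" by auto
  ultimately have "partition_on {Suc a..<b} (P - {{a}})"
    using partition_on_insert[of "{a}" "P - {{a}}" "{a..<b}"] P by simp
  then show ?case using noncrossing_subset[OF P(2)] by auto
next
  case (3 P)
  then have "\<Union>P = {Suc a..<b}" by (auto simp: partition_on_def)
  then have "a \<notin> \<Union>P" by simp
  then have "{a} \<notin> P" by blast
  then show ?case by auto
next
  case (4 P)
  then have P: "partition_on {Suc a..<b} P" "noncrossing P" by auto
  then have U: "\<Union>P = {Suc a..<b}" by (auto simp: partition_on_def)
  then have "disjnt {a} (\<Union>P)" by auto
  moreover have "{a..<b} - {a} = {Suc a..<b}" by auto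
  ultimately have part: "partition_on {a..<b} (insert {a} P)"
    using partition_on_insert[of "{a}" P "{a..<b}"] P assms by simp
  moreover have "noncrossing (insert {a} P)"
  proof (rule noncrossingI)
    fix A B p q r s assume *: "A \<in> insert {a} P" "B \<in> insert {a} P"
      "p \<in> A" "q \<in> B" "r \<in> A" "s \<in> B" "p < q" "q < r" "r < s"
    then have "A \<noteq> {a}" "B \<noteq> {a}" by auto
    then show "A = B" using * by (intro noncrossingD[OF P(2) _ _ *(3-)]) auto
  qed
  moreover have "block (insert {a} P) a = {a}" by (rule block_eq[OF part]) auto
  ultimately show ?case by simp
next
  case (5 P)
  then show ?case by simp
qed

text \<open>The sum is sorted by the second smallest element j of the block of \<open>a\<close>. The
  part from j on is a partition whose first block has lost \<open>a\<close>, which is recorded by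
  the shift \<open>Suc s\<close>.\<close>

lemma nc_block_sum_split:
  assumes "a < b"
  shows "(\<Sum>P\<in>{P \<in> nc_partitions {a..<b}. block P a \<noteq> {a}}.
       f (card (block P a) + s) * (\<Prod>B\<in>P - {block P a}. f (card B)))
    = (\<Sum>j\<in>{Suc a..<b}. nc_sum f {Suc a..<j} * nc_block_sum f (Suc s) j b)"
proof -
  let ?w = "\<lambda>s P a. f (card (block P a) + s) * (\<Prod>B\<in>P - {block P a}. f (card B))"
  let ?m = "\<lambda>P. Min (block P a - {a})"
  have "(\<Sum>P\<in>{P \<in> nc_partitions {a..<b}. block P a \<noteq> {a}}. ?w s P a)
    = (\<Sum>(j, P1, P2)\<in>(SIGMA j:{Suc a..<b}. nc_partitions {Suc a..<j} \<times> nc_partitions {j..<b}).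
        (\<Prod>B\<in>P1. f (card B)) * ?w (Suc s) P2 j)"
  proof (rule sum.reindex_bij_witness[where 
      i = "\<lambda>(j, P1, P2). P1 \<union> insert (insert a (block P2 j)) (P2 - {block P2 j})" and
      j = "\<lambda>P. (?m P, {C\<in>P. C \<subseteq> {Suc a..<?m P}}, insert (block P a - {a}) {C\<in>P. C \<subseteq> {?m P..<b}})"], goal_cases)
    case (1 P)
    then have P: "partition_on {a..<b} P" "noncrossing P" and ne: "block P a \<noteq> {a}" by auto
    define B where "B = block P a"
    have B: "B \<in> P" "a \<in> B" using block_in[OF P(1), of a] assms by (auto simp: B_def)
    define j where "j = Min (B - {a})"
    have fin: "finite (B - {a})" using partition_on_sub[OF P(1) B(1)] finite_subset[of B "{a..<b}"] by auto
    have ne': "B - {a} \<noteq> {}" using ne B unfolding B_def by blast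
    have j: "j \<in> B - {a}" using Min_in[OF fin ne'] by (simp add: j_def)
    then have j': "j \<in> B" "a < j" "j < b" using partition_on_sub[OF P(1) B(1)] by fastforce+
    have min: "x \<in> B \<Longrightarrow> a < x \<Longrightarrow> j \<le> x" for x using fin by (auto simp: j_def)
    note split = noncrossing_split[OF P B j'(1,2) min]
    have "block (insert (B - {a}) {C\<in>P. C \<subseteq> {j..<b}}) j = B - {a}"
      using split(3) j by (intro block_eq) auto
    moreover have "insert a (B - {a}) = B" using B by auto
    ultimately show ?case using split(5) unfolding B_def[symmetric] j_def[symmetric] by simp
  next
    case (2 P)
    then have P: "partition_on {a..<b} P" "noncrossing P" and ne: "block P a \<noteq> {a}" by auto
    define B where "B = block P a"
    have B: "B \<in> P" "a \<in> B" using block_in[OF P(1), of a] assms by (auto simp: B_def)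
    define j where "j = Min (B - {a})"
    have fin: "finite (B - {a})" using partition_on_sub[OF P(1) B(1)] finite_subset[of B "{a..<b}"] by auto
    have ne': "B - {a} \<noteq> {}" using ne B unfolding B_def by blast
    have j: "j \<in> B - {a}" using Min_in[OF fin ne'] by (simp add: j_def)
    then have j': "j \<in> B" "a < j" "j < b" using partition_on_sub[OF P(1) B(1)] by fastforce+
    have min: "x \<in> B \<Longrightarrow> a < x \<Longrightarrow> j \<le> x" for x using fin by (auto simp: j_def)
    note split = noncrossing_split[OF P B j'(1,2) min]
    show ?case using split(1-4) j' unfolding B_def[symmetric] j_def[symmetric] by simp
  next
    case (3 x)
    then obtain j P1 P2 where x: "x = (j, P1, P2)" and j: "a < j" "j < b"
      and P1: "partition_on {Suc a..<j} P1" "noncrossing P1"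
      and P2: "partition_on {j..<b} P2" "noncrossing P2" by auto
    define B where "B = block P2 j"
    have B: "B \<in> P2" "j \<in> B" using block_in[OF P2(1), of j] j by (auto simp: B_def)
    note join = noncrossing_join[OF P1 P2 B j(1)]
    have blk: "block (P1 \<union> insert (insert a B) (P2 - {B})) a = insert a B"
      by (rule block_eq[OF join(1)]) auto
    have sub: "B \<subseteq> {j..<b}" by (rule partition_on_sub[OF P2(1) B(1)])
    then have aB: "insert a B - {a} = B" using j by auto
    have "Min B = j" using sub B(2) finite_subset[OF sub] by (intro Min_eqI) auto
    then show ?case unfolding x prod.case B_def[symmetric] blk aB using join(3,4) by simp
  next
    case (4 x)
    then obtain j P1 P2 where x: "x = (j, P1, P2)" and j: "a < j" "j < b"
      and P1: "partition_on {Suc a..<j} P1" "noncrossing P1"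
      and P2: "partition_on {j..<b} P2" "noncrossing P2" by auto
    define B where "B = block P2 j"
    have B: "B \<in> P2" "j \<in> B" using block_in[OF P2(1), of j] j by (auto simp: B_def)
    note join = noncrossing_join[OF P1 P2 B j(1)]
    have blk: "block (P1 \<union> insert (insert a B) (P2 - {B})) a = insert a B"
      by (rule block_eq[OF join(1)]) auto
    have "insert a B \<noteq> {a}" using B(2) j by auto
    then show ?case unfolding x prod.case B_def[symmetric] mem_Collect_eq blk using join(1,2) by blast
  next
    case (5 P)
    then have P: "partition_on {a..<b} P" "noncrossing P" and ne: "block P a \<noteq> {a}" by auto
    define B where "B = block P a"
    have B: "B \<in> P" "a \<in> B" using block_in[OF P(1), of a] assms by (auto simp: B_def)
    define j where "j = Min (B - {a})"
    have finB: "finite B" using partition_on_sub[OF P(1) B(1)] finite_subset[of B "{a..<b}"] by auto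
    then have fin: "finite (B - {a})" by auto
    have ne': "B - {a} \<noteq> {}" using ne B unfolding B_def by blast
    have j: "j \<in> B - {a}" using Min_in[OF fin ne'] by (simp add: j_def)
    then have j': "j \<in> B" "a < j" "j < b" using partition_on_sub[OF P(1) B(1)] by fastforce+
    have min: "x \<in> B \<Longrightarrow> a < x \<Longrightarrow> j \<le> x" for x using fin by (auto simp: j_def)
    define P1 where "P1 = {C\<in>P. C \<subseteq> {Suc a..<j}}"
    define P2 where "P2 = insert (B - {a}) {C\<in>P. C \<subseteq> {j..<b}}"
    note split = noncrossing_split[OF P B j'(1,2) min, folded P1_def P2_def]
    have blk: "block P2 j = B - {a}"
      using split(3) j by (intro block_eq) (auto simp: P2_def)
    have BP2: "B - {a} \<in> P2" by (simp add: P2_def)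
    have ins: "insert a (B - {a}) = B" using B by auto
    note join = noncrossing_join[OF split(1-4) BP2 j j'(2), unfolded ins]
    have fin12: "finite P1" "finite P2" using split(1,3) by (auto intro: finite_elements[rotated])
    have PB: "P - {B} = P1 \<union> (P2 - {B - {a}})"
      using split(5) join(5,6) by blast
    have "(\<Prod>B\<in>P - {B}. f (card B)) = (\<Prod>B\<in>P1. f (card B)) * (\<Prod>B\<in>P2 - {B - {a}}. f (card B))"
      unfolding PB using fin12 join(5) by (intro prod.union_disjoint) auto
    moreover have "card B = Suc (card (B - {a}))" using card_Suc_Diff1[OF finB B(2)] by simp
    ultimately show ?case
      unfolding B_def[symmetric] j_def[symmetric] P1_def[symmetric] P2_def[symmetric] prod.case blk
      by (simp add: mult_ac)
  qed
  also have "\<dots> = (\<Sum>j\<in>{Suc a..<b}. \<Sum>(P1, P2)\<in>nc_partitions {Suc a..<j} \<times> nc_partitions {j..<b}.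
      (\<Prod>B\<in>P1. f (card B)) * ?w (Suc s) P2 j)"
    by (subst sum.Sigma) (auto intro!: finite_cartesian_product finite_nc_partitions)
  also have "\<dots> = (\<Sum>j\<in>{Suc a..<b}. nc_sum f {Suc a..<j} * nc_block_sum f (Suc s) j b)"
    unfolding nc_sum_def nc_block_sum_def sum_product sum.cartesian_product ..
  finally show ?thesis .
qed

text \<open>The value of \<open>nc_block_sum\<close> on intervals of length k. At k = 0 there is no
  first block and the value is 0, whereas a full partition sum over the empty interval is 1; hence
  the case distinctions.\<close>

fun free_rec :: "(nat \<Rightarrow> real) \<Rightarrow> nat \<Rightarrow> nat \<Rightarrow> real" where
  "free_rec f s 0 = 0"
| "free_rec f s (Suc k) = f (Suc s) * (if k = 0 then 1 else free_rec f 0 k)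
     + (\<Sum>i<k. (if i = 0 then 1 else free_rec f 0 i) * free_rec f (Suc s) (k - i))"

declare free_rec.simps(2) [simp del]

lemma nc_sum_rec:
  "nc_sum f {a..<a + k} = (if k = 0 then 1 else free_rec f 0 k)
   \<and> (k > 0 \<longrightarrow> nc_block_sum f s a (a + k) = free_rec f s k)"
proof (induction k arbitrary: a s rule: less_induct)
  case (less k)
  show ?case
  proof (cases k)
    case 0 then show ?thesis by (simp add: nc_sum_empty)
  next
    case (Suc l)
    have blk: "nc_block_sum f s a (a + k) = free_rec f s k" for s
    proof -
      have ab: "a < a + k" using Suc by simp
      have "nc_partitions {a..<a+k} = {P \<in> nc_partitions {a..<a+k}. block P a = {a}}
          \<union> {P \<in> nc_partitions {a..<a+k}. block P a \<noteq> {a}}" by blast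
      then have "nc_block_sum f s a (a + k) = f (Suc s) * nc_sum f {Suc a..<a+k}
         + (\<Sum>j\<in>{Suc a..<a+k}. nc_sum f {Suc a..<j} * nc_block_sum f (Suc s) j (a+k))"
        unfolding nc_block_sum_singleton[OF ab, symmetric, where s=s] nc_block_sum_split[OF ab, symmetric]
        unfolding nc_block_sum_def
        by (subst sum.union_disjoint[symmetric])
          (auto intro: finite_subset[OF _ finite_nc_partitions[of "{a..<a+k}"]] intro!: sum.cong)
      also have "nc_sum f {Suc a..<a+k} = (if l = 0 then 1 else free_rec f 0 l)"
        using less.IH[of l "Suc a"] Suc by simp
      also have "(\<Sum>j\<in>{Suc a..<a+k}. nc_sum f {Suc a..<j} * nc_block_sum f (Suc s) j (a+k))
          = (\<Sum>i<l. (if i = 0 then 1 else free_rec f 0 i) * free_rec f (Suc s) (l - i))"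
      proof (rule sum.reindex_bij_witness[where i = "\<lambda>i. Suc a + i" and j = "\<lambda>j. j - Suc a"], goal_cases)
        case (5 j)
        define i where "i = j - Suc a"
        have i: "j = Suc a + i" "i < l" using 5 Suc by (auto simp: i_def)
        have "a + k = j + (l - i)" using i Suc by simp
        then show ?case
          using less.IH[of i "Suc a"] less.IH[of "l - i" j "Suc s"] i Suc
          by (simp add: i_def[symmetric])
      qed (use Suc in auto)
      finally show ?thesis by (simp add: Suc free_rec.simps(2))
    qed
    then show ?thesis using nc_sum_eq_block_sum[of a "a + k" f] Suc by simp
  qed
qed

lemma free_moments_rec: "free_moments c k = (if k = 0 then 0 else free_rec c 0 k)"
proof -
  have "{1..k} = {1..<1 + k}" by auto
  then show ?thesis
    using nc_sum_rec[of c 1 k] unfolding free_moments_def nc_sum_def by simp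
qed

section \<open>Free cumulants\<close>

unbundle no vec_syntax and fps_syntax

text \<open>The polynomials take the value 2 cos (n \<theta>) at 2 cos \<theta> for n > 0, but 1
  instead of 2 for n = 0; this doubles the first coefficient.\<close>

definition cheb_coeff :: "nat \<Rightarrow> real" where
  "cheb_coeff n = (if n = 1 then 2 else 1)"

definition mom_fps :: "real fps" where
  "mom_fps = Abs_fps (\<lambda>k. if k = 0 then 1 else free_rec unit_cumulants 0 k)"

definition sub_fps :: "real fps" where "sub_fps = fps_X * mom_fps"

text \<open>This is 1 / sqrt (1 - 4 X^2), the moment series of the arcsine law, written without a
  square root.\<close>

definition jac_fps :: "real fps" where "jac_fps = inverse (1 - 2 * fps_X * sub_fps)"

text \<open>The first block has already lost two elements, so it originally had at least three and
  weight 0.\<close>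

lemma free_rec_unit_eq_0: "s \<ge> 2 \<Longrightarrow> free_rec unit_cumulants s k = 0"
proof (induction k arbitrary: s rule: less_induct)
  case (less k)
  show ?case
  proof (cases k)
    case (Suc l)
    have "(\<Sum>i<l. (if i = 0 then 1 else free_rec unit_cumulants 0 i) * free_rec unit_cumulants (Suc s) (l - i)) = 0"
      using less Suc by (intro sum.neutral) auto
    moreover have "unit_cumulants (Suc s) = 0" using less.prems by (simp add: unit_cumulants_def)
    ultimately show ?thesis by (simp only: Suc free_rec.simps(2) mult_zero_left add_0)
  qed simp
qed

lemma fps_X_mult_eqI:
  assumes "F $ 0 = 0" "\<And>k. F $ Suc k = G $ k"
  shows "F = fps_X * (G :: real fps)"
proof (rule fps_ext)
  fix n show "F $ n = (fps_X * G) $ n" using assms by (cases n) auto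
qed

lemma sum_lessThan_eq_fps_mult:
  fixes A B :: "real fps"
  assumes "B $ 0 = 0"
  shows "(\<Sum>i<k. A $ i * B $ (k - i)) = (A * B) $ k"
proof -
  have "(A * B) $ k = (\<Sum>i\<in>insert k {..<k}. A $ i * B $ (k - i))"
    unfolding fps_mult_nth by (intro sum.cong) auto
  then show ?thesis using assms by simp
qed

lemma free_rec_fps:
  "Abs_fps (free_rec unit_cumulants s) = fps_X * (fps_const (unit_cumulants (Suc s)) * mom_fps
     + mom_fps * Abs_fps (free_rec unit_cumulants (Suc s)))"
proof (rule fps_X_mult_eqI)
  fix k
  have "Abs_fps (free_rec unit_cumulants s) $ Suc k = unit_cumulants (Suc s) * mom_fps $ k
      + (\<Sum>i<k. mom_fps $ i * Abs_fps (free_rec unit_cumulants (Suc s)) $ (k - i))"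
    by (simp add: free_rec.simps(2) mom_fps_def)
  then show "Abs_fps (free_rec unit_cumulants s) $ Suc k = (fps_const (unit_cumulants (Suc s)) * mom_fps
     + mom_fps * Abs_fps (free_rec unit_cumulants (Suc s))) $ k"
    by (subst (asm) sum_lessThan_eq_fps_mult) auto
qed simp

lemma free_rec_unit_fps:
  "Abs_fps (free_rec unit_cumulants 0) = sub_fps * sub_fps"
  "Abs_fps (free_rec unit_cumulants (Suc 0)) = sub_fps"
  "s \<ge> 2 \<Longrightarrow> Abs_fps (free_rec unit_cumulants s) = 0"
proof -
  show 2: "s \<ge> 2 \<Longrightarrow> Abs_fps (free_rec unit_cumulants s) = 0" for s
    by (intro fps_ext) (simp add: free_rec_unit_eq_0)
  show 1: "Abs_fps (free_rec unit_cumulants (Suc 0)) = sub_fps"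
    by (subst free_rec_fps) (simp add: 2 unit_cumulants_def sub_fps_def)
  show "Abs_fps (free_rec unit_cumulants 0) = sub_fps * sub_fps"
    by (subst free_rec_fps) (simp add: 1 unit_cumulants_def sub_fps_def mult_ac)
qed

lemma mom_fps_eq: "mom_fps = 1 + sub_fps * sub_fps"
proof -
  have "mom_fps = 1 + Abs_fps (free_rec unit_cumulants 0)"
    by (rule fps_ext) (simp add: mom_fps_def)
  then show ?thesis by (simp add: free_rec_unit_fps)
qed

lemma sub_fps_eq: "sub_fps = fps_X * (1 + sub_fps * sub_fps)"
  using mom_fps_eq sub_fps_def by metis

lemma sub_fps_0 [simp]: "sub_fps $ 0 = 0" by (simp add: sub_fps_def)

lemma jac_fps_eq: "jac_fps = 1 + 2 * fps_X * sub_fps * jac_fps"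
proof -
  have "jac_fps * (1 - 2 * fps_X * sub_fps) = 1"
    unfolding jac_fps_def by (intro inverse_mult_eq_1) simp
  then show ?thesis by (simp add: algebra_simps)
qed

lemma jac_fps_0 [simp]: "jac_fps $ 0 = 1"
  by (subst jac_fps_eq) (simp add: mult.assoc)

text \<open>A path to height \<open>n\<close> splits at its last visits to the heights below
  \<open>n\<close>: \<open>jac_fps\<close> counts the part up to the last visit to 0, each
  \<open>sub_fps\<close> an ascent followed by an excursion. In the proof, \<open>jac_fps_eq\<close>
  gives the recursion at height 0 and \<open>sub_fps_eq\<close> that at the other heights.\<close>

lemma path_weight_cheb: "path_weight cheb_coeff k n = (jac_fps * sub_fps ^ n) $ k"
proof (induction k arbitrary: n)
  case 0
  show ?case by (cases n) (auto simp: fps_mult_nth_0)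
next
  case (Suc k)
  show ?case
  proof (cases n)
    case 0
    have "jac_fps = 1 + fps_X * (fps_const 2 * (jac_fps * sub_fps ^ 1))"
      by (subst jac_fps_eq) (simp add: fps_numeral_fps_const[symmetric] mult_ac)
    then have "jac_fps $ Suc k = (1 + fps_X * (fps_const 2 * (jac_fps * sub_fps ^ 1))) $ Suc k" by (rule arg_cong)
    also have "\<dots> = 2 * (jac_fps * sub_fps ^ 1) $ k" by simp
    finally have "jac_fps $ Suc k = 2 * (jac_fps * sub_fps ^ 1) $ k" .
    then show ?thesis using 0 Suc[of 1] by (simp add: cheb_coeff_def)
  next
    case (Suc m)
    have "jac_fps * sub_fps ^ Suc m = jac_fps * sub_fps ^ m * (fps_X * (1 + sub_fps * sub_fps))"
      using sub_fps_eq by (metis mult.assoc power_Suc2)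
    also have "\<dots> = fps_X * (jac_fps * sub_fps ^ m + jac_fps * sub_fps ^ Suc (Suc m))"
      by (simp add: algebra_simps)
    finally have "(jac_fps * sub_fps ^ n) $ Suc k = (jac_fps * sub_fps ^ m + jac_fps * sub_fps ^ Suc (Suc m)) $ k"
      unfolding Suc by (simp only: fps_X_mult_nth) simp
    then show ?thesis using Suc Suc.IH[of m] Suc.IH[of "Suc (Suc m)"] by (simp add: cheb_coeff_def)
  qed
qed

text \<open>With M = \<open>mom_fps\<close> and u = \<open>sub_fps\<close> = X M, the product of M
  and 1 - 2 X u is M - 2 u^2 = 1 - u^2.\<close>

lemma mom_fps_jac: "mom_fps = jac_fps - jac_fps * sub_fps ^ 2"
proof -
  have "fps_X * mom_fps = sub_fps" by (simp add: sub_fps_def)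
  moreover have "mom_fps * (1 - 2 * fps_X * sub_fps) = mom_fps - 2 * sub_fps * (fps_X * mom_fps)"
    by (simp add: algebra_simps)
  ultimately have "mom_fps * (1 - 2 * fps_X * sub_fps) = mom_fps - 2 * sub_fps * sub_fps" by simp
  also have "\<dots> = 1 - sub_fps ^ 2"
    by (simp add: mom_fps_eq power2_eq_square)
  finally have "mom_fps * (1 - 2 * fps_X * sub_fps) = 1 - sub_fps ^ 2" .
  moreover have "(1 - 2 * fps_X * sub_fps) * jac_fps = 1"
    unfolding jac_fps_def by (intro inverse_mult_eq_1') simp
  then have "mom_fps = mom_fps * (1 - 2 * fps_X * sub_fps) * jac_fps" by (simp only: mult.assoc mult_1_right)
  ultimately have "mom_fps = (1 - sub_fps ^ 2) * jac_fps" by (rule subst)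
  then show ?thesis by (simp add: algebra_simps)
qed

lemma free_rec_unit:
  "k > 0 \<Longrightarrow> free_rec unit_cumulants 0 k = path_weight cheb_coeff k 0 - path_weight cheb_coeff k 2"
  using arg_cong[OF mom_fps_jac, of "\<lambda>F. F $ k"] by (simp add: path_weight_cheb mom_fps_def)

context
  fixes c :: "real \<Rightarrow> nat \<Rightarrow> real" and d :: "nat \<Rightarrow> real"
  assumes c: "\<And>j. ((\<lambda>\<epsilon>. c \<epsilon> j) has_real_derivative d j) (at 0)" and c0: "c 0 = unit_cumulants"
begin

text \<open>The linearization at \<open>unit_cumulants\<close> is solved in closed form: the moment series satisfies
  \<open>M = 1 + u\<^sup>2\<close> with \<open>u = X M\<close>, so its derivative \<open>M'\<close> satisfies \<open>(1 - 2 X u) M' = (\<Sum>n. d\<^sub>n u\<^sup>n)\<close>.\<close>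

definition dir_fps :: "nat \<Rightarrow> real fps" where
  "dir_fps s = Abs_fps (\<lambda>j. if j = 0 then 0 else d (s + j)) oo sub_fps"

definition dmom_fps :: "real fps" where
  "dmom_fps = jac_fps * dir_fps 0"

text \<open>At the base point the recursion has the values u^2, u, 0 for shifts 0, 1, \<ge> 2. The
  added term is their derivative when u moves with velocity \<open>fps_X * dmom_fps\<close>.\<close>

definition drec_fps :: "nat \<Rightarrow> real fps" where
  "drec_fps s = dir_fps s + (if s = 0 then 2 * fps_X * sub_fps * dmom_fps
     else if s = 1 then fps_X * dmom_fps else 0)"

lemma dir_fps_rec: "dir_fps s = fps_const (d (Suc s)) * sub_fps + sub_fps * dir_fps (Suc s)"
proof -
  have "Abs_fps (\<lambda>j. if j = 0 then 0 else d (s + j))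
      = fps_X * (fps_const (d (Suc s)) + Abs_fps (\<lambda>j. if j = 0 then 0 else d (Suc s + j)))"
    by (rule fps_X_mult_eqI) auto
  then show ?thesis
    by (simp add: dir_fps_def fps_compose_mult_distrib fps_compose_add_distrib algebra_simps)
qed

lemma dir_fps_0 [simp]: "dir_fps s $ 0 = 0" by (simp add: dir_fps_def)

lemma drec_fps_0: "drec_fps 0 = dmom_fps"
proof -
  have "jac_fps * dir_fps 0 = (1 + 2 * fps_X * sub_fps * jac_fps) * dir_fps 0"
    by (subst jac_fps_eq) (rule refl)
  also have "\<dots> = dir_fps 0 + 2 * fps_X * sub_fps * (jac_fps * dir_fps 0)"
    by (simp add: algebra_simps)
  finally show ?thesis by (simp only: drec_fps_def dmom_fps_def if_True simp_thms)
qed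

lemma drec_fps_nth_0: "drec_fps s $ 0 = 0" "dmom_fps $ 0 = 0"
  by (auto simp: drec_fps_def dmom_fps_def mult.assoc)

text \<open>The proposed derivatives solve the recursion of \<open>free_rec\<close> differentiated
  by the product rule.\<close>

lemma drec_fps_rec:
  "drec_fps s = fps_X * (fps_const (d (Suc s)) * mom_fps + fps_const (unit_cumulants (Suc s)) * dmom_fps
     + dmom_fps * Abs_fps (free_rec unit_cumulants (Suc s)) + mom_fps * drec_fps (Suc s))"
proof -
  consider "s = 0" | "s = 1" | "s \<ge> 2" by linarith
  then show ?thesis
  proof cases
    case 1
    then show ?thesis
      using dir_fps_rec[of 0]
      by (simp add: drec_fps_def free_rec_unit_fps unit_cumulants_def algebra_simps sub_fps_def)
  next
    case 2
    then show ?thesis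
      using dir_fps_rec[of 1] free_rec_unit_fps(3)[of "Suc (Suc 0)"]
      by (simp add: drec_fps_def unit_cumulants_def algebra_simps sub_fps_def)
  next
    case 3
    then show ?thesis
      using dir_fps_rec[of s] free_rec_unit_fps(3)[of "Suc s"]
      by (simp add: drec_fps_def unit_cumulants_def algebra_simps sub_fps_def)
  qed
qed

lemma free_rec_derivative:
  "((\<lambda>\<epsilon>. free_rec (c \<epsilon>) s k) has_real_derivative drec_fps s $ k) (at 0)"
proof (induction k arbitrary: s rule: less_induct)
  case (less k)
  show ?case
  proof (cases k)
    case 0
    then show ?thesis by (simp add: drec_fps_nth_0)
  next
    case (Suc l)
    have e: "((\<lambda>\<epsilon>. if i = 0 then 1 else free_rec (c \<epsilon>) 0 i) has_real_derivative dmom_fps $ i) (at 0)" if "i < k" for i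
      using less.IH[OF that, of 0] by (cases "i = 0") (simp_all add: drec_fps_0 drec_fps_nth_0)
    have e0: "(if i = 0 then 1 else free_rec (c 0) 0 i) = mom_fps $ i" for i
      by (simp add: mom_fps_def c0)
    let ?G = "Abs_fps (free_rec unit_cumulants (Suc s))"
    have "((\<lambda>\<epsilon>. free_rec (c \<epsilon>) s (Suc l)) has_real_derivative
        (d (Suc s) * mom_fps $ l + dmom_fps $ l * unit_cumulants (Suc s))
        + (\<Sum>i<l. dmom_fps $ i * ?G $ (l - i) + drec_fps (Suc s) $ (l - i) * mom_fps $ i)) (at 0)"
      unfolding free_rec.simps(2)
    proof (intro DERIV_add DERIV_sum)
      show "((\<lambda>\<epsilon>. c \<epsilon> (Suc s) * (if l = 0 then 1 else free_rec (c \<epsilon>) 0 l)) has_real_derivative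
          d (Suc s) * mom_fps $ l + dmom_fps $ l * unit_cumulants (Suc s)) (at 0)"
        using DERIV_mult[OF c e[of l]] e0[of l] Suc c0 by simp
    next
      fix i assume i: "i \<in> {..<l}"
      then have "((\<lambda>\<epsilon>. free_rec (c \<epsilon>) (Suc s) (l - i)) has_real_derivative drec_fps (Suc s) $ (l - i)) (at 0)"
        using Suc by (intro less.IH) auto
      from DERIV_mult[OF e[of i] this]
      show "((\<lambda>\<epsilon>. (if i = 0 then 1 else free_rec (c \<epsilon>) 0 i) * free_rec (c \<epsilon>) (Suc s) (l - i))
          has_real_derivative dmom_fps $ i * ?G $ (l - i) + drec_fps (Suc s) $ (l - i) * mom_fps $ i) (at 0)"
        using i Suc e0[of i] c0 by simp
    qed
    also have "(\<Sum>i<l. dmom_fps $ i * ?G $ (l - i) + drec_fps (Suc s) $ (l - i) * mom_fps $ i)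
        = (dmom_fps * ?G) $ l + (mom_fps * drec_fps (Suc s)) $ l"
    proof -
      have "(\<Sum>i<l. dmom_fps $ i * ?G $ (l - i)) = (dmom_fps * ?G) $ l"
        by (rule sum_lessThan_eq_fps_mult) simp
      moreover have "(\<Sum>i<l. mom_fps $ i * drec_fps (Suc s) $ (l - i)) = (mom_fps * drec_fps (Suc s)) $ l"
        by (rule sum_lessThan_eq_fps_mult) (rule drec_fps_nth_0)
      moreover have "drec_fps (Suc s) $ (l - i) * mom_fps $ i = mom_fps $ i * drec_fps (Suc s) $ (l - i)" for i
        by (rule mult.commute)
      ultimately show ?thesis by (simp only: sum.distrib)
    qed
    also have "(d (Suc s) * mom_fps $ l + dmom_fps $ l * unit_cumulants (Suc s))
        + ((dmom_fps * ?G) $ l + (mom_fps * drec_fps (Suc s)) $ l) = drec_fps s $ Suc l"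
      by (subst drec_fps_rec) (simp only: fps_X_mult_nth, simp)
    finally show ?thesis unfolding Suc .
  qed
qed

lemma dmom_fps_nth: "dmom_fps $ k = (\<Sum>n=1..k. path_weight cheb_coeff k n * d n)"
proof -
  let ?D = "\<lambda>j. if j = 0 then 0 else d (0 + j)"
  have "dmom_fps $ k = (\<Sum>i=0..k. jac_fps $ i * (\<Sum>n=0..k-i. ?D n * (sub_fps ^ n) $ (k - i)))"
    by (simp add: dmom_fps_def dir_fps_def fps_mult_nth fps_compose_nth)
  also have "\<dots> = (\<Sum>i=0..k. jac_fps $ i * (\<Sum>n=0..k. ?D n * (sub_fps ^ n) $ (k - i)))"
  proof (rule sum.cong[OF refl])
    fix i
    \<comment> \<open>\<open>sub_fps\<close> has no constant term, so its higher powers contribute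
      nothing and the range can be made independent of i.\<close>
    have "(\<Sum>n=0..k-i. ?D n * (sub_fps ^ n) $ (k - i)) = (\<Sum>n=0..k. ?D n * (sub_fps ^ n) $ (k - i))"
      by (rule sum.mono_neutral_left) (auto simp: startsby_zero_power_prefix)
    then show "jac_fps $ i * (\<Sum>n=0..k-i. ?D n * (sub_fps ^ n) $ (k - i))
        = jac_fps $ i * (\<Sum>n=0..k. ?D n * (sub_fps ^ n) $ (k - i))" by (rule arg_cong)
  qed
  also have "\<dots> = (\<Sum>n=0..k. \<Sum>i=0..k. jac_fps $ i * (?D n * (sub_fps ^ n) $ (k - i)))"
    unfolding sum_distrib_left by (rule sum.swap)
  also have "\<dots> = (\<Sum>n=0..k. path_weight cheb_coeff k n * ?D n)"
    by (intro sum.cong refl) (simp add: path_weight_cheb fps_mult_nth sum_distrib_left sum_distrib_right mult_ac)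
  also have "\<dots> = (\<Sum>n=1..k. path_weight cheb_coeff k n * d n)"
    by (rule sum.mono_neutral_cong_right) auto
  finally show ?thesis .
qed

lemma free_moments_derivative:
  "((\<lambda>\<epsilon>. free_moments (c \<epsilon>) k) has_real_derivative (\<Sum>n=1..k. path_weight cheb_coeff k n * d n)) (at 0)"
  using free_rec_derivative[of 0 k] unfolding free_moments_rec drec_fps_0 dmom_fps_nth
  by (cases "k = 0") auto

end

interpretation free: cumulant_transform "\<lambda>k. nc_partitions {1..k}" "\<lambda>n. 1"
  by unfold_locales (auto intro: partition_on_space simp: noncrossing_def)

lemma free_moments_eq: "free.moments = free_moments"
  by (intro ext) (simp only: free.moments_def free_moments_def mult_1_left)

lemma free_moments_unit:
  "free_moments unit_cumulants k = (if k = 0 then 0 else path_weight cheb_coeff k 0 - path_weight cheb_coeff k 2)"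
  by (simp add: free_moments_rec free_rec_unit)

section \<open>A free pair of semicircular variables\<close>

text \<open>Creation plus annihilation of the letter \<open>i\<close> on functions of words, the
  coordinates in the full Fock space: the first summand prepends \<open>i\<close> to a word, the
  second one removes it.\<close>

definition fock :: "bool \<Rightarrow> (bool list \<Rightarrow> real) \<Rightarrow> bool list \<Rightarrow> real" where
  "fock i f v = (case v of [] \<Rightarrow> 0 | j # u \<Rightarrow> if j = i then f u else 0) + f (i # v)"

lemma fock_simps [simp]:
  "fock i f [] = f [i]"
  "fock i f (j # u) = (if j = i then f u else 0) + f (i # j # u)"
  by (simp_all add: fock_def)

definition vacuum :: "bool list \<Rightarrow> real" where
  "vacuum v = (if v = [] then 1 else 0)"

definition fock_state :: "bool list \<Rightarrow> real" where
  "fock_state w = foldr fock w vacuum []"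

primrec fock_vector :: "(bool \<times> real poly) list \<Rightarrow> bool list \<Rightarrow> real" where
  "fock_vector [] = vacuum"
| "fock_vector (q # ps) = (\<lambda>v. \<Sum>k\<le>degree (snd q).
     coeff (snd q) k * (fock (fst q) ^^ k) (fock_vector ps) v)"

lemma fock_sum: "fock i (\<lambda>v. \<Sum>k\<in>A. c k * f k v) = (\<lambda>v. \<Sum>k\<in>A. c k * fock i (f k) v)"
  by (rule ext) (auto simp: fock_def sum.distrib distrib_left split: list.split)

lemma foldr_fock_sum:
  "foldr fock w (\<lambda>v. \<Sum>k\<in>A. c k * f k v) = (\<lambda>v. \<Sum>k\<in>A. c k * foldr fock w (f k) v)"
  by (induction w) (simp_all add: fock_sum)

lemma joint_moment_fock_state: "joint_moment fock_state w ps = foldr fock w (fock_vector ps) []"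
proof (induction ps arbitrary: w)
  case (Cons q ps)
  then show ?case by (simp only: joint_moment.simps fock_vector.simps foldr_fock_sum foldr_append foldr_replicate)
qed (simp add: fock_state_def)

text \<open>If no word in the support of \<open>f\<close> starts with \<open>i\<close>, the operator
  acts along the words i, i i, ... followed by \<open>v\<close> as the Jacobi matrix with all
  coefficients 1.\<close>

lemma fock_funpow:
  assumes f: "\<And>v. f (i # v) = 0" and v: "v = [] \<or> hd v \<noteq> i"
  shows "(fock i ^^ k) f (replicate j i @ v) = path_weight (\<lambda>_. 1) k j * f v"
proof (induction k arbitrary: j)
  case 0
  then show ?case using f by (cases j) auto
next
  case (Suc k)
  have "i # replicate j i @ v = replicate (Suc j) i @ v" by simp
  then have *: "(fock i ^^ k) f (i # replicate j i @ v) = path_weight (\<lambda>_. 1) k (Suc j) * f v"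
    using Suc[of "Suc j"] by simp
  show ?case
  proof (cases j)
    case 0
    then show ?thesis using * v by (cases v) auto
  next
    case (Suc l)
    then show ?thesis using * Suc.IH[of l] by (simp add: distrib_right)
  qed
qed

lemma fock_funpow_vacuum: "(fock i ^^ k) vacuum [] = path_weight (\<lambda>_. 1) k 0"
  using fock_funpow[of vacuum i "[]" k 0] by (simp add: vacuum_def)

text \<open>By induction the vector of the remaining factors has no words starting with the letter
  of the first factor, so \<open>fock_funpow\<close> applies. The component that stays at such a
  word \<open>v\<close> is multiplied by the moment of the first polynomial, which is 0. Freeness is
  the case of the empty word.\<close>

lemma fock_vector_support:
  assumes "ps \<noteq> []" "successively (\<lambda>q r. fst q \<noteq> fst r) ps"
    and "\<forall>q\<in>set ps. joint_moment fock_state [] [q] = 0"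
  shows "v = [] \<or> hd v \<noteq> fst (hd ps) \<Longrightarrow> fock_vector ps v = 0"
  using assms
proof (induction ps arbitrary: v)
  case (Cons q ps)
  let ?i = "fst q"
  have f: "fock_vector ps (?i # u) = 0" for u
  proof (cases ps)
    case (Cons r rs)
    then show ?thesis using Cons.IH[of "?i # u"] Cons.prems by auto
  qed (simp add: vacuum_def)
  have "(\<Sum>k\<le>degree (snd q). coeff (snd q) k * path_weight (\<lambda>_. 1) k 0) = 0"
    using Cons.prems(4) by (simp add: joint_moment_fock_state fock_funpow_vacuum del: joint_moment.simps)
  moreover have "(fock ?i ^^ k) (fock_vector ps) v = path_weight (\<lambda>_. 1) k 0 * fock_vector ps v" for k
    using fock_funpow[of "fock_vector ps" ?i v k 0, OF f] Cons.prems(1) by simp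
  ultimately show ?case by (simp add: sum_distrib_right[symmetric] mult.assoc[symmetric])
qed simp

lemma freely_independent_fock_state: "freely_independent fock_state"
  unfolding freely_independent_def
  using fock_vector_support[where v = "[]"]
  by (auto simp: fock_state_def vacuum_def joint_moment_fock_state)

lemma fock_state_replicate: "fock_state (replicate k i) = path_weight (\<lambda>_. 1) k 0"
  by (simp add: fock_state_def fock_funpow_vacuum)

section \<open>The sum of the two semicircular variables\<close>

lemma words_Suc: "{w :: bool list. length w = Suc k} = (#) False ` {w. length w = k} \<union> (#) True ` {w. length w = k}"
proof (intro equalityI subsetI)
  fix w :: "bool list" assume "w \<in> {w. length w = Suc k}"
  then obtain b u where "w = b # u" "length u = k" by (auto simp: length_Suc_conv)
  then show "w \<in> (#) False ` {w. length w = k} \<union> (#) True ` {w. length w = k}" by (cases b) auto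
qed auto

lemma finite_words: "finite {w :: bool list. length w = k}"
  using finite_lists_length_eq[of "UNIV :: bool set" k] by simp

text \<open>Powers of the sum of both operators applied to the vacuum depend only on the length of
  the word; each word has two extensions by one letter, whence the coefficient 2.\<close>

lemma sum_words_fock:
  "(\<Sum>w | length w = k. foldr fock w vacuum v) = path_weight (\<lambda>_. 2) k (length v)"
proof (induction k arbitrary: v)
  case 0
  then show ?case by (simp add: vacuum_def)
next
  case (Suc k)
  let ?W = "{w :: bool list. length w = k}"
  have "(\<Sum>w | length w = Suc k. foldr fock w vacuum v)
      = (\<Sum>w\<in>?W. fock False (foldr fock w vacuum) v) + (\<Sum>w\<in>?W. fock True (foldr fock w vacuum) v)"
    unfolding words_Suc using finite_words[of k]
    by (subst sum.union_disjoint) (auto simp: sum.reindex)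
  also have "\<dots> = fock False (\<lambda>v. \<Sum>w\<in>?W. 1 * foldr fock w vacuum v) v + fock True (\<lambda>v. \<Sum>w\<in>?W. 1 * foldr fock w vacuum v) v"
    unfolding fock_sum by simp
  also have "\<dots> = path_weight (\<lambda>_. 2) (Suc k) (length v)"
    by (cases v) (auto simp: Suc)
  finally show ?case .
qed

text \<open>A path of \<open>k\<close> steps to height \<open>n\<close> has (k - n) / 2 down steps,
  each of which contributes a factor \<open>s\<close>.\<close>

lemma path_weight_scale:
  assumes "s > 0"
  shows "sqrt s ^ n * path_weight (\<lambda>n. s * \<beta> n) k n = sqrt s ^ k * path_weight \<beta> k n"
proof (induction k arbitrary: n)
  case (Suc k)
  have s: "sqrt s ^ n * s = sqrt s * sqrt s ^ Suc n" for n using assms by simp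
  have 1: "sqrt s ^ n * (s * \<beta> (Suc n) * path_weight (\<lambda>n. s * \<beta> n) k (Suc n))
      = sqrt s ^ Suc k * (\<beta> (Suc n) * path_weight \<beta> k (Suc n))" for n
  proof -
    have "sqrt s ^ n * (s * \<beta> (Suc n) * path_weight (\<lambda>n. s * \<beta> n) k (Suc n))
        = sqrt s * \<beta> (Suc n) * (sqrt s ^ Suc n * path_weight (\<lambda>n. s * \<beta> n) k (Suc n))"
      using s[of n] assms by (simp add: mult_ac)
    then show ?thesis unfolding Suc by simp
  qed
  show ?case
  proof (cases n)
    case 0
    then show ?thesis using 1[of 0] by simp
  next
    case n: (Suc m)
    have "sqrt s ^ Suc m * path_weight (\<lambda>n. s * \<beta> n) k m = sqrt s ^ Suc k * path_weight \<beta> k m"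
      using Suc[of m] by simp
    then show ?thesis using 1[of "Suc m"] unfolding n by (simp only: path_weight.simps nat.case distrib_left)
  qed
qed auto

lemma sum_words_fock_state:
  "(\<Sum>w | length w = k. fock_state w) = sqrt 2 ^ k * path_weight (\<lambda>_. 1) k 0"
  using sum_words_fock[where k = k and v = "[]"] path_weight_scale[where s = 2 and n = 0 and \<beta> = "\<lambda>_. 1" and k = k] by (simp add: fock_state_def)

text \<open>Expanding the vanishing moment of these centred polynomials expresses \<open>\<tau>\<close> at a word through its
  values at shorter words.\<close>

definition centred_blocks :: "(bool list \<Rightarrow> real) \<Rightarrow> (bool \<times> nat) list \<Rightarrow> (bool \<times> real poly) list" where
  "centred_blocks \<tau> = map (\<lambda>(i, K). (i, monom 1 K - [:\<tau> (replicate K i):]))"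

definition block_word :: "(bool \<times> nat) list \<Rightarrow> bool list" where
  "block_word bs = concat (map (\<lambda>(i, K). replicate K i) bs)"

lemma joint_moment_monom_diff:
  assumes "K > 0"
  shows "joint_moment \<tau> u ((i, monom 1 K - [:c:]) # ps)
    = joint_moment \<tau> (u @ replicate K i) ps - c * joint_moment \<tau> u ps"
proof -
  let ?p = "monom 1 K - [:c:]"
  have co: "coeff ?p k = (if k = K then 1 else 0) - (if k = 0 then c else 0)" for k
    by (cases k) (auto simp: coeff_pCons)
  have "degree ?p \<le> K" by (intro degree_le allI impI) (simp only: co, use assms in simp)
  moreover have "K \<le> degree ?p" by (intro le_degree) (simp only: co, use assms in simp)
  ultimately have deg: "degree ?p = K" by simp
  have "(\<Sum>k\<le>K. coeff ?p k * joint_moment \<tau> (u @ replicate k i) ps)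
      = (\<Sum>k\<in>{0, K}. coeff ?p k * joint_moment \<tau> (u @ replicate k i) ps)"
    by (rule sum.mono_neutral_right) (auto simp: co simp del: coeff_diff)
  also have "\<dots> = joint_moment \<tau> (u @ replicate K i) ps - c * joint_moment \<tau> u ps"
    using assms by (simp add: co del: coeff_diff)
  finally show ?thesis by (simp add: deg)
qed

text \<open>All terms of the expanded centred product except the leading one involve shorter words,
  on which both functionals agree, so they cancel in the difference.\<close>

lemma joint_moment_centred_blocks_diff:
  assumes agree: "\<And>w. length w < N \<Longrightarrow> \<tau> w = \<tau>' w"
    and "length u + length (block_word bs) \<le> N" "\<forall>(i, K)\<in>set bs. K > 0"
    and "\<And>i K. \<tau> (replicate K i) = \<tau>' (replicate K i)"
  shows "joint_moment \<tau> u (centred_blocks \<tau> bs) - joint_moment \<tau>' u (centred_blocks \<tau>' bs)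
    = \<tau> (u @ block_word bs) - \<tau>' (u @ block_word bs)"
  using assms(2,3)
proof (induction bs arbitrary: u)
  case Nil
  then show ?case by (simp add: centred_blocks_def block_word_def)
next
  case (Cons b bs)
  obtain i K where b: "b = (i, K)" by (cases b)
  have K: "K > 0" using Cons.prems b by simp
  have cb: "centred_blocks \<sigma> (b # bs) = (i, monom 1 K - [:\<sigma> (replicate K i):]) # centred_blocks \<sigma> bs" for \<sigma>
    by (simp add: centred_blocks_def b)
  have wb: "block_word (b # bs) = replicate K i @ block_word bs" by (simp add: block_word_def b)
  have 1: "joint_moment \<tau> (u @ replicate K i) (centred_blocks \<tau> bs) - joint_moment \<tau>' (u @ replicate K i) (centred_blocks \<tau>' bs)
      = \<tau> (u @ block_word (b # bs)) - \<tau>' (u @ block_word (b # bs))"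
    using Cons.IH[of "u @ replicate K i"] Cons.prems by (simp add: wb)
  have "joint_moment \<tau> u (centred_blocks \<tau> bs) - joint_moment \<tau>' u (centred_blocks \<tau>' bs)
      = \<tau> (u @ block_word bs) - \<tau>' (u @ block_word bs)"
    using Cons.IH[of u] Cons.prems by (simp add: wb)
  also have "\<dots> = 0" using agree[of "u @ block_word bs"] Cons.prems K by (simp add: wb)
  finally show ?case
    unfolding cb joint_moment_monom_diff[OF K] using 1 assms(4)[of K i] by (simp add: algebra_simps)
qed

lemma block_word_exists:
  "w \<noteq> [] \<Longrightarrow> \<exists>bs. block_word bs = w \<and> bs \<noteq> [] \<and> (\<forall>(i, K)\<in>set bs. K > 0)
     \<and> successively (\<lambda>q r. fst q \<noteq> fst r) bs"
proof (induction w)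
  case (Cons b w)
  show ?case
  proof (cases "w = []")
    case True
    then show ?thesis by (intro exI[of _ "[(b, 1)]"]) (simp add: block_word_def)
  next
    case False
    then obtain bs where bs: "block_word bs = w" "bs \<noteq> []" "\<forall>(i, K)\<in>set bs. K > 0"
        "successively (\<lambda>q r. fst q \<noteq> fst r) bs"
      using Cons.IH by blast
    then obtain i K r where r: "bs = (i, K) # r" by (metis list.exhaust surj_pair)
    show ?thesis
    proof (cases "b = i")
      case True
      then show ?thesis using bs r
        by (intro exI[of _ "(i, Suc K) # r"]) (auto simp: block_word_def successively_Cons)
    next
      case False
      then show ?thesis using bs r
        by (intro exI[of _ "(b, 1) # bs"]) (auto simp: block_word_def)
    qed
  qed
qed simp

text \<open>Both centred moments belonging to the maximal runs of equal letters vanish by freeness,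
  so the difference of the two values at the word is 0.\<close>

lemma freely_independent_unique:
  assumes "freely_independent \<tau>" "freely_independent \<tau>'"
    and marg: "\<And>i k. \<tau> (replicate k i) = \<tau>' (replicate k i)"
  shows "\<tau> w = \<tau>' w"
proof (induction "length w" arbitrary: w rule: less_induct)
  case less
  show ?case
  proof (cases "w = []")
    case True
    then show ?thesis using assms by (simp add: freely_independent_def)
  next
    case False
    then obtain bs where bs: "block_word bs = w" "bs \<noteq> []" "\<forall>(i, K)\<in>set bs. K > 0"
        "successively (\<lambda>q r. fst q \<noteq> fst r) bs"
      using block_word_exists by blast
    have "joint_moment \<sigma> [] (centred_blocks \<sigma> bs) = 0" if \<sigma>: "freely_independent \<sigma>" for \<sigma>
    proof -
      have fst: "fst ((\<lambda>(i, K). (i, monom 1 K - [:\<sigma> (replicate K i):])) b) = fst b" for b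
        by (cases b) simp
      have "centred_blocks \<sigma> bs \<noteq> []" using bs by (simp add: centred_blocks_def)
      moreover have "successively (\<lambda>q r. fst q \<noteq> fst r) (centred_blocks \<sigma> bs)"
        using bs(4) unfolding centred_blocks_def successively_map fst .
      moreover have "joint_moment \<sigma> [] [q] = 0" if mem: "q \<in> set (centred_blocks \<sigma> bs)" for q
      proof -
        obtain i K where q: "q = (i, monom 1 K - [:\<sigma> (replicate K i):])" "K > 0"
          using mem bs(3) by (auto simp: centred_blocks_def)
        have "\<sigma> [] = 1" using \<sigma> by (simp add: freely_independent_def)
        then show ?thesis unfolding q(1) joint_moment_monom_diff[OF q(2)] by simp
      qed
      ultimately show ?thesis using \<sigma> unfolding freely_independent_def by blast
    qed
    then show ?thesis
      using joint_moment_centred_blocks_diff[of "length w" \<tau> \<tau>' "[]" bs] less bs assms by simp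
  qed
qed

text \<open>Passage from Chebyshev polynomials of the first to the second kind. The right-hand side
  obeys the recursion with all coefficients 1; at height 0 the doubled coefficient makes up for the
  subtracted upward step.\<close>

lemma path_weight_cheb_diff:
  "path_weight (\<lambda>_. 1) k n = path_weight cheb_coeff k n - path_weight cheb_coeff k (Suc (Suc n))"
proof (induction k arbitrary: n)
  case (Suc k)
  then show ?case by (cases n) (simp_all add: cheb_coeff_def)
qed simp

section \<open>Reduction of spectral stability to coefficients\<close>

lemma path_weight_sum_cancel:
  assumes "\<And>k. (\<Sum>n=1..k. path_weight \<beta> k n * b n) = (\<Sum>n=1..k. path_weight \<beta> k n * b' n)"
  shows "n > 0 \<Longrightarrow> b n = b' n"
proof (induction n rule: less_induct)
  case (less n)
  have split: "{1..n} = insert n {1..<n}" using less.prems by auto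
  have "(\<Sum>j=1..<n. path_weight \<beta> n j * b j) = (\<Sum>j=1..<n. path_weight \<beta> n j * b' j)"
    using less.IH by (intro sum.cong) auto
  then show ?case using assms[of n] unfolding split by simp
qed

lemma (in orthogonal_weight) density_moments_admissible:
  assumes "f \<in> admissible \<phi>"
  shows "density_moments f k = (\<Sum>n=1..k. J k n * rcoef n f)"
proof (cases "k = 0")
  case False
  have "{..k} = insert 0 {1..k}" by auto
  then show ?thesis using assms False moment_eq[of f k] by (simp add: density_moments_def admissible_iff)
qed (simp add: density_moments_def)

text \<open>Unit triangularity turns equality of moment sequences into equality of coefficients of
  positive order; at order 0 both are 0 by admissibility. So \<open>is_differential\<close> becomes
  the hypothesis of \<open>diagonal_operator_spectrum\<close>.\<close>

lemma (in orthogonal_weight) strictly_spectrally_stableI: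
  assumes gateaux: "\<And>f z. f \<in> admissible \<phi> \<Longrightarrow>
    has_gateaux_derivative \<T> (measure_moments \<mu>) (density_moments f) z
      \<longleftrightarrow> z = (\<lambda>k. \<Sum>n=1..k. J k n * (eigenvalue n * rcoef n f))"
  shows "strictly_spectrally_stable \<T> \<phi> \<mu>"
proof -
  have iff: "is_differential \<T> \<phi> \<mu> D \<longleftrightarrow>
      (\<forall>f\<in>admissible \<phi>. D f \<in> admissible \<phi> \<and> (\<forall>n. rcoef n (D f) = eigenvalue n * rcoef n f))" for D
    unfolding is_differential_def
  proof (intro ball_cong refl conj_cong)
    fix f assume f: "f \<in> admissible \<phi>" and Df: "D f \<in> admissible \<phi>"
    have "density_moments (D f) = (\<lambda>k. \<Sum>n=1..k. J k n * (eigenvalue n * rcoef n f))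
        \<longleftrightarrow> (\<forall>n. rcoef n (D f) = eigenvalue n * rcoef n f)"
    proof
      assume eq: "density_moments (D f) = (\<lambda>k. \<Sum>n=1..k. J k n * (eigenvalue n * rcoef n f))"
      have "n > 0 \<Longrightarrow> rcoef n (D f) = eigenvalue n * rcoef n f" for n
        by (rule path_weight_sum_cancel[where \<beta> = \<beta>])
          (use eq density_moments_admissible[OF Df] in metis)
      moreover have "rcoef 0 (D f) = eigenvalue 0 * rcoef 0 f" using f Df by (simp add: admissible_iff)
      ultimately show "\<forall>n. rcoef n (D f) = eigenvalue n * rcoef n f" by (metis neq0_conv)
    qed (simp add: density_moments_admissible[OF Df] fun_eq_iff)
    then show "has_gateaux_derivative \<T> (measure_moments \<mu>) (density_moments f) (density_moments (D f))
      \<longleftrightarrow> (\<forall>n. rcoef n (D f) = eigenvalue n * rcoef n f)"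
      by (simp only: gateaux[OF f])
  qed
  show ?thesis
    unfolding strictly_spectrally_stable_def iff
  proof (intro conjI allI impI)
    fix D assume "\<forall>f\<in>admissible \<phi>. D f \<in> admissible \<phi> \<and> (\<forall>n. rcoef n (D f) = eigenvalue n * rcoef n f)"
    then have D: "\<And>f. f \<in> admissible \<phi> \<Longrightarrow> D f \<in> admissible \<phi>"
      "\<And>f n. f \<in> admissible \<phi> \<Longrightarrow> rcoef n (D f) = eigenvalue n * rcoef n f" by auto
    show "bounded_operator \<phi> (complex_space (admissible \<phi>)) (complexification D)"
      using D by (rule diagonal_operator_spectrum(1))
    show "op_spectrum \<phi> (complex_space (admissible \<phi>)) (complexification D) \<subseteq> ball 0 1"
      using D by (rule diagonal_operator_spectrum(2))
  qed (rule diagonal_operator_exists)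
qed

section \<open>The Gaussian distribution\<close>

lemma std_gaussian_eq: "std_gaussian = density lborel std_normal_density"
  by (simp add: std_gaussian_def std_normal_density_def)

lemma inverse_gauss_weight: "inverse (gauss_weight x) = sqrt (2 * pi) * std_normal_density x"
  using exp_minus[of "x\<^sup>2 / 2"] by (simp add: gauss_weight_def std_normal_density_def)

lemma gauss_moment_even: "gauss_moment (2 * k) = fact (2 * k) / (2 ^ k * fact k)"
proof -
  have "gauss_moment (2 * k) * (2 ^ k * fact k) = fact (2 * k)"
  proof (induction k)
    case (Suc k)
    have "gauss_moment (2 * Suc k) * (2 ^ Suc k * fact (Suc k))
        = real (Suc (2 * k)) * (2 * real (Suc k)) * (gauss_moment (2 * k) * (2 ^ k * fact k))"
      by (simp add: mult_ac)
    also have "\<dots> = fact (2 * Suc k)" unfolding Suc by (simp add: algebra_simps)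
    finally show ?case .
  qed simp
  then show ?thesis by (simp add: eq_divide_eq)
qed

lemma gauss_moment_odd: "odd k \<Longrightarrow> gauss_moment k = 0"
  by (induction k rule: gauss_moment.induct) auto

lemma std_gaussian_moment: "(\<integral>x. x ^ k \<partial>std_gaussian) = gauss_moment k"
  unfolding std_gaussian_eq
  using std_normal_distribution_even_moments[of "k div 2"]
    integral_std_normal_distribution_moment_odd[of k]
  by (cases "even k") (auto simp: gauss_moment_even gauss_moment_odd elim!: evenE)

text \<open>Completing the square turns \<open>exp (t * x)\<close> times the density into a multiple
  of the normal density with mean t; \<open>exp (s * \<bar>x\<bar>)\<close> is at most the sum of
  the exponentials with t = s and t = - s.\<close>

lemma integrable_exp_gauss: "integrable lborel (\<lambda>x. exp (s * \<bar>x\<bar>) * std_normal_density x)"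
proof -
  have shift: "exp (t * x) * std_normal_density x = exp (t\<^sup>2 / 2) * normal_density t 1 x" for t x
    by (simp add: normal_density_def exp_add[symmetric] power2_eq_square field_simps)
  have i: "integrable lborel (\<lambda>x. exp (t * x) * std_normal_density x)" for t
    unfolding shift using integrable_normal_moment[of 1 t 0] by simp
  show ?thesis
  proof (rule Bochner_Integration.integrable_bound[OF Bochner_Integration.integrable_add[OF i[of s] i[of "- s"]]])
    show "AE x in lborel. norm (exp (s * \<bar>x\<bar>) * std_normal_density x)
       \<le> norm (exp (s * x) * std_normal_density x + exp (- s * x) * std_normal_density x)"
    proof (intro AE_I2)
      fix x
      have "0 \<le> exp t * std_normal_density x" for t by (simp add: normal_density_nonneg)
      then show "norm (exp (s * \<bar>x\<bar>) * std_normal_density x)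
         \<le> norm (exp (s * x) * std_normal_density x + exp (- s * x) * std_normal_density x)"
        by (cases "x \<ge> 0") (simp_all only: real_norm_def abs_of_nonneg abs_of_neg add_nonneg_nonneg not_le
            mult_minus_left mult_minus_right le_add_same_cancel1 le_add_same_cancel2)
    qed
  qed measurable
qed

interpretation gauss: orthogonal_weight gauss_weight real "sqrt (2 * pi)"
proof
  show "gauss_weight \<in> borel_measurable borel" unfolding gauss_weight_def by measurable
  show "integrable lborel (\<lambda>x. exp (s * \<bar>x\<bar>) * inverse (gauss_weight x))" for s
    using integrable_mult_right[OF integrable_exp_gauss[of s], of "sqrt (2 * pi)"]
    by (simp add: inverse_gauss_weight mult_ac)
  have "(\<integral>x. x ^ k \<partial>std_gaussian) = (\<integral>x. std_normal_density x * x ^ k \<partial>lborel)" for k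
    unfolding std_gaussian_eq by (subst integral_density) (auto simp: normal_density_nonneg)
  moreover have "(\<integral>x. x ^ k * inverse (gauss_weight x) \<partial>lborel)
      = (\<integral>x. sqrt (2 * pi) * (std_normal_density x * x ^ k) \<partial>lborel)" for k
    by (simp only: inverse_gauss_weight mult_ac)
  ultimately show "(\<integral>x. x ^ k * inverse (gauss_weight x) \<partial>lborel) = sqrt (2 * pi) * path_weight real k 0" for k
    by (simp only: integral_mult_right_zero) (simp add: std_gaussian_moment path_weight_hermite)
qed (auto simp: gauss_weight_def)

lemma classical_moments_unit: "classical_moments unit_cumulants = measure_moments std_gaussian"
  by (rule ext) (simp only: classical_moments_exp exp_moments_unit measure_moments_def std_gaussian_moment)

lemma std_gaussian_std_distributions: "std_gaussian \<in> std_distributions gauss_weight"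
proof -
  have "(1 / sqrt (2 * pi) * exp (- x\<^sup>2 / 2))\<^sup>2 * gauss_weight x = 1 / sqrt (2 * pi) * std_normal_density x" for x
    by (simp add: gauss_weight_def std_normal_density_def power_mult_distrib power2_eq_square exp_add[symmetric] field_simps)
  then have "(\<lambda>x. 1 / sqrt (2 * pi) * exp (- x\<^sup>2 / 2)) \<in> L2_weighted gauss_weight"
    using integrable_normal_density[of 1 0] by (simp add: L2_weighted_def) (simp add: gauss_weight_def)
  moreover have "prob_space std_gaussian" unfolding std_gaussian_eq by (rule prob_space_normal_density) simp
  moreover have "(\<integral>x. x \<partial>std_gaussian) = 0" "(\<integral>x. x\<^sup>2 \<partial>std_gaussian) = 1"
    using std_gaussian_moment[of 1] std_gaussian_moment[of 2] by (simp_all add: numeral_2_eq_2)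
  ultimately show ?thesis
    unfolding std_distributions_def mem_Collect_eq
    by (intro conjI bexI[of _ "\<lambda>x. 1 / sqrt (2 * pi) * exp (- x\<^sup>2 / 2)"]) (simp_all add: std_gaussian_def)
qed

lemma classical_clt_std_gaussian: "classical_clt std_gaussian = std_gaussian"
proof -
  have fin: "finite_measure (density lborel std_normal_density)"
    by (intro prob_space.finite_measure prob_space_normal_density) simp
  have "std_gaussian \<star> std_gaussian
      = density lborel (\<lambda>x. \<integral>\<^sup>+y. ennreal (std_normal_density (x - y)) * ennreal (std_normal_density y) \<partial>lborel)"
    unfolding std_gaussian_eq by (intro convolution_density fin) auto
  also have "\<dots> = density lborel (normal_density 0 (sqrt 2))"
    using conv_normal_density_zero_mean[of 1 1] by (simp add: ennreal_mult normal_density_nonneg)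
  finally have conv: "std_gaussian \<star> std_gaussian = density lborel (normal_density 0 (sqrt 2))" .
  let ?M = "density lborel (\<lambda>x. ennreal (normal_density 0 (sqrt 2) x))"
  interpret prob_space ?M by (rule prob_space_normal_density) simp
  have "distributed ?M lborel (\<lambda>x. x) (normal_density 0 (sqrt 2))"
    unfolding distributed_def by (auto intro!: distr_id2)
  from normal_density_affine[OF this, of "1 / sqrt 2" 0]
  have "distr ?M lborel (\<lambda>x. 1 / sqrt 2 * x) = density lborel std_normal_density"
    by (simp add: distributed_def)
  moreover have "distr ?M lborel (\<lambda>x. 1 / sqrt 2 * x) = distr ?M borel (\<lambda>x. 1 / sqrt 2 * x)"
    by (rule distr_cong) auto
  ultimately have "dilation (1 / sqrt 2) ?M = std_gaussian" by (simp only: dilation_def std_gaussian_eq)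
  then show ?thesis by (simp only: classical_clt_def conv)
qed

lemma strictly_spectrally_stable_std_gaussian:
  "strictly_spectrally_stable (clt_sequence classical_moments) gauss_weight std_gaussian"
proof (rule gauss.strictly_spectrally_stableI)
  fix f z assume f: "f \<in> admissible gauss_weight"
  show "has_gateaux_derivative (clt_sequence classical_moments) (measure_moments std_gaussian) (density_moments f) z
    \<longleftrightarrow> z = (\<lambda>k. \<Sum>n=1..k. path_weight real k n * (eigenvalue n * gauss.rcoef n f))"
    unfolding classical_moments_unit[symmetric] classical_moments_eq[symmetric]
  proof (rule classical.gateaux_derivative_clt_sequence)
    show "((\<lambda>\<epsilon>. classical.moments (c \<epsilon>) k) has_real_derivative (\<Sum>n=1..k. fact (n - 1) * path_weight real k n * d n)) (at 0)"
      if "\<And>j. ((\<lambda>\<epsilon>. c \<epsilon> j) has_real_derivative d j) (at 0)" "c 0 = unit_cumulants" for c d k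
      unfolding classical_moments_eq by (rule classical_moments_derivative[OF that])
    show "density_moments f 0 = 0" by (simp add: density_moments_def)
  qed (rule gauss.density_moments_admissible[OF f])
qed

section \<open>The semicircular distribution\<close>

lemma inverse_semicircle_weight:
  "inverse (semicircle_weight t) = indicator {-2..2} t * (1 / sqrt (4 - t\<^sup>2))"
  by (simp add: semicircle_weight_def indicator_def divide_inverse)

lemma four_minus_square_pos: "\<bar>t\<bar> < 2 \<Longrightarrow> 0 < 4 - (t :: real)\<^sup>2"
  using power_strict_mono[of "\<bar>t\<bar>" 2 2] by simp

lemma four_minus_square_nonneg: "\<bar>t\<bar> \<le> 2 \<Longrightarrow> 0 \<le> 4 - (t :: real)\<^sup>2"
  using abs_le_square_iff[of t 2] by simp

lemma orth_poly_cheb: "orth_poly cheb_coeff n (2 * cos \<theta>) = (if n = 0 then 1 else 2 * cos (real n * \<theta>))"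
proof (induction n rule: induct_nat_012)
  case (ge2 n)
  have "cos (real (Suc (Suc n)) * \<theta>) + cos (real n * \<theta>) = 2 * cos \<theta> * cos (real (Suc n) * \<theta>)"
    using cos_plus_cos[of "real (Suc (Suc n)) * \<theta>" "real n * \<theta>"] by (simp add: algebra_simps add_divide_distrib)
  then show ?case using ge2 by (cases n) (simp_all add: cheb_coeff_def algebra_simps)
qed auto

lemma arccos_half_has_derivative:
  assumes "\<bar>x\<bar> < 2"
  shows "((\<lambda>x. arccos (x / 2)) has_real_derivative - (1 / sqrt (4 - x\<^sup>2))) (at x)"
proof -
  have "sqrt (1 - (x / 2)\<^sup>2) = sqrt (4 - x\<^sup>2) / 2"
    using real_sqrt_divide[of "4 - x\<^sup>2" 4] by (simp add: power_divide diff_divide_distrib)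
  moreover have "sqrt (4 - x\<^sup>2) > 0" using four_minus_square_pos[OF assms] by simp
  moreover have "((\<lambda>x. arccos (x / 2)) has_real_derivative inverse (- sqrt (1 - (x / 2)\<^sup>2)) * (1 / 2)) (at x)"
    using assms by (intro DERIV_chain2[OF DERIV_arccos] DERIV_cdivide DERIV_ident) auto
  ultimately show ?thesis by (simp add: field_simps)
qed

text \<open>The antiderivative is that of the substitution x = 2 cos \<theta>. It is continuous up
  to the endpoints, where the integrand is singular, so the interior form of the fundamental theorem
  applies.\<close>

lemma has_integral_cheb:
  "((\<lambda>x. orth_poly cheb_coeff n x * (1 / sqrt (4 - x\<^sup>2))) has_integral (if n = 0 then pi else 0)) {-2..2}"
proof -
  define F where "F x = (if n = 0 then - arccos (x / 2) else - (2 / n) * sin (n * arccos (x / 2)))" for x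
  have "((\<lambda>x. orth_poly cheb_coeff n x * (1 / sqrt (4 - x\<^sup>2))) has_integral F 2 - F (-2)) {-2..2}"
  proof (rule fundamental_theorem_of_calculus_interior)
    show "continuous_on {-2..2} F"
      unfolding F_def by (cases "n = 0") (auto intro!: continuous_intros)
    fix x :: real assume "x \<in> {-2<..<2}"
    then have x: "\<bar>x\<bar> < 2" by auto
    have p: "orth_poly cheb_coeff n x = (if n = 0 then 1 else 2 * cos (real n * arccos (x / 2)))"
      using orth_poly_cheb[of n "arccos (x / 2)"] x by (simp add: cos_arccos_abs)
    show "(F has_vector_derivative orth_poly cheb_coeff n x * (1 / sqrt (4 - x\<^sup>2))) (at x)"
      unfolding has_real_derivative_iff_has_vector_derivative[symmetric] p
    proof (cases "n = 0")
      case True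
      then show "(F has_real_derivative (if n = 0 then 1 else 2 * cos (real n * arccos (x / 2))) * (1 / sqrt (4 - x\<^sup>2))) (at x)"
        using DERIV_minus[OF arccos_half_has_derivative[OF x]] by (simp add: F_def[abs_def])
    next
      case False
      then show "(F has_real_derivative (if n = 0 then 1 else 2 * cos (real n * arccos (x / 2))) * (1 / sqrt (4 - x\<^sup>2))) (at x)"
        using DERIV_cmult[OF DERIV_chain2[OF DERIV_sin DERIV_cmult[OF arccos_half_has_derivative[OF x], of "real n"]], of "- (2 / real n)"]
        by (simp add: F_def[abs_def])
    qed
  qed simp
  moreover have "F 2 - F (-2) = (if n = 0 then pi else 0)"
    by (simp add: F_def)
  ultimately show ?thesis by simp
qed

lemma borel_measurable_semicircle_weight [measurable]: "semicircle_weight \<in> borel_measurable borel"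
  unfolding semicircle_weight_def by measurable

lemma semicircle_weight_nonneg: "semicircle_weight t \<ge> 0"
  using four_minus_square_nonneg[of t] by (simp add: semicircle_weight_def indicator_def abs_le_iff)

lemma has_integral_cheb_UNIV:
  "((\<lambda>x. orth_poly cheb_coeff n x * inverse (semicircle_weight x)) has_integral (if n = 0 then pi else 0)) UNIV"
proof -
  have "(\<lambda>x. orth_poly cheb_coeff n x * inverse (semicircle_weight x))
      = (\<lambda>x. if x \<in> {-2..2} then orth_poly cheb_coeff n x * (1 / sqrt (4 - x\<^sup>2)) else 0)"
    by (auto simp: inverse_semicircle_weight)
  then show ?thesis using has_integral_cheb[of n] by (simp only: has_integral_restrict_UNIV)
qed

lemma integrable_inverse_semicircle_weight: "integrable lborel (\<lambda>x. inverse (semicircle_weight x))"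
proof (rule integrableI_nonneg)
  have "(\<integral>\<^sup>+x. ennreal (inverse (semicircle_weight x)) \<partial>lborel) = ennreal pi"
    using has_integral_cheb_UNIV[of 0] semicircle_weight_nonneg
    by (intro nn_integral_has_integral_lborel) auto
  then show "(\<integral>\<^sup>+x. ennreal (inverse (semicircle_weight x)) \<partial>lborel) < \<infinity>" by simp
qed (use semicircle_weight_nonneg in auto)

lemma integrable_bounded_semicircle:
  assumes [measurable]: "q \<in> borel_measurable borel" and q: "\<And>x. \<bar>x\<bar> \<le> 2 \<Longrightarrow> \<bar>q x\<bar> \<le> C"
  shows "integrable lborel (\<lambda>x. q x * inverse (semicircle_weight x))"
proof (rule Bochner_Integration.integrable_bound[OF integrable_mult_right[OF integrable_inverse_semicircle_weight, of C]])
  show "AE x in lborel. norm (q x * inverse (semicircle_weight x)) \<le> norm (C * inverse (semicircle_weight x))"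
  proof (intro AE_I2)
    fix x
    show "norm (q x * inverse (semicircle_weight x)) \<le> norm (C * inverse (semicircle_weight x))"
    proof (cases "\<bar>x\<bar> \<le> 2")
      case True
      then show ?thesis using q[OF True] by (auto simp: abs_mult intro!: mult_right_mono)
    qed (auto simp: semicircle_weight_def indicator_def)
  qed
qed measurable

lemma integrable_cheb: "integrable lborel (\<lambda>x. orth_poly cheb_coeff n x * inverse (semicircle_weight x))"
proof (rule integrable_bounded_semicircle[where C = 2])
  fix x :: real assume "\<bar>x\<bar> \<le> 2"
  then have "orth_poly cheb_coeff n x = (if n = 0 then 1 else 2 * cos (real n * arccos (x / 2)))"
    using orth_poly_cheb[of n "arccos (x / 2)"] by (simp add: cos_arccos_abs)
  then show "\<bar>orth_poly cheb_coeff n x\<bar> \<le> 2" by (simp add: abs_mult)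
qed measurable

interpretation semicircle: orthogonal_weight semicircle_weight cheb_coeff pi
proof
  show "integrable lborel (\<lambda>x. exp (s * \<bar>x\<bar>) * inverse (semicircle_weight x))" for s
  proof (rule integrable_bounded_semicircle)
    fix x :: real assume "\<bar>x\<bar> \<le> 2"
    then have "s * \<bar>x\<bar> \<le> \<bar>s\<bar> * 2" by (intro order_trans[OF mult_right_mono[OF abs_ge_self] mult_left_mono]) auto
    then show "\<bar>exp (s * \<bar>x\<bar>)\<bar> \<le> exp (\<bar>s\<bar> * 2)" by simp
  qed measurable
  \<comment> \<open>Only the polynomial of order 0 has nonzero integral, so the expansion of a power
    leaves the column 0 of \<open>path_weight\<close>.\<close>
  have int: "(\<integral>x. orth_poly cheb_coeff n x * inverse (semicircle_weight x) \<partial>lborel) = (if n = 0 then pi else 0)" for n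
    using has_integral_unique[OF has_integral_integral_lborel[OF integrable_cheb] has_integral_cheb_UNIV] .
  show "(\<integral>x. x ^ k * inverse (semicircle_weight x) \<partial>lborel) = pi * path_weight cheb_coeff k 0" for k
  proof -
    have "(\<integral>x. x ^ k * inverse (semicircle_weight x) \<partial>lborel)
        = (\<integral>x. (\<Sum>n\<le>k. path_weight cheb_coeff k n * (orth_poly cheb_coeff n x * inverse (semicircle_weight x))) \<partial>lborel)"
      by (subst power_eq_sum_orth_poly[where \<beta> = cheb_coeff]) (simp add: sum_distrib_right sum_distrib_left mult_ac)
    also have "\<dots> = (\<Sum>n\<le>k. path_weight cheb_coeff k n * (if n = 0 then pi else 0))"
      using integrable_cheb by (subst Bochner_Integration.integral_sum) (auto simp: int)
    also have "\<dots> = pi * path_weight cheb_coeff k 0"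
      by (simp add: if_distrib[of "(*) _"] cong: if_cong)
    finally show ?thesis .
  qed
qed (auto simp: semicircle_weight_nonneg cheb_coeff_def)

section \<open>The semicircle law and its free convolution square\<close>

definition semicircle_density :: "real \<Rightarrow> real" where
  "semicircle_density t = indicator {-2..2} t * (1 / (2 * pi) * sqrt (4 - t\<^sup>2))"

lemma borel_measurable_semicircle_density [measurable]: "semicircle_density \<in> borel_measurable borel"
  unfolding semicircle_density_def by measurable

lemma semicircle_density_nonneg: "semicircle_density t \<ge> 0"
  using four_minus_square_nonneg[of t] by (simp add: semicircle_density_def indicator_def abs_le_iff)

lemma std_semicircle_eq: "std_semicircle = density lborel (\<lambda>t. ennreal (semicircle_density t))"
  by (simp only: std_semicircle_def semicircle_density_def)

lemma semicircle_density_eq: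
  "semicircle_density t = (1 / (2 * pi)) * ((4 - t\<^sup>2) * inverse (semicircle_weight t))"
proof (cases "\<bar>t\<bar> \<le> 2")
  case True
  then have "sqrt (4 - t\<^sup>2) * sqrt (4 - t\<^sup>2) = 4 - t\<^sup>2" using four_minus_square_nonneg[OF True] by simp
  then have "(4 - t\<^sup>2) * inverse (sqrt (4 - t\<^sup>2)) = sqrt (4 - t\<^sup>2)"
    by (metis divide_inverse nonzero_mult_div_cancel_right mult_zero_left)
  then show ?thesis using True by (auto simp: semicircle_density_def semicircle_weight_def indicator_def abs_le_iff)
next
  case False
  then show ?thesis by (auto simp: semicircle_density_def semicircle_weight_def indicator_def)
qed

lemma integrable_semicircle_density: "integrable lborel (\<lambda>x. x ^ k * semicircle_density x)"
  and integral_semicircle_density: "(\<integral>x. x ^ k * semicircle_density x \<partial>lborel) = path_weight (\<lambda>_. 1) k 0"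
proof -
  let ?w = "\<lambda>x. inverse (semicircle_weight x)"
  have eq: "x ^ k * semicircle_density x = (1 / (2 * pi)) * (4 * (x ^ k * ?w x) - x ^ (k + 2) * ?w x)" for x
    unfolding semicircle_density_eq by (simp add: algebra_simps power_add power2_eq_square)
  have i: "integrable lborel (\<lambda>x. x ^ j * ?w x)" for j
    by (intro semicircle.integrable_exp_bounded exp_bounded_intros)
  show "integrable lborel (\<lambda>x. x ^ k * semicircle_density x)"
    unfolding eq by (intro integrable_mult_right Bochner_Integration.integrable_diff i)
  have "(\<integral>x. x ^ k * semicircle_density x \<partial>lborel)
      = (1 / (2 * pi)) * (4 * (pi * path_weight cheb_coeff k 0) - pi * path_weight cheb_coeff (k + 2) 0)"
    unfolding eq integral_mult_right_zero semicircle.weight_moments[symmetric]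
    using i[of k] i[of "k + 2"] by (subst Bochner_Integration.integral_diff) auto
  \<comment> \<open>Two steps of the path recursion give twice the sum of the entries at heights 0
    and 2, which leaves their difference.\<close>
  also have "\<dots> = path_weight (\<lambda>_. 1) k 0"
    unfolding path_weight_cheb_diff[of k 0] by (simp add: cheb_coeff_def numeral_2_eq_2 field_simps)
  finally show "(\<integral>x. x ^ k * semicircle_density x \<partial>lborel) = path_weight (\<lambda>_. 1) k 0" .
qed

lemma std_semicircle_moment: "(\<integral>x. x ^ k \<partial>std_semicircle) = path_weight (\<lambda>_. 1) k 0"
  unfolding std_semicircle_eq integral_semicircle_density[symmetric]
  by (subst integral_density) (auto simp: semicircle_density_nonneg mult.commute)

lemma sets_std_semicircle [simp, measurable_cong]: "sets std_semicircle = sets borel"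
  by (simp add: std_semicircle_eq)

lemma prob_space_std_semicircle: "prob_space std_semicircle"
  unfolding std_semicircle_eq
  using integrable_semicircle_density[of 0] integral_semicircle_density[of 0]
  by (intro prob_spaceI) (simp add: emeasure_density nn_integral_eq_integral semicircle_density_nonneg)

lemma AE_std_semicircle: "AE x in std_semicircle. \<bar>x\<bar> \<le> 2"
  unfolding std_semicircle_eq
  by (subst AE_density) (auto simp: semicircle_density_def indicator_def intro!: AE_I2)

lemma std_semicircle_std_distributions: "std_semicircle \<in> std_distributions semicircle_weight"
proof -
  have "(semicircle_density t)\<^sup>2 * semicircle_weight t
      = (1 / (4 * pi\<^sup>2)) * ((4 - t\<^sup>2)\<^sup>2 * inverse (semicircle_weight t))" for t
  proof (cases "semicircle_weight t = 0")
    case False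
    then show ?thesis unfolding semicircle_density_eq by (simp add: power2_eq_square field_simps)
  qed simp
  moreover have "integrable lborel (\<lambda>t. (4 + (- 1) * t\<^sup>2)\<^sup>2 * inverse (semicircle_weight t))"
    by (intro semicircle.integrable_exp_bounded exp_bounded_intros)
  ultimately have "semicircle_density \<in> L2_weighted semicircle_weight"
    by (simp add: L2_weighted_def) (simp add: semicircle_density_def semicircle_weight_def)
  moreover have "(\<integral>x. x \<partial>std_semicircle) = 0" "(\<integral>x. x\<^sup>2 \<partial>std_semicircle) = 1"
    using std_semicircle_moment[of 1] std_semicircle_moment[of 2] by (simp_all add: numeral_2_eq_2)
  ultimately show ?thesis
    unfolding std_distributions_def mem_Collect_eq
    by (intro conjI bexI[of _ semicircle_density] prob_space_std_semicircle)
      (simp_all add: std_semicircle_eq semicircle_density_nonneg)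
qed

lemma integrable_exp_bounded_support:
  assumes "prob_space M" and [measurable_cong]: "sets M = sets borel" and R: "AE x in M. \<bar>x\<bar> \<le> R"
  shows "integrable M (\<lambda>x. exp (s * \<bar>x\<bar>) :: real)"
proof -
  interpret prob_space M by fact
  show ?thesis
  proof (rule integrable_const_bound[where B = "exp (\<bar>s\<bar> * R)"])
    show "AE x in M. norm (exp (s * \<bar>x\<bar>)) \<le> exp (\<bar>s\<bar> * R)"
      using R
    proof eventually_elim
      case (elim x)
      then have "s * \<bar>x\<bar> \<le> \<bar>s\<bar> * R" by (intro order_trans[OF mult_right_mono[OF abs_ge_self] mult_left_mono]) auto
      then show ?case by simp
    qed
  qed measurable
qed

text \<open>The Fock state is the witness for existence. For uniqueness, any other joint
  distribution with these marginals equals the Fock state, and bounded support makes the moments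
  determine the measure.\<close>

lemma free_convolution_std_semicircle: "std_semicircle \<boxplus> std_semicircle = dilation (sqrt 2) std_semicircle"
proof -
  interpret prob_space std_semicircle by (rule prob_space_std_semicircle)
  let ?\<rho> = "dilation (sqrt 2) std_semicircle"
  have prob: "prob_space ?\<rho>" unfolding dilation_def by (intro prob_space_distr) measurable
  have sets: "sets ?\<rho> = sets borel" by (simp add: dilation_def)
  have AE: "AE x in ?\<rho>. \<bar>x\<bar> \<le> sqrt 2 * 2"
    unfolding dilation_def using AE_std_semicircle by (subst AE_distr_iff) (auto simp: abs_mult)
  have mom: "(\<integral>x. x ^ k \<partial>?\<rho>) = sqrt 2 ^ k * path_weight (\<lambda>_. 1) k 0" for k
    unfolding dilation_def by (subst integral_distr) (auto simp: power_mult_distrib std_semicircle_moment)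
  show ?thesis
    unfolding free_convolution_def
  proof (rule the_equality)
    show "prob_space ?\<rho> \<and> sets ?\<rho> = sets borel \<and> (\<exists>R. AE x in ?\<rho>. \<bar>x\<bar> \<le> R) \<and>
        (\<exists>\<tau>. freely_independent \<tau> \<and> (\<forall>k. \<tau> (replicate k False) = (\<integral>x. x ^ k \<partial>std_semicircle)) \<and>
          (\<forall>k. \<tau> (replicate k True) = (\<integral>x. x ^ k \<partial>std_semicircle)) \<and>
          (\<forall>k. (\<integral>x. x ^ k \<partial>?\<rho>) = (\<Sum>w | length w = k. \<tau> w)))"
      using prob sets AE
      by (intro conjI exI[of _ "sqrt 2 * 2"] exI[of _ fock_state])
        (simp_all add: freely_independent_fock_state fock_state_replicate std_semicircle_moment mom sum_words_fock_state)
  next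
    fix \<rho> assume *: "prob_space \<rho> \<and> sets \<rho> = sets borel \<and> (\<exists>R. AE x in \<rho>. \<bar>x\<bar> \<le> R) \<and>
        (\<exists>\<tau>. freely_independent \<tau> \<and> (\<forall>k. \<tau> (replicate k False) = (\<integral>x. x ^ k \<partial>std_semicircle)) \<and>
          (\<forall>k. \<tau> (replicate k True) = (\<integral>x. x ^ k \<partial>std_semicircle)) \<and>
          (\<forall>k. (\<integral>x. x ^ k \<partial>\<rho>) = (\<Sum>w | length w = k. \<tau> w)))"
    then obtain \<tau> R where \<rho>: "prob_space \<rho>" "sets \<rho> = sets borel" "AE x in \<rho>. \<bar>x\<bar> \<le> R"
      and \<tau>: "freely_independent \<tau>" "\<And>k. \<tau> (replicate k False) = (\<integral>x. x ^ k \<partial>std_semicircle)"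
        "\<And>k. \<tau> (replicate k True) = (\<integral>x. x ^ k \<partial>std_semicircle)"
        "\<And>k. (\<integral>x. x ^ k \<partial>\<rho>) = (\<Sum>w | length w = k. \<tau> w)"
      by auto
    have "\<tau> (replicate k i) = fock_state (replicate k i)" for k i
      using \<tau>(2,3) by (cases i) (simp_all add: fock_state_replicate std_semicircle_moment)
    then have "\<tau> w = fock_state w" for w
      by (rule freely_independent_unique[OF \<tau>(1) freely_independent_fock_state])
    then have "(\<integral>x. x ^ k \<partial>\<rho>) = (\<integral>x. x ^ k \<partial>?\<rho>)" for k
      using \<tau>(4)[of k] by (simp add: mom sum_words_fock_state)
    then show "\<rho> = ?\<rho>"
      by (rule prob_measure_eqI_moments[OF \<rho>(1,2) integrable_exp_bounded_support[OF \<rho>]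
          prob sets integrable_exp_bounded_support[OF prob sets AE]])
  qed
qed

lemma free_clt_std_semicircle: "free_clt std_semicircle = std_semicircle"
  unfolding free_clt_def free_convolution_std_semicircle dilation_def
  by (subst distr_distr) (auto simp: comp_def intro: distr_id2)

lemma free_moments_unit_eq: "free_moments unit_cumulants = measure_moments std_semicircle"
  using path_weight_cheb_diff[of _ 0]
  by (auto simp: fun_eq_iff free_moments_unit measure_moments_def std_semicircle_moment numeral_2_eq_2)

lemma strictly_spectrally_stable_std_semicircle:
  "strictly_spectrally_stable (clt_sequence free_moments) semicircle_weight std_semicircle"
proof (rule semicircle.strictly_spectrally_stableI)
  fix f z assume f: "f \<in> admissible semicircle_weight"
  show "has_gateaux_derivative (clt_sequence free_moments) (measure_moments std_semicircle) (density_moments f) z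
    \<longleftrightarrow> z = (\<lambda>k. \<Sum>n=1..k. path_weight cheb_coeff k n * (eigenvalue n * semicircle.rcoef n f))"
    unfolding free_moments_unit_eq[symmetric] free_moments_eq[symmetric]
  proof (rule free.gateaux_derivative_clt_sequence)
    show "((\<lambda>\<epsilon>. free.moments (c \<epsilon>) k) has_real_derivative (\<Sum>n=1..k. 1 * path_weight cheb_coeff k n * d n)) (at 0)"
      if "\<And>j. ((\<lambda>\<epsilon>. c \<epsilon> j) has_real_derivative d j) (at 0)" "c 0 = unit_cumulants" for c d k
      unfolding free_moments_eq mult_1_left by (rule free_moments_derivative[OF that])
    show "density_moments f 0 = 0" by (simp add: density_moments_def)
  qed (rule semicircle.density_moments_admissible[OF f])
qed

theorem corollary2p6:
  shows "(std_gaussian \<in> std_distributions gauss_weight \<and>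
          classical_clt std_gaussian = std_gaussian \<and>
          strictly_spectrally_stable (clt_sequence classical_moments) gauss_weight std_gaussian) \<and>
         (std_semicircle \<in> std_distributions semicircle_weight \<and>
          free_clt std_semicircle = std_semicircle \<and>
          strictly_spectrally_stable (clt_sequence free_moments) semicircle_weight std_semicircle)"
  by (intro conjI std_gaussian_std_distributions classical_clt_std_gaussian strictly_spectrally_stable_std_gaussian
      std_semicircle_std_distributions free_clt_std_semicircle strictly_spectrally_stable_std_semicircle)

end
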